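(* Let $N\ge 1$ be an integer, and for $\beta>0$, $\theta\in\mathbb{R}$ let $Z[\beta,\theta]$ be the partition function of ultra-local lattice Maxwell theory with $\theta$-term in the modified Villain formulation on the periodic lattice $(\mathbb{Z}/N\mathbb{Z})^4$ (defined in the context). Put $$\tau=\frac{\theta}{2\pi}+2\pi i\beta,\qquad \tilde\beta=\frac{\beta}{(2\pi\beta)^2+(\theta/2\pi)^2},\qquad \tilde\theta=\frac{-\theta}{(2\pi\beta)^2+(\theta/2\pi)^2},$$ so that $-1/\tau=\tilde\theta/(2\pi)+2\pi i\tilde\beta$. Then for all $\beta>0$, $\theta\in\mathbb{R}$, $$Z[\beta,\theta+2\pi]=Z[\beta,\theta],\qquad Z[\beta,\theta]=\Big(\sqrt{\tilde\beta/\beta}\Big)^{3N^4}Z[\tilde\beta,\tilde\theta].$$ Consequently the rescaled partition function $\bar Z[\tau]:=\big(\sqrt{\beta}\big)^{3N^4}Z[\beta,\theta]$, regarded as a function of $\tau$ in the upper half plane, is invariant under the full modular group: $$\bar Z\Big[\frac{a\tau+b}{c\tau+d}\Big]=\bar Z[\tau]\qquad\text{for all }\begin{pmatrix}a&b\\c&d\end{pmatrix}\in\mathrm{SL}(2,\mathbb{Z}).$$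
   Context: Lattice: $\Lambda=(\mathbb{Z}/N\mathbb{Z})^4$, with unit vectors $\hat\mu$, $\mu=1,\dots,4$. An $r$-form $\alpha$ assigns a value $\alpha_{x,\mu_1\cdots\mu_r}$ to each site $x$ and indices $\mu_i\in\{1,2,3,4\}$, antisymmetric in the indices. Exterior derivative of an $r$-form: $(d\alpha)_{x,\mu_1\cdots\mu_{r+1}}=\sum_{j=1}^{r+1}(-1)^{j+1}[\alpha_{x+\hat\mu_j,\mu_1\cdots\mathring{\mu}_j\cdots\mu_{r+1}}-\alpha_{x,\mu_1\cdots\mathring{\mu}_j\cdots\mu_{r+1}}]$, where $\mathring{\mu}_j$ means the index is omitted. Fields: a real 1-form $A^e$ with $A^e_{x,\mu}\in[-\pi,\pi)$ and an integer-valued 2-form $n$. Field strength: $F^e=dA^e+2\pi n$. Topological charge: $$Q_0[F^e]=\frac{1}{8\pi^2}\sum_x\sum_{\mu<\nu,\ \rho<\sigma}\epsilon_{\mu\nu\rho\sigma}F^e_{x,\mu\nu}F^e_{x+\hat\mu+\hat\nu,\rho\sigma},$$ with $\epsilon$ the Levi-Civita symbol. Partition function: $$Z[\beta,\theta]=\int DA^e\sum_{\{n\}}\exp\Big(-\frac{\beta}{2}\sum_x\sum_{\mu<\nu}(F^e_{x,\mu\nu})^2-i\theta Q_0[F^e]\Big)\prod_x\prod_{\mu<\nu<\rho}\delta_{(dn)_{x,\mu\nu\rho},0},$$ where $\int DA^e=\prod_{x,\mu}\int_{-\pi}^{\pi}\frac{dA^e_{x,\mu}}{2\pi}$ and the sum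 is over all integer-valued 2-forms $n$ (each $n_{x,\mu\nu}$, $\mu<\nu$, independently over $\mathbb{Z}$). *)

theory Defs
  imports "HOL-Analysis.Analysis" "HOL-Combinatorics.Permutations"
begin

text \<open>
  A site of the periodic lattice is the vector of its four coordinates, each the representative in
  \<open>{0..<N}\<close> of its class modulo \<open>N\<close>. An \<open>r\<close>-form is a function of a site and a list of \<open>r\<close>
  directions from \<open>{1..4}\<close>.
\<close>

type_synonym site = "nat \<Rightarrow> nat"

type_synonym 'a form = "site \<times> nat list \<Rightarrow> 'a"

definition lattice :: "nat \<Rightarrow> site set" where
  "lattice N = {1..4} \<rightarrow>\<^sub>E {0..<N}"

text \<open>\<open>shift N x \<mu>\<close> is the neighbouring site \<open>x\<close> plus the unit vector in direction \<open>\<mu>\<close>.\<close>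

definition shift :: "nat \<Rightarrow> site \<Rightarrow> nat \<Rightarrow> site" where
  "shift N x \<mu> = x(\<mu> := (x \<mu> + 1) mod N)"

definition indices :: "nat \<Rightarrow> nat list set" where
  "indices r = {\<mu>s. length \<mu>s = r \<and> set \<mu>s \<subseteq> {1..4}}"

definition increasing_indices :: "nat \<Rightarrow> nat list set" where
  "increasing_indices r = {\<mu>s \<in> indices r. sorted_wrt (<) \<mu>s}"

text \<open>
  Forms are extensional (\<open>undefined\<close> off the lattice), so that each form is represented by exactly
  one function. This matters for the sum over all integer-valued 2-forms.
\<close>

definition forms :: "nat \<Rightarrow> nat \<Rightarrow> 'a::ab_group_add form set" where
  "forms N r = {\<alpha> \<in> extensional (lattice N \<times> indices r).
     \<forall>x\<in>lattice N. \<forall>\<mu>s\<in>indices r. \<forall>i j. i < j \<and> j < r \<longrightarrow>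
       \<alpha> (x, \<mu>s[i := \<mu>s ! j, j := \<mu>s ! i]) = - \<alpha> (x, \<mu>s)}"

definition omit_nth :: "nat \<Rightarrow> 'a list \<Rightarrow> 'a list" where
  "omit_nth j xs = take j xs @ drop (Suc j) xs"

text \<open>List positions start at 0, hence the sign \<open>(-1) ^ j\<close> instead of \<open>(-1) ^ (j + 1)\<close>.\<close>

definition ext_deriv :: "nat \<Rightarrow> 'a::comm_ring_1 form \<Rightarrow> 'a form" where
  "ext_deriv N \<alpha> = (\<lambda>(x, \<mu>s). \<Sum>j<length \<mu>s.
     (-1) ^ j * (\<alpha> (shift N x (\<mu>s ! j), omit_nth j \<mu>s) - \<alpha> (x, omit_nth j \<mu>s)))"

definition field_strength :: "nat \<Rightarrow> real form \<Rightarrow> int form \<Rightarrow> real form" where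
  "field_strength N A n = (\<lambda>p. ext_deriv N A p + 2 * pi * of_int (n p))"

definition levi_civita :: "nat list \<Rightarrow> int" where
  "levi_civita \<mu>s = (let p = (\<lambda>i. if i \<in> {1..4} then \<mu>s ! (i - 1) else i)
     in if p permutes {1..4} then sign p else 0)"

definition top_charge :: "nat \<Rightarrow> real form \<Rightarrow> real" where
  "top_charge N F = 1 / (8 * pi\<^sup>2) *
     (\<Sum>x\<in>lattice N. \<Sum>\<mu>\<nu>\<in>increasing_indices 2. \<Sum>\<rho>\<sigma>\<in>increasing_indices 2.
        of_int (levi_civita (\<mu>\<nu> @ \<rho>\<sigma>)) * F (x, \<mu>\<nu>) *
        F (shift N (shift N x (\<mu>\<nu> ! 0)) (\<mu>\<nu> ! 1), \<rho>\<sigma>))"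

text \<open>
  The uniform probability measure on \<open>[-\<pi>, \<pi>)\<close> is Lebesgue measure there divided by \<open>2\<pi>\<close>.
  The points of the product measure are the real 1-forms.
\<close>

definition gauge_measure :: "nat \<Rightarrow> real form measure" where
  "gauge_measure N =
     (\<Pi>\<^sub>M l \<in> lattice N \<times> indices 1. uniform_measure lborel {-pi..<pi})"

definition partition_function :: "nat \<Rightarrow> real \<Rightarrow> real \<Rightarrow> complex" where
  "partition_function N \<beta> \<theta> =
     (\<integral>A. (\<Sum>\<^sub>\<infinity>n\<in>forms N 2.
        exp (- of_real (\<beta> / 2 *
                 (\<Sum>x\<in>lattice N. \<Sum>\<mu>\<nu>\<in>increasing_indices 2. (field_strength N A n (x, \<mu>\<nu>))\<^sup>2))
             - \<i> * of_real \<theta> * of_real (top_charge N (field_strength N A n))) *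
        (\<Prod>x\<in>lattice N. \<Prod>\<mu>\<nu>\<rho>\<in>increasing_indices 3.
           if ext_deriv N n (x, \<mu>\<nu>\<rho>) = 0 then 1 else 0)) \<partial>gauge_measure N)"

definition tau :: "real \<Rightarrow> real \<Rightarrow> complex" where
  "tau \<beta> \<theta> = of_real (\<theta> / (2 * pi)) + 2 * of_real pi * \<i> * of_real \<beta>"

definition dual_beta :: "real \<Rightarrow> real \<Rightarrow> real" where
  "dual_beta \<beta> \<theta> = \<beta> / ((2 * pi * \<beta>)\<^sup>2 + (\<theta> / (2 * pi))\<^sup>2)"

definition dual_theta :: "real \<Rightarrow> real \<Rightarrow> real" where
  "dual_theta \<beta> \<theta> = - \<theta> / ((2 * pi * \<beta>)\<^sup>2 + (\<theta> / (2 * pi))\<^sup>2)"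

definition rescaled_partition_function :: "nat \<Rightarrow> complex \<Rightarrow> complex" where
  "rescaled_partition_function N \<tau> =
     (let \<beta> = Im \<tau> / (2 * pi); \<theta> = 2 * pi * Re \<tau>
      in of_real (sqrt \<beta> ^ (3 * N ^ 4)) * partition_function N \<beta> \<theta>)"

lemma rescaled_partition_function_tau:
  "rescaled_partition_function N (tau \<beta> \<theta>) =
     of_real (sqrt \<beta> ^ (3 * N ^ 4)) * partition_function N \<beta> \<theta>"
  by (simp add: rescaled_partition_function_def tau_def)

end

theory Submission
  imports Defs "HOL-Probability.Characteristic_Functions" "HOL-Probability.Infinite_Product_Measure"
begin

text \<open>
  An integer-valued closed 2-form is determined by its six fluxes through the coordinate tori and,
  up to the differential of an integer 1-form, by nothing else. Restricting these 1-forms to the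
  links off a maximal tree enlarged by four winding links makes the representation unique, and the
  sum over them unfolds the integral over angles to an integral over the real line, link by link.
  There the exact part of the field strength decouples from its constant harmonic part and leaves a
  Gaussian integral in \<open>3 N\<^sup>4 - 3\<close> variables; the topological charge depends on
  the fluxes only. So the partition function is \<open>\<beta>\<close> to the power
  \<open>- (3 N\<^sup>4 - 3) / 2\<close> times the cube of a theta series in two variables. Poisson
  summation in one of the two turns this series into the sum of
  \<open>exp (- \<pi> |k + \<tau> a|\<^sup>2 / Im \<tau>)\<close> over the lattice of all \<open>(a, k)\<close>, in
  which a modular transformation only permutes the terms.
\<close>

section \<open>Closed 2-forms on the periodic lattice\<close>

text \<open>The obstacle is that the quadratic form in the links is degenerate: closed 1-forms, that
  is the \<open>N^4 - 1\<close> gauge directions and four windings, cost no energy. Summing over all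
  integer 1-forms would overcount the closed 2-forms and unfold to a divergent integral, hence the
  gauge-fixed links. What remains of the \<open>4 * N^4\<close> links is the number of Gaussian
  variables, and only the scaling of their integral in \<beta> is computed. The missing three
  half-powers of \<beta> come from the theta series: each of the three pairs of complementary planes
  contributes one Poisson factor proportional to \<open>1 / sqrt \<beta>\<close>, which makes the
  rescaling exponent \<open>3 * N^4\<close> exact. The homological part is stated over commutative
  rings because it is used twice: over the integers to parametrize the constraint, and over the
  reals to subtract the constant representative of the flux class, which is in general not integral.
  The two functional equations are obtained as cases of invariance under the whole modular group,
  not as generators from which it is deduced.\<close>

lemma lattice_less: "x \<in> lattice N \<Longrightarrow> \<mu> \<in> {1..4} \<Longrightarrow> x \<mu> < N"
  unfolding lattice_def by (auto dest!: PiE_mem)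

lemma lattice_upd: "x \<in> lattice N \<Longrightarrow> \<mu> \<in> {1..4} \<Longrightarrow> t < N \<Longrightarrow> x(\<mu> := t) \<in> lattice N"
  unfolding lattice_def by (auto simp: PiE_iff extensional_def)

lemma shift_lattice: "x \<in> lattice N \<Longrightarrow> \<mu> \<in> {1..4} \<Longrightarrow> shift N x \<mu> \<in> lattice N"
  unfolding shift_def using lattice_less[of x N \<mu>] by (intro lattice_upd) auto

lemma shift_commute: "shift N (shift N x \<mu>) \<nu> = shift N (shift N x \<nu>) \<mu>"
  unfolding shift_def by (auto simp: fun_eq_iff)

lemma finite_lattice: "finite (lattice N)"
  unfolding lattice_def by (intro finite_PiE) auto

lemma shift_upd_other: "\<mu> \<noteq> \<nu> \<Longrightarrow> shift N (x(\<mu> := t)) \<nu> = (shift N x \<nu>)(\<mu> := t)"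
  unfolding shift_def by (auto simp: fun_eq_iff)

lemma shift_upd_same: "shift N (x(\<mu> := t)) \<mu> = x(\<mu> := (t + 1) mod N)"
  unfolding shift_def by (auto simp: fun_eq_iff)

lemma shift_other: "\<mu> \<noteq> \<nu> \<Longrightarrow> shift N x \<nu> \<mu> = x \<mu>"
  unfolding shift_def by auto

lemma shift_same: "shift N x \<mu> \<mu> = (x \<mu> + 1) mod N"
  unfolding shift_def by auto

lemma bij_betw_shift:
  assumes "\<mu> \<in> {1..4}"
  shows "bij_betw (\<lambda>x. shift N x \<mu>) (lattice N) (lattice N)"
proof -
  have "inj_on (\<lambda>x. shift N x \<mu>) (lattice N)"
  proof (rule inj_onI)
    fix x y assume xy: "x \<in> lattice N" "y \<in> lattice N" and eq: "shift N x \<mu> = shift N y \<mu>"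
    have "x i = y i" for i
    proof (cases "i = \<mu>")
      case True
      have "(x \<mu> + 1) mod N = (y \<mu> + 1) mod N"
        using fun_cong[OF eq, of \<mu>] by (simp add: shift_same)
      moreover have "x \<mu> < N" "y \<mu> < N" using xy lattice_less assms by blast+
      moreover have "(k + 1) mod N = (if k + 1 = N then 0 else k + 1)" if "k < N" for k
        using that by auto
      ultimately show ?thesis using True by (auto split: if_splits)
    next
      case False
      then show ?thesis using fun_cong[OF eq, of i] by (simp add: shift_other)
    qed
    then show "x = y" by auto
  qed
  moreover have "(\<lambda>x. shift N x \<mu>) ` lattice N \<subseteq> lattice N"
    using shift_lattice assms by blast
  ultimately show ?thesis
    unfolding bij_betw_def using endo_inj_surj[OF finite_lattice] by blast
qed

lemma sum_shift:
  assumes "\<mu> \<in> {1..4}"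
  shows "(\<Sum>x\<in>lattice N. f (shift N x \<mu>)) = (\<Sum>x\<in>lattice N. f x)"
  by (rule sum.reindex_bij_betw[OF bij_betw_shift[OF assms]])

text \<open>A discrete fundamental theorem of calculus on a periodic line. The correction sits at
  \<open>N - 1\<close> because there the neighbour's coordinate wraps to 0 and its partial sum is
  empty.\<close>

lemma line_sum_shift:
  assumes x: "x \<in> lattice N" and \<mu>: "\<mu> \<in> {1..4}"
  shows "(\<Sum>t<shift N x \<mu> \<mu>. f (x(\<mu> := t))) - (\<Sum>t<x \<mu>. f (x(\<mu> := t))) =
    (f x - (if x \<mu> = N - 1 then \<Sum>t<N. f (x(\<mu> := t)) else 0) :: 'a::comm_ring_1)"
proof (cases "x \<mu> = N - 1")
  case True
  obtain M where M: "N = Suc M" using lattice_less[OF x \<mu>] by (cases N) auto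
  then have "x \<mu> = M" "x(\<mu> := M) = x" using True by auto
  then show ?thesis using M by (simp add: shift_same)
next
  case False
  then have "(x \<mu> + 1) mod N = Suc (x \<mu>)" using lattice_less[OF x \<mu>] by auto
  then show ?thesis using False by (simp add: shift_same)
qed

lemma line_sum_telescope:
  assumes x: "x \<in> lattice N" and \<mu>: "\<mu> \<in> {1..4}"
  shows "(\<Sum>t<x \<mu>. f (shift N (x(\<mu> := t)) \<mu>) - f (x(\<mu> := t))) =
    (f x - f (x(\<mu> := 0)) :: 'a::comm_ring_1)"
proof -
  have "(\<Sum>t<k. f (shift N (x(\<mu> := t)) \<mu>) - f (x(\<mu> := t))) = f (x(\<mu> := k)) - f (x(\<mu> := 0))"
    if "k < N" for k
    using that by (induction k) (auto simp: shift_upd_same)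
  from this[OF lattice_less[OF x \<mu>]] show ?thesis by simp
qed

lemma line_sum_cyclic:
  assumes x: "x \<in> lattice N" and \<mu>: "\<mu> \<in> {1..4}"
  shows "(\<Sum>t<N. f (shift N (x(\<mu> := t)) \<mu>)) = (\<Sum>t<N. f (x(\<mu> := t)) :: 'a::comm_ring_1)"
proof -
  obtain M where M: "N = Suc M" using lattice_less[OF x \<mu>] by (cases N) auto
  have "(\<Sum>t<N. f (shift N (x(\<mu> := t)) \<mu>)) = (\<Sum>t<M. f (x(\<mu> := Suc t))) + f (x(\<mu> := 0))"
    by (simp add: M shift_upd_same)
  then show ?thesis unfolding M sum.lessThan_Suc_shift by (simp add: add.commute)
qed

text \<open>The hypothesis stops short of the link from \<open>N - 1\<close> back to 0; the other
  steps already connect the whole line. In \<open>cobdry_inj_aux\<close> invariance is at first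
  known only away from that link.\<close>

lemma invariant_updI:
  assumes inv: "\<And>x. x \<in> lattice N \<Longrightarrow> x \<mu> < N - 1 \<Longrightarrow> f (shift N x \<mu>) = f x"
    and x: "x \<in> lattice N" and \<mu>: "\<mu> \<in> {1..4}" and t: "t < N"
  shows "f (x(\<mu> := t)) = f x"
proof -
  have *: "f (x(\<mu> := k)) = f (x(\<mu> := 0))" if "k < N" for k
    using that
  proof (induction k)
    case (Suc k)
    have "f (shift N (x(\<mu> := k)) \<mu>) = f (x(\<mu> := k))"
      by (rule inv) (use Suc x \<mu> in \<open>auto intro: lattice_upd\<close>)
    moreover have "shift N (x(\<mu> := k)) \<mu> = x(\<mu> := Suc k)" using Suc by (simp add: shift_upd_same)
    moreover have "f (x(\<mu> := k)) = f (x(\<mu> := 0))" using Suc by (intro Suc.IH) simp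
    ultimately show ?case by metis
  qed simp
  show ?thesis using *[OF t] *[OF lattice_less[OF x \<mu>]] by simp
qed

section \<open>Coboundaries, closed 2-forms and gauge fixing\<close>

definition cobdry :: "nat \<Rightarrow> (site \<Rightarrow> nat \<Rightarrow> 'a::comm_ring_1) \<Rightarrow> site \<Rightarrow> nat \<Rightarrow> nat \<Rightarrow> 'a" where
  "cobdry N l x \<mu> \<nu> = l (shift N x \<mu>) \<nu> - l x \<nu> - (l (shift N x \<nu>) \<mu> - l x \<mu>)"

text \<open>The diagonal condition is separate because antisymmetry does not imply it in every
  commutative ring.\<close>

definition closed2 :: "nat \<Rightarrow> (site \<Rightarrow> nat \<Rightarrow> nat \<Rightarrow> 'a::comm_ring_1) \<Rightarrow> bool" where
  "closed2 N F \<longleftrightarrow> (\<forall>x\<in>lattice N. \<forall>\<mu>\<in>{1..4}. F x \<mu> \<mu> = 0 \<and> (\<forall>\<nu>\<in>{1..4}. F x \<mu> \<nu> = - F x \<nu> \<mu> \<and>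
     (\<forall>\<rho>\<in>{1..4}. F (shift N x \<mu>) \<nu> \<rho> - F x \<nu> \<rho> - (F (shift N x \<nu>) \<mu> \<rho> - F x \<mu> \<rho>)
        + (F (shift N x \<rho>) \<mu> \<nu> - F x \<mu> \<nu>) = 0)))"

text \<open>
  The links on which a 1-form is gauged to zero: a spanning tree, together with the link that closes
  each coordinate circle through the origin. Closed 1-forms restrict bijectively to these links.
\<close>

definition gauge_fixed :: "nat \<Rightarrow> site \<Rightarrow> nat \<Rightarrow> bool" where
  "gauge_fixed N x \<mu> \<longleftrightarrow> (\<forall>\<nu>\<in>{1..4}. \<nu> < \<mu> \<longrightarrow> x \<nu> = 0) \<and>
     (x \<mu> < N - 1 \<or> (\<forall>\<nu>\<in>{1..4}. \<mu> < \<nu> \<longrightarrow> x \<nu> = 0))"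

text \<open>A representative of the cohomology class with fluxes \<open>m\<close> that exists over
  any ring: each coordinate 2-torus carries its whole flux on one plaquette. The constant form
  \<open>m / N^2\<close> has the same fluxes but needs division.\<close>

definition flux_form :: "nat \<Rightarrow> (nat \<Rightarrow> nat \<Rightarrow> 'a::comm_ring_1) \<Rightarrow> site \<Rightarrow> nat \<Rightarrow> nat \<Rightarrow> 'a" where
  "flux_form N m x \<mu> \<nu> = (if x \<mu> = N - 1 \<and> x \<nu> = N - 1 then m \<mu> \<nu> else 0)"

lemma closed2_cobdry: "closed2 N (cobdry N l)"
  unfolding closed2_def cobdry_def
  by (auto simp: shift_commute algebra_simps)

lemma closed2_diff: "closed2 N F \<Longrightarrow> closed2 N G \<Longrightarrow> closed2 N (\<lambda>x \<mu> \<nu>. F x \<mu> \<nu> - G x \<mu> \<nu>)"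
  unfolding closed2_def
proof (intro ballI conjI, goal_cases)
  case (2 x \<mu> \<nu>)
  have "F x \<mu> \<nu> = - F x \<nu> \<mu>" "G x \<mu> \<nu> = - G x \<nu> \<mu>" using 2 by blast+
  then show ?case by simp
next
  case (3 x \<mu> \<nu> \<rho>)
  let ?d = "\<lambda>H. H (shift N x \<mu>) \<nu> \<rho> - H x \<nu> \<rho> - (H (shift N x \<nu>) \<mu> \<rho> - H x \<mu> \<rho>)
        + (H (shift N x \<rho>) \<mu> \<nu> - H x \<mu> \<nu>)"
  have "?d F = 0" "?d G = 0" using 3 by blast+
  moreover have "?d (\<lambda>x \<mu> \<nu>. F x \<mu> \<nu> - G x \<mu> \<nu>) = ?d F - ?d G" by (simp add: algebra_simps)
  ultimately show ?case by simp
qed simp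

lemma closed2_cong:
  assumes "\<And>x \<mu> \<nu>. x \<in> lattice N \<Longrightarrow> \<mu> \<in> {1..4} \<Longrightarrow> \<nu> \<in> {1..4} \<Longrightarrow> F x \<mu> \<nu> = G x \<mu> \<nu>"
  shows "closed2 N F \<longleftrightarrow> closed2 N G"
  unfolding closed2_def using assms by (simp add: shift_lattice)

lemma cobdry_add: "cobdry N (\<lambda>x \<mu>. l x \<mu> + l' x \<mu>) x \<mu> \<nu> = cobdry N l x \<mu> \<nu> + cobdry N l' x \<mu> \<nu>"
  unfolding cobdry_def by simp

text \<open>Invariant of the reduction: the treated directions already have the shape of
  \<open>flux_form\<close>, constant across them and concentrated at the last coordinate along them.
  At \<open>k = 4\<close> nothing but the fluxes is left.\<close>

definition reduced :: "nat \<Rightarrow> nat \<Rightarrow> (site \<Rightarrow> nat \<Rightarrow> nat \<Rightarrow> 'a::comm_ring_1) \<Rightarrow> bool" where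
  "reduced N k F \<longleftrightarrow> (\<forall>x\<in>lattice N. \<forall>\<sigma>\<in>{1..4}. \<sigma> \<le> k \<longrightarrow>
     (\<forall>\<nu>\<in>{1..4}. \<forall>\<rho>\<in>{1..4}. \<forall>t<N. \<nu> \<noteq> \<sigma> \<longrightarrow> \<rho> \<noteq> \<sigma> \<longrightarrow> F (x(\<sigma> := t)) \<nu> \<rho> = F x \<nu> \<rho>) \<and>
     (\<forall>\<rho>\<in>{1..4}. x \<sigma> < N - 1 \<longrightarrow> F x \<sigma> \<rho> = 0))"

text \<open>
  One step of the contracting homotopy of the torus onto its cohomology, summing along the lines in
  direction \<open>\<mu>\<close>. Directions are treated in increasing order, so the primitive \<open>l\<close> vanishes
  exactly where \<^const>\<open>gauge_fixed\<close> asks for it.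
\<close>

lemma reduce_step:
  fixes F :: "site \<Rightarrow> nat \<Rightarrow> nat \<Rightarrow> 'a::comm_ring_1"
  assumes cl: "closed2 N F" and red: "reduced N k F" and \<mu>: "\<mu> = Suc k" "\<mu> \<in> {1..4}"
  shows "\<exists>l F'. closed2 N F' \<and> reduced N \<mu> F' \<and>
    (\<forall>x\<in>lattice N. \<forall>\<nu>\<in>{1..4}. gauge_fixed N x \<nu> \<longrightarrow> l x \<nu> = 0) \<and>
    (\<forall>x\<in>lattice N. \<forall>\<nu>\<in>{1..4}. \<forall>\<rho>\<in>{1..4}. F x \<nu> \<rho> = F' x \<nu> \<rho> + cobdry N l x \<nu> \<rho>)"
proof -
  define l where "l x \<nu> = (\<Sum>t<x \<mu>. F (x(\<mu> := t)) \<mu> \<nu>)" for x \<nu>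
  \<comment> \<open>What integration along \<mu> cannot remove: the line totals, placed where the
    primitive jumps, and the restriction to the slice where the partial sums start.\<close>
  define F' where "F' x \<nu> \<rho> = (if \<nu> = \<mu> \<or> \<rho> = \<mu> then
      (if x \<mu> = N - 1 then \<Sum>t<N. F (x(\<mu> := t)) \<nu> \<rho> else 0) else F (x(\<mu> := 0)) \<nu> \<rho>)" for x \<nu> \<rho>
  have diag: "F x \<nu> \<nu> = 0" if "x \<in> lattice N" "\<nu> \<in> {1..4}" for x \<nu>
    using cl that unfolding closed2_def by blast
  have anti: "F x \<nu> \<rho> = - F x \<rho> \<nu>" if "x \<in> lattice N" "\<nu> \<in> {1..4}" "\<rho> \<in> {1..4}" for x \<nu> \<rho>
    using cl that unfolding closed2_def by blast
  have dF: "F (shift N x \<mu>) \<nu> \<rho> - F x \<nu> \<rho> - (F (shift N x \<nu>) \<mu> \<rho> - F x \<mu> \<rho>)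
        + (F (shift N x \<rho>) \<mu> \<nu> - F x \<mu> \<nu>) = 0"
    if "x \<in> lattice N" "\<nu> \<in> {1..4}" "\<rho> \<in> {1..4}" for x \<nu> \<rho>
    using cl that \<mu>(2) unfolding closed2_def by blast
  have upd: "x(\<mu> := t) \<in> lattice N" if "x \<in> lattice N" "t < N" for x t
    using lattice_upd that \<mu> by blast
  have lmu: "l x \<mu> = 0" if x: "x \<in> lattice N" for x
    unfolding l_def using lattice_less[OF x \<mu>(2)] \<mu>(2)
    by (intro sum.neutral) (auto intro!: diag upd[OF x])
  have dl_mu: "F x \<mu> \<rho> = F' x \<mu> \<rho> + cobdry N l x \<mu> \<rho>"
    if x: "x \<in> lattice N" and \<rho>: "\<rho> \<in> {1..4}" for x \<rho>
  proof -
    have "l (shift N x \<mu>) \<rho> = (\<Sum>t<shift N x \<mu> \<mu>. F (x(\<mu> := t)) \<mu> \<rho>)"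
      unfolding l_def by (simp add: shift_def)
    then have "cobdry N l x \<mu> \<rho> = F x \<mu> \<rho> - (if x \<mu> = N - 1 then \<Sum>t<N. F (x(\<mu> := t)) \<mu> \<rho> else 0)"
      unfolding cobdry_def lmu[OF x] lmu[OF shift_lattice[OF x \<rho>]]
      using line_sum_shift[OF x \<mu>(2), of "\<lambda>x. F x \<mu> \<rho>"] by (simp add: l_def[of x \<rho>])
    then show ?thesis unfolding F'_def by simp
  qed
  have dl: "F x \<nu> \<rho> = F' x \<nu> \<rho> + cobdry N l x \<nu> \<rho>"
    if x: "x \<in> lattice N" and \<nu>: "\<nu> \<in> {1..4}" and \<rho>: "\<rho> \<in> {1..4}" for x \<nu> \<rho>
  proof (cases "\<nu> = \<mu> \<or> \<rho> = \<mu>")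
    case True
    have "F' x \<nu> \<rho> = - F' x \<rho> \<nu>"
      unfolding F'_def using True anti[OF upd[OF x] \<nu> \<rho>] by (auto simp: sum_negf[symmetric])
    moreover have "cobdry N l x \<nu> \<rho> = - cobdry N l x \<rho> \<nu>" by (simp add: cobdry_def)
    ultimately show ?thesis
      using True dl_mu[OF x \<rho>] dl_mu[OF x \<nu>] anti[OF x \<nu> \<rho>] by auto
  next
    case False
    have *: "c - d - (e - f) = a - b" if "a - b - (c - d) + (e - f) = 0" for a b c d e f :: 'a
    proof -
      have "c - d - (e - f) = (a - b) - (a - b - (c - d) + (e - f))" by simp
      then show ?thesis using that by simp
    qed
    have "cobdry N l x \<nu> \<rho> = (\<Sum>t<x \<mu>. F (shift N (x(\<mu> := t)) \<nu>) \<mu> \<rho> - F (x(\<mu> := t)) \<mu> \<rho>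
        - (F (shift N (x(\<mu> := t)) \<rho>) \<mu> \<nu> - F (x(\<mu> := t)) \<mu> \<nu>))"
      unfolding cobdry_def l_def using False
      by (simp add: shift_upd_other shift_other sum_subtractf)
    \<comment> \<open>Closedness trades the differences in \<nu> and \<rho> for the difference of
      the (\<nu>, \<rho>) component in \<mu>, so that the sum telescopes.\<close>
    also have "\<dots> = (\<Sum>t<x \<mu>. F (shift N (x(\<mu> := t)) \<mu>) \<nu> \<rho> - F (x(\<mu> := t)) \<nu> \<rho>)"
    proof (rule sum.cong[OF refl])
      fix t assume "t \<in> {..<x \<mu>}"
      then have "x(\<mu> := t) \<in> lattice N" using lattice_less[OF x \<mu>(2)] by (intro upd[OF x]) auto
      from dF[OF this \<nu> \<rho>]
      show "F (shift N (x(\<mu> := t)) \<nu>) \<mu> \<rho> - F (x(\<mu> := t)) \<mu> \<rho>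
        - (F (shift N (x(\<mu> := t)) \<rho>) \<mu> \<nu> - F (x(\<mu> := t)) \<mu> \<nu>) =
        F (shift N (x(\<mu> := t)) \<mu>) \<nu> \<rho> - F (x(\<mu> := t)) \<nu> \<rho>" by (rule *)
    qed
    also have "\<dots> = F x \<nu> \<rho> - F (x(\<mu> := 0)) \<nu> \<rho>"
      by (rule line_sum_telescope[OF x \<mu>(2)])
    finally show ?thesis using False by (simp add: F'_def)
  qed
  have "closed2 N F'"
    using closed2_diff[OF cl closed2_cobdry[of N l]] dl
    by (subst (asm) closed2_cong[of N _ F']) auto
  moreover have "reduced N \<mu> F'"
    unfolding reduced_def
  proof (intro ballI impI conjI allI)
    fix x \<sigma> \<nu> \<rho> t assume x: "x \<in> lattice N" and la: "\<sigma> \<in> {1..4}" "\<sigma> \<le> \<mu>"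
      and nr: "\<nu> \<in> {1..4}" "\<rho> \<in> {1..4}" "\<nu> \<noteq> \<sigma>" "\<rho> \<noteq> \<sigma>" and t: "t < N"
    show "F' (x(\<sigma> := t)) \<nu> \<rho> = F' x \<nu> \<rho>"
    proof (cases "\<sigma> = \<mu>")
      case True
      then show ?thesis using nr by (simp add: F'_def)
    next
      case False
      then have "F (y(\<sigma> := t)) \<nu> \<rho> = F y \<nu> \<rho>" if "y \<in> lattice N" for y
        using red la nr t \<mu> that unfolding reduced_def by auto
      then show ?thesis using False t unfolding F'_def
        by (auto simp: fun_upd_twist[of \<sigma> \<mu>] upd[OF x])
    qed
  next
    fix x and \<sigma> \<rho> :: nat assume x: "x \<in> lattice N" and la: "\<sigma> \<in> {1..4}" "\<sigma> \<le> \<mu>"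
      and r: "\<rho> \<in> {1..4}" and xl: "x \<sigma> < N - 1"
    show "F' x \<sigma> \<rho> = 0"
    proof (cases "\<sigma> = \<mu>")
      case True
      then show ?thesis using xl by (simp add: F'_def)
    next
      case False
      then have "F (x(\<mu> := t)) \<sigma> \<rho> = 0" if "t < N" for t
        using red la r \<mu> upd[OF x that] xl unfolding reduced_def by auto
      then show ?thesis using xl unfolding F'_def by auto
    qed
  qed
  moreover have "l x \<nu> = 0" if x: "x \<in> lattice N" and \<nu>: "\<nu> \<in> {1..4}" and g: "gauge_fixed N x \<nu>" for x \<nu>
  proof (cases "\<nu> < \<mu>")
    case True
    show ?thesis
    proof (cases "x \<nu> < N - 1")
      case True
      \<comment> \<open>Direction \<nu> was treated earlier, so this component survives only where
        the \<nu>-coordinate is \<open>N - 1\<close>.\<close>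
      have "F (x(\<mu> := t)) \<mu> \<nu> = 0" if "t < x \<mu>" for t
      proof -
        have t: "t < N" using that lattice_less[OF x \<mu>(2)] by simp
        have "F (x(\<mu> := t)) \<nu> \<mu> = 0"
          using red \<nu> \<mu> upd[OF x t] \<open>\<nu> < \<mu>\<close> True unfolding reduced_def by auto
        then show ?thesis using anti[OF upd[OF x t] \<mu>(2) \<nu>] by simp
      qed
      then show ?thesis unfolding l_def by simp
    next
      case False
      then have "x \<mu> = 0" using g \<open>\<nu> < \<mu>\<close> \<mu>(2) unfolding gauge_fixed_def by auto
      then show ?thesis unfolding l_def by simp
    qed
  next
    case False
    then consider "\<nu> = \<mu>" | "\<mu> < \<nu>" by linarith
    then show ?thesis
    proof cases
      case 1
      then show ?thesis using lmu[OF x] by simp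
    next
      case 2
      then have "x \<mu> = 0" using g \<mu>(2) unfolding gauge_fixed_def by auto
      then show ?thesis unfolding l_def by simp
    qed
  qed
  ultimately show ?thesis using dl by blast
qed

lemma reduce_exists:
  fixes F :: "site \<Rightarrow> nat \<Rightarrow> nat \<Rightarrow> 'a::comm_ring_1"
  assumes cl: "closed2 N F" and "k \<le> 4"
  shows "\<exists>l F'. closed2 N F' \<and> reduced N k F' \<and>
    (\<forall>x\<in>lattice N. \<forall>\<nu>\<in>{1..4}. gauge_fixed N x \<nu> \<longrightarrow> l x \<nu> = 0) \<and>
    (\<forall>x\<in>lattice N. \<forall>\<nu>\<in>{1..4}. \<forall>\<rho>\<in>{1..4}. F x \<nu> \<rho> = F' x \<nu> \<rho> + cobdry N l x \<nu> \<rho>)"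
  using assms(2)
proof (induction k)
  case 0
  show ?case
    by (rule exI[of _ "\<lambda>_ _. 0"], rule exI[of _ F]) (use cl in \<open>auto simp: reduced_def cobdry_def\<close>)
next
  case (Suc k)
  then obtain l F' where 1: "closed2 N F'" "reduced N k F'"
    "\<forall>x\<in>lattice N. \<forall>\<nu>\<in>{1..4}. gauge_fixed N x \<nu> \<longrightarrow> l x \<nu> = 0"
    "\<forall>x\<in>lattice N. \<forall>\<nu>\<in>{1..4}. \<forall>\<rho>\<in>{1..4}. F x \<nu> \<rho> = F' x \<nu> \<rho> + cobdry N l x \<nu> \<rho>" by auto
  from Suc.prems have "Suc k \<in> {1..4}" by simp
  from reduce_step[OF 1(1,2) refl this] obtain l' F'' where 2: "closed2 N F''" "reduced N (Suc k) F''"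
    "\<forall>x\<in>lattice N. \<forall>\<nu>\<in>{1..4}. gauge_fixed N x \<nu> \<longrightarrow> l' x \<nu> = 0"
    "\<forall>x\<in>lattice N. \<forall>\<nu>\<in>{1..4}. \<forall>\<rho>\<in>{1..4}. F' x \<nu> \<rho> = F'' x \<nu> \<rho> + cobdry N l' x \<nu> \<rho>" by blast
  show ?case
    by (rule exI[of _ "\<lambda>x \<nu>. l x \<nu> + l' x \<nu>"], rule exI[of _ F''])
       (use 1 2 in \<open>auto simp: cobdry_add add_ac\<close>)
qed

lemma lattice_eqI:
  assumes "x \<in> lattice N" "y \<in> lattice N" "\<And>\<mu>. \<mu> \<in> {1..4} \<Longrightarrow> x \<mu> = y \<mu>"
  shows "x = y"
  using assms unfolding lattice_def by (intro PiE_ext) auto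

text \<open>Walks from \<open>x\<close> to \<open>y\<close> by overwriting one coordinate at a time.
  \<open>P\<close> travels along the path and restricts the sites at which invariance must be
  known.\<close>

lemma invariant_const:
  assumes inv: "\<And>x \<mu> t. x \<in> lattice N \<Longrightarrow> \<mu> \<in> {1..4} \<Longrightarrow> P x \<Longrightarrow> t = y \<mu> \<Longrightarrow> P (x(\<mu> := t)) \<and> f (x(\<mu> := t)) = f x"
    and x: "x \<in> lattice N" and y: "y \<in> lattice N" and P: "P x"
  shows "f y = f x"
proof -
  have up: "x(\<mu> := y \<mu>) \<in> lattice N" if "x \<in> lattice N" "\<mu> \<in> {1..4}" for x \<mu>
    using lattice_upd[OF that] lattice_less[OF y that(2)] by blast
  define x1 where "x1 = x(1 := y 1)"
  define x2 where "x2 = x1(2 := y 2)"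
  define x3 where "x3 = x2(3 := y 3)"
  define x4 where "x4 = x3(4 := y 4)"
  have 1: "x1 \<in> lattice N" "P x1" "f x1 = f x"
    unfolding x1_def using inv[OF x, of 1] P up[OF x, of 1] by auto
  have 2: "x2 \<in> lattice N" "P x2" "f x2 = f x"
    unfolding x2_def using inv[OF 1(1), of 2] 1 up[OF 1(1), of 2] by auto
  have 3: "x3 \<in> lattice N" "P x3" "f x3 = f x"
    unfolding x3_def using inv[OF 2(1), of 3] 2 up[OF 2(1), of 3] by auto
  have 4: "x4 \<in> lattice N" "f x4 = f x"
    unfolding x4_def using inv[OF 3(1), of 4] 3 up[OF 3(1), of 4] by auto
  have "x4 = y"
  proof (rule lattice_eqI[OF 4(1) y])
    fix \<mu> :: nat assume "\<mu> \<in> {1..4}"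
    then have "\<mu> = 1 \<or> \<mu> = 2 \<or> \<mu> = 3 \<or> \<mu> = 4" by auto
    then show "x4 \<mu> = y \<mu>" unfolding x4_def x3_def x2_def x1_def by auto
  qed
  then show ?thesis using 4 by simp
qed

text \<open>Existence half. Once all four directions are reduced, each component is constant where
  both its coordinates are \<open>N - 1\<close> and zero elsewhere, which is exactly a
  \<open>flux_form\<close>.\<close>

lemma closed2_decomposition:
  fixes F :: "site \<Rightarrow> nat \<Rightarrow> nat \<Rightarrow> 'a::comm_ring_1"
  assumes cl: "closed2 N F" and N: "N \<ge> 1"
  obtains l m where
    "\<And>x \<nu>. x \<in> lattice N \<Longrightarrow> \<nu> \<in> {1..4} \<Longrightarrow> gauge_fixed N x \<nu> \<Longrightarrow> l x \<nu> = 0"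
    "\<And>x \<nu> \<rho>. x \<in> lattice N \<Longrightarrow> \<nu> \<in> {1..4} \<Longrightarrow> \<rho> \<in> {1..4} \<Longrightarrow>
       F x \<nu> \<rho> = flux_form N m x \<nu> \<rho> + cobdry N l x \<nu> \<rho>"
proof -
  obtain l F' where 1: "closed2 N F'" "reduced N 4 F'"
    "\<forall>x\<in>lattice N. \<forall>\<nu>\<in>{1..4}. gauge_fixed N x \<nu> \<longrightarrow> l x \<nu> = 0"
    "\<forall>x\<in>lattice N. \<forall>\<nu>\<in>{1..4}. \<forall>\<rho>\<in>{1..4}. F x \<nu> \<rho> = F' x \<nu> \<rho> + cobdry N l x \<nu> \<rho>"
    using reduce_exists[OF cl order_refl] by blast
  \<comment> \<open>The corner that lies on every slice supporting a flux; the fluxes are read off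
    there.\<close>
  define y where "y = (\<lambda>i\<in>{1..4::nat}. N - 1)"
  have y: "y \<in> lattice N" using N unfolding lattice_def y_def by auto
  have F': "F' x \<mu> \<nu> = flux_form N (F' y) x \<mu> \<nu>"
    if x: "x \<in> lattice N" and \<mu>: "\<mu> \<in> {1..4}" and \<nu>: "\<nu> \<in> {1..4}" for x \<mu> \<nu>
  proof (cases "x \<mu> = N - 1 \<and> x \<nu> = N - 1")
    case True
    have "F' y \<mu> \<nu> = F' x \<mu> \<nu>"
    proof (rule invariant_const[where P="\<lambda>x. x \<mu> = N - 1 \<and> x \<nu> = N - 1" and f="\<lambda>x. F' x \<mu> \<nu>" and y=y, OF _ x y True])
      fix x \<sigma> t assume *: "x \<in> lattice N" "\<sigma> \<in> {1..4}" "x \<mu> = N - 1 \<and> x \<nu> = N - 1" "t = y \<sigma>"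
      then have t: "t = N - 1" by (simp add: y_def)
      show "((x(\<sigma> := t)) \<mu> = N - 1 \<and> (x(\<sigma> := t)) \<nu> = N - 1) \<and> F' (x(\<sigma> := t)) \<mu> \<nu> = F' x \<mu> \<nu>"
      proof (cases "\<sigma> = \<mu> \<or> \<sigma> = \<nu>")
        case True
        then have "x(\<sigma> := t) = x" using * t by auto
        then show ?thesis using * by simp
      next
        case False
        then show ?thesis using * t N 1(2) \<mu> \<nu> unfolding reduced_def by auto
      qed
    qed
    then show ?thesis using True by (simp add: flux_form_def)
  next
    case False
    then consider "x \<mu> < N - 1" | "x \<nu> < N - 1"
      using lattice_less[OF x \<mu>] lattice_less[OF x \<nu>] by linarith
    then have "F' x \<mu> \<nu> = 0"
    proof cases
      case 2
      then have "F' x \<nu> \<mu> = 0" using 1(2) x \<mu> \<nu> unfolding reduced_def by auto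
      moreover have "F' x \<mu> \<nu> = - F' x \<nu> \<mu>" using 1(1) x \<mu> \<nu> unfolding closed2_def by blast
      ultimately show ?thesis by simp
    qed (use 1(2) x \<mu> \<nu> in \<open>auto simp: reduced_def\<close>)
    then show ?thesis using False unfolding flux_form_def by presburger
  qed
  show ?thesis by (rule that[of l "F' y"]) (use 1 F' in auto)
qed

text \<open>Stokes on the coordinate 2-torus through \<open>z\<close>: the coboundary cancels
  cyclically along both directions, and \<open>flux_form\<close> contributes at one plaquette. Hence
  the fluxes are determined by \<open>F\<close>.\<close>

lemma flux_eq:
  fixes F :: "site \<Rightarrow> nat \<Rightarrow> nat \<Rightarrow> 'a::comm_ring_1"
  assumes F: "\<And>x. x \<in> lattice N \<Longrightarrow> F x \<mu> \<nu> = flux_form N m x \<mu> \<nu> + cobdry N l x \<mu> \<nu>"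
    and \<mu>: "\<mu> \<in> {1..4}" and \<nu>: "\<nu> \<in> {1..4}" and ne: "\<mu> \<noteq> \<nu>" and z: "z \<in> lattice N"
  shows "(\<Sum>s<N. \<Sum>t<N. F (z(\<mu> := s, \<nu> := t)) \<mu> \<nu>) = m \<mu> \<nu>"
proof -
  have N: "N \<ge> 1" using lattice_less[OF z \<mu>] by simp
  have in_l: "z(\<mu> := s, \<nu> := t) \<in> lattice N" if "s < N" "t < N" for s t
    using that z \<mu> \<nu> by (intro lattice_upd) auto
  have "(\<Sum>s<N. \<Sum>t<N. F (z(\<mu> := s, \<nu> := t)) \<mu> \<nu>) =
     (\<Sum>s<N. \<Sum>t<N. flux_form N m (z(\<mu> := s, \<nu> := t)) \<mu> \<nu>) +
     (\<Sum>s<N. \<Sum>t<N. cobdry N l (z(\<mu> := s, \<nu> := t)) \<mu> \<nu>)"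
    by (simp add: F in_l sum.distrib)
  also have "(\<Sum>s<N. \<Sum>t<N. flux_form N m (z(\<mu> := s, \<nu> := t)) \<mu> \<nu>) =
     (\<Sum>s<N. if s = N - 1 then \<Sum>t<N. if t = N - 1 then m \<mu> \<nu> else 0 else 0)"
    using ne by (intro sum.cong refl) (auto simp: flux_form_def)
  also have "\<dots> = m \<mu> \<nu>" using N by (simp add: sum.delta)
  also have "(\<Sum>s<N. \<Sum>t<N. cobdry N l (z(\<mu> := s, \<nu> := t)) \<mu> \<nu>) =
     (\<Sum>s<N. \<Sum>t<N. l (shift N (z(\<mu> := s, \<nu> := t)) \<mu>) \<nu> - l (z(\<mu> := s, \<nu> := t)) \<nu>) -
     (\<Sum>s<N. (\<Sum>t<N. l (shift N (z(\<mu> := s, \<nu> := t)) \<nu>) \<mu>) - (\<Sum>t<N. l (z(\<mu> := s, \<nu> := t)) \<mu>))"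
    by (simp only: cobdry_def sum_subtractf)
  also have "(\<Sum>s<N. (\<Sum>t<N. l (shift N (z(\<mu> := s, \<nu> := t)) \<nu>) \<mu>) - (\<Sum>t<N. l (z(\<mu> := s, \<nu> := t)) \<mu>)) = 0"
    using line_sum_cyclic[OF lattice_upd[OF z \<mu>] \<nu>, of _ "\<lambda>x. l x \<mu>"] by (intro sum.neutral) auto
  also have "(\<Sum>s<N. \<Sum>t<N. l (shift N (z(\<mu> := s, \<nu> := t)) \<mu>) \<nu> - l (z(\<mu> := s, \<nu> := t)) \<nu>) =
     (\<Sum>t<N. (\<Sum>s<N. l (shift N (z(\<nu> := t, \<mu> := s)) \<mu>) \<nu>) - (\<Sum>s<N. l (z(\<nu> := t, \<mu> := s)) \<nu>))"
    by (subst sum.swap) (simp add: sum_subtractf fun_upd_twist[OF ne])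
  also have "\<dots> = 0"
    using line_sum_cyclic[OF lattice_upd[OF z \<nu>] \<mu>, of _ "\<lambda>x. l x \<nu>"] by (intro sum.neutral) auto
  finally show ?thesis by (simp only: diff_self add_0_right)
qed

text \<open>Uniqueness half: a closed 1-form that vanishes on the gauge-fixed links is zero.
  Directions are cleared in increasing order. The second conjunct, that later components do not
  depend on cleared coordinates, is what allows any link to be moved onto the gauge-fixed
  set.\<close>

lemma cobdry_inj_aux:
  fixes l :: "site \<Rightarrow> nat \<Rightarrow> 'a::comm_ring_1"
  assumes T: "\<And>x \<nu>. x \<in> lattice N \<Longrightarrow> \<nu> \<in> {1..4} \<Longrightarrow> gauge_fixed N x \<nu> \<Longrightarrow> l x \<nu> = 0"
    and d: "\<And>x \<nu> \<rho>. x \<in> lattice N \<Longrightarrow> \<nu> \<in> {1..4} \<Longrightarrow> \<rho> \<in> {1..4} \<Longrightarrow> cobdry N l x \<nu> \<rho> = 0"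
    and "k \<le> 4"
  shows "(\<forall>x\<in>lattice N. \<forall>\<mu>\<in>{1..4}. \<mu> \<le> k \<longrightarrow> l x \<mu> = 0) \<and>
    (\<forall>x\<in>lattice N. \<forall>\<mu>\<in>{1..4}. \<forall>\<nu>\<in>{1..4}. \<forall>t<N. \<mu> \<le> k \<longrightarrow> k < \<nu> \<longrightarrow> l (x(\<mu> := t)) \<nu> = l x \<nu>)"
  using assms(3)
proof (induction k)
  case (Suc k)
  define \<kappa> where "\<kappa> = Suc k"
  have \<kappa>: "\<kappa> \<in> {1..4}" using Suc.prems by (simp add: \<kappa>_def)
  have inv: "l (x(\<mu> := t)) \<nu> = l x \<nu>"
    if "x \<in> lattice N" "\<mu> \<in> {1..4}" "\<nu> \<in> {1..4}" "t < N" "\<mu> < \<kappa>" "\<kappa> \<le> \<nu>" for x \<mu> \<nu> t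
  proof -
    have "\<forall>x\<in>lattice N. \<forall>\<mu>\<in>{1..4}. \<forall>\<nu>\<in>{1..4}. \<forall>t<N. \<mu> \<le> k \<longrightarrow> k < \<nu> \<longrightarrow> l (x(\<mu> := t)) \<nu> = l x \<nu>"
      using Suc.IH[OF Suc_leD[OF Suc.prems]] by (rule conjunct2)
    then show ?thesis using that unfolding \<kappa>_def by (meson Suc_le_lessD less_Suc_eq_le)
  qed
  \<comment> \<open>Setting the lower coordinates to 0 does not change the \<kappa>-link by the
    induction hypothesis, and puts it on the tree unless it closes a circle.\<close>
  define z where "z x = (\<lambda>i\<in>{1..4::nat}. if i < \<kappa> then 0 else x i)" for x :: site
  have zin: "z x \<in> lattice N" if x: "x \<in> lattice N" for x
    unfolding lattice_def z_def using lattice_less[OF x] by fastforce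
  have red: "l (z x) \<kappa> = l x \<kappa>" if x: "x \<in> lattice N" for x
  proof (rule invariant_const[where P="\<lambda>w. \<forall>i\<in>{1..4}. i \<ge> \<kappa> \<longrightarrow> w i = x i" and f="\<lambda>x. l x \<kappa>", OF _ x zin[OF x]])
    fix w \<mu> t assume *: "w \<in> lattice N" "\<mu> \<in> {1..4}" "\<forall>i\<in>{1..4}. \<kappa> \<le> i \<longrightarrow> w i = x i" "t = z x \<mu>"
    show "(\<forall>i\<in>{1..4}. \<kappa> \<le> i \<longrightarrow> (w(\<mu> := t)) i = x i) \<and> l (w(\<mu> := t)) \<kappa> = l w \<kappa>"
    proof (cases "\<mu> < \<kappa>")
      case True
      then have "t = 0" "N > 0" using * lattice_less[OF x \<kappa>] by (auto simp: z_def)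
      then show ?thesis using True inv[OF *(1) *(2) \<kappa>, of t] * by auto
    next
      case False
      then have "w(\<mu> := t) = w" using * by (auto simp: z_def)
      then show ?thesis using * by auto
    qed
  qed auto
  have l0: "l x \<kappa> = 0" if x: "x \<in> lattice N" and xk: "x \<kappa> < N - 1" for x
  proof -
    have "gauge_fixed N (z x) \<kappa>" using xk \<kappa> unfolding gauge_fixed_def z_def by auto
    then show ?thesis using T[OF zin[OF x] \<kappa>] red[OF x] by simp
  qed
  have inv\<kappa>: "l (x(\<kappa> := t)) \<nu> = l x \<nu>"
    if x: "x \<in> lattice N" and \<nu>: "\<nu> \<in> {1..4}" "\<nu> > \<kappa>" and t: "t < N" for x \<nu> t
  proof (rule invariant_updI[where f="\<lambda>x. l x \<nu>", OF _ x \<kappa> t])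
    fix x assume x: "x \<in> lattice N" "x \<kappa> < N - 1"
    then have "l (shift N x \<nu>) \<kappa> = 0" "l x \<kappa> = 0"
      using \<nu> by (auto intro!: l0 shift_lattice simp: shift_other)
    \<comment> \<open>Both \<kappa>-links of the plaquette vanish, so closedness equates its two
      \<nu>-links.\<close>
    then show "l (shift N x \<kappa>) \<nu> = l x \<nu>"
      using d[OF x(1) \<kappa> \<nu>(1)] by (simp add: cobdry_def)
  qed
  have inv'': "l (x(\<mu> := t)) \<kappa> = l x \<kappa>"
    if x: "x \<in> lattice N" and \<mu>: "\<mu> \<in> {1..4}" "\<mu> \<noteq> \<kappa>" and t: "t < N" for x \<mu> t
  proof (cases "\<mu> < \<kappa>")
    case True
    then show ?thesis using inv[OF x \<mu>(1) \<kappa> t] by simp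
  next
    case False
    show ?thesis
    proof (rule invariant_updI[where f="\<lambda>x. l x \<kappa>", OF _ x \<mu>(1) t])
      fix x assume x: "x \<in> lattice N"
      have "l (shift N x \<kappa>) \<mu> = l x \<mu>"
        unfolding shift_def using lattice_less[OF x \<kappa>] False \<mu>
        by (intro inv\<kappa>[OF x]) auto
      then show "l (shift N x \<mu>) \<kappa> = l x \<kappa>"
        using d[OF x \<kappa> \<mu>(1)] by (simp add: cobdry_def)
    qed
  qed
  have l\<kappa>: "l x \<kappa> = 0" if x: "x \<in> lattice N" for x
  proof -
    \<comment> \<open>This also reaches the closing links: moved onto the coordinate circle through
      the origin, every \<kappa>-link is gauge fixed.\<close>
    define y where "y = (\<lambda>i\<in>{1..4::nat}. if i = \<kappa> then x \<kappa> else 0)"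
    have y: "y \<in> lattice N" unfolding lattice_def y_def using lattice_less[OF x \<kappa>] by auto
    have "l y \<kappa> = l x \<kappa>"
    proof (rule invariant_const[where P="\<lambda>w. w \<kappa> = x \<kappa>" and f="\<lambda>x. l x \<kappa>", OF _ x y refl])
      fix w \<mu> t assume *: "w \<in> lattice N" "\<mu> \<in> {1..4}" "w \<kappa> = x \<kappa>" "t = y \<mu>"
      have "t < N" using lattice_less[OF y *(2)] *(4) by simp
      then show "(w(\<mu> := t)) \<kappa> = x \<kappa> \<and> l (w(\<mu> := t)) \<kappa> = l w \<kappa>"
        using inv''[OF *(1,2), of t] * by (cases "\<mu> = \<kappa>") (auto simp: y_def fun_upd_idem)
    qed
    moreover have "gauge_fixed N y \<kappa>" unfolding gauge_fixed_def y_def by auto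
    ultimately show ?thesis using T[OF y \<kappa>] by simp
  qed
  have "l x \<mu> = 0" if "x \<in> lattice N" "\<mu> \<in> {1..4}" "\<mu> \<le> Suc k" for x \<mu>
    using Suc l\<kappa> that by (cases "\<mu> = \<kappa>") (auto simp: \<kappa>_def)
  moreover have "l (x(\<mu> := t)) \<nu> = l x \<nu>"
    if "x \<in> lattice N" "\<mu> \<in> {1..4}" "\<nu> \<in> {1..4}" "t < N" "\<mu> \<le> Suc k" "Suc k < \<nu>" for x \<mu> \<nu> t
    using inv[OF that(1-4)] inv\<kappa>[OF that(1,3) _ that(4)] that
    by (cases "\<mu> = \<kappa>") (auto simp: \<kappa>_def)
  ultimately show ?case by blast
qed auto

lemma cobdry_inj:
  fixes l :: "site \<Rightarrow> nat \<Rightarrow> 'a::comm_ring_1"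
  assumes "\<And>x \<nu>. x \<in> lattice N \<Longrightarrow> \<nu> \<in> {1..4} \<Longrightarrow> gauge_fixed N x \<nu> \<Longrightarrow> l x \<nu> = 0"
    and "\<And>x \<nu> \<rho>. x \<in> lattice N \<Longrightarrow> \<nu> \<in> {1..4} \<Longrightarrow> \<rho> \<in> {1..4} \<Longrightarrow> cobdry N l x \<nu> \<rho> = 0"
    and "x \<in> lattice N" "\<mu> \<in> {1..4}"
  shows "l x \<mu> = 0"
  using cobdry_inj_aux[of N l 4, OF assms(1,2)] assms(3,4) by auto

section \<open>Uniqueness of Fourier coefficients\<close>

lemma integral_infsum_swap:
  fixes f :: "'a \<Rightarrow> 'b \<Rightarrow> 'c::{banach,second_countable_topology}"
  assumes M: "sigma_finite_measure M" and X: "countable X"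
    and int: "\<And>x. x \<in> X \<Longrightarrow> integrable M (f x)"
    and pt: "\<And>\<omega>. \<omega> \<in> space M \<Longrightarrow> (\<lambda>x. norm (f x \<omega>)) summable_on X"
    and nrm: "(\<lambda>x. \<integral>\<omega>. norm (f x \<omega>) \<partial>M) summable_on X"
  shows "(\<integral>\<omega>. (\<Sum>\<^sub>\<infinity>x\<in>X. f x \<omega>) \<partial>M) = (\<Sum>\<^sub>\<infinity>x\<in>X. \<integral>\<omega>. f x \<omega> \<partial>M)"
proof -
  interpret M: sigma_finite_measure M by fact
  interpret X: sigma_finite_measure "count_space X"
    by (rule sigma_finite_measure_count_space_countable[OF X])
  interpret P: pair_sigma_finite "count_space X" M ..
  have [measurable]: "f x \<in> borel_measurable M" if "x \<in> X" for x
    using int[OF that] by auto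
  have "integrable (count_space X \<Otimes>\<^sub>M M) (\<lambda>(x, \<omega>). f x \<omega>)"
  proof (rule P.Fubini_integrable)
    show "(\<lambda>(x, \<omega>). f x \<omega>) \<in> borel_measurable (count_space X \<Otimes>\<^sub>M M)"
      by (rule measurable_pair_measure_countable1[OF X]) auto
    have "(\<lambda>x. norm (\<integral>\<omega>. norm (f x \<omega>) \<partial>M)) summable_on X"
      using nrm by simp
    then show "integrable (count_space X) (\<lambda>x. \<integral>\<omega>. norm (case (x, \<omega>) of (x, \<omega>) \<Rightarrow> f x \<omega>) \<partial>M)"
      unfolding abs_summable_equivalent abs_summable_on_def by simp
    show "AE x in count_space X. integrable M (\<lambda>\<omega>. case (x, \<omega>) of (x, \<omega>) \<Rightarrow> f x \<omega>)"
      by (auto simp: AE_count_space int)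
  qed
  note i = this
  have 1: "(\<Sum>\<^sub>\<infinity>x\<in>X. f x \<omega>) = (\<integral>x. f x \<omega> \<partial>count_space X)" if "\<omega> \<in> space M" for \<omega>
    using infsetsum_infsum[of "\<lambda>x. f x \<omega>" X] pt[OF that]
    unfolding abs_summable_equivalent infsetsum_def by simp
  have "(\<lambda>x. norm (\<integral>\<omega>. f x \<omega> \<partial>M)) summable_on X"
    by (rule summable_on_comparison_test[OF nrm]) auto
  then have 2: "(\<Sum>\<^sub>\<infinity>x\<in>X. \<integral>\<omega>. f x \<omega> \<partial>M) = (\<integral>x. (\<integral>\<omega>. f x \<omega> \<partial>M) \<partial>count_space X)"
    using infsetsum_infsum[of "\<lambda>x. \<integral>\<omega>. f x \<omega> \<partial>M" X]
    unfolding abs_summable_equivalent infsetsum_def by simp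
  have "(\<integral>\<omega>. (\<Sum>\<^sub>\<infinity>x\<in>X. f x \<omega>) \<partial>M) = (\<integral>\<omega>. (\<integral>x. f x \<omega> \<partial>count_space X) \<partial>M)"
    by (rule Bochner_Integration.integral_cong) (auto simp: 1)
  also have "\<dots> = (\<integral>x. (\<integral>\<omega>. f x \<omega> \<partial>M) \<partial>count_space X)"
    using P.integral_fst'[OF i] P.integral_snd[OF i] by simp
  finally show ?thesis using 2 by simp
qed

lemma summable_on_intI:
  fixes f :: "int \<Rightarrow> real"
  assumes "(\<lambda>n. f (int n)) summable_on UNIV" "(\<lambda>n. f (- int n)) summable_on UNIV"
  shows "f summable_on UNIV"
proof -
  have "f summable_on range int" "f summable_on range (\<lambda>n. - int n)"
    using assms by (auto simp: summable_on_reindex inj_def o_def)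
  then have "f summable_on (range int \<union> range (\<lambda>n. - int n))"
    by (rule summable_on_union)
  moreover have "k \<in> range int \<union> range (\<lambda>n. - int n)" for k
    by (cases k rule: int_cases2) auto
  then have "range int \<union> range (\<lambda>n. - int n) = UNIV" by blast
  ultimately show ?thesis by simp
qed

lemma gaussian_summable:
  fixes c :: real
  assumes "c > 0"
  shows "(\<lambda>k::int. exp (- c * (of_int k)\<^sup>2)) summable_on UNIV"
proof (rule summable_on_intI)
  have "summable (\<lambda>n. exp (- c) ^ n)" using assms by (intro summable_geometric) auto
  then have s: "(\<lambda>n::nat. exp (- c) ^ n) summable_on UNIV"
    by (intro norm_summable_imp_summable_on) (auto simp: power_abs)
  have "exp (- c * (real n)\<^sup>2) \<le> exp (- c) ^ n" for n :: nat
  proof -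
    have "real n \<le> (real n)\<^sup>2" unfolding power2_eq_square by (cases n) auto
    then have "c * real n \<le> c * (real n)\<^sup>2" using assms by simp
    then show ?thesis by (simp add: exp_of_nat_mult[symmetric] mult.commute)
  qed
  then have "(\<lambda>n::nat. exp (- c * (real n)\<^sup>2)) summable_on UNIV"
    by (intro summable_on_comparison_test[OF s]) auto
  then show "(\<lambda>n. exp (- c * (of_int (int n))\<^sup>2)) summable_on UNIV"
    "(\<lambda>n. exp (- c * (of_int (- int n))\<^sup>2)) summable_on UNIV" by simp_all
qed

lemma cis_add_int: "cis (2 * pi * (t + of_int k)) = cis (2 * pi * t)"
  by (simp add: distrib_left cis_mult[symmetric] cis_multiple_2pi)

text \<open>Orthogonality to all characters, as a predicate stable under linear combinations and
  under multiplication by a character. Multiplication by trigonometric polynomials then preserves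
  it.\<close>

definition fourier_null :: "(real \<Rightarrow> complex) \<Rightarrow> bool" where
  "fourier_null h \<longleftrightarrow> continuous_on {0..1} h \<and>
     (\<forall>n::int. integral {0..1} (\<lambda>t. h t * cis (2 * pi * of_int n * t)) = 0)"

lemma fourier_null_add: "fourier_null h \<Longrightarrow> fourier_null g \<Longrightarrow> fourier_null (\<lambda>t. h t + g t)"
  unfolding fourier_null_def
  by (auto simp: distrib_right intro!: continuous_intros
      trans[OF Henstock_Kurzweil_Integration.integral_add] integrable_continuous_interval)

lemma fourier_null_scale: "fourier_null h \<Longrightarrow> fourier_null (\<lambda>t. c * h t)"
  unfolding fourier_null_def
  by (auto simp: mult.assoc intro!: continuous_intros)

lemma fourier_null_cis: "fourier_null h \<Longrightarrow> fourier_null (\<lambda>t. cis (2 * pi * of_int k * t) * h t)"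
  unfolding fourier_null_def
proof (intro conjI allI)
  fix n :: int
  assume h: "continuous_on {0..1} h \<and> (\<forall>n::int. integral {0..1} (\<lambda>t. h t * cis (2 * pi * of_int n * t)) = 0)"
  have "(\<lambda>t. cis (2 * pi * of_int k * t) * h t * cis (2 * pi * of_int n * t)) =
        (\<lambda>t. h t * cis (2 * pi * of_int (k + n) * t))"
  proof
    fix t :: real
    have "cis (2 * pi * of_int (k + n) * t) = cis (2 * pi * of_int k * t) * cis (2 * pi * of_int n * t)"
      by (simp add: cis_mult algebra_simps)
    then show "cis (2 * pi * of_int k * t) * h t * cis (2 * pi * of_int n * t) =
      h t * cis (2 * pi * of_int (k + n) * t)" by simp
  qed
  then show "integral {0..1} (\<lambda>t. cis (2 * pi * of_int k * t) * h t * cis (2 * pi * of_int n * t)) = 0"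
    using h by (simp del: of_int_add)
qed (auto intro!: continuous_intros)

text \<open>
  The induction multiplies the polynomial into \<open>h\<close>, which avoids writing it as a trigonometric
  polynomial.
\<close>

lemma fourier_null_poly:
  fixes p :: "complex \<Rightarrow> real"
  assumes "real_polynomial_function p" "fourier_null h"
  shows "fourier_null (\<lambda>t. of_real (p (cis (2 * pi * t))) * h t)"
  using assms
proof (induction p arbitrary: h rule: real_polynomial_function.induct)
  case (linear p)
  interpret bounded_linear p by fact
  \<comment> \<open>A real-linear functional on the complex plane has the form
    \<open>c * z + d * cnj z\<close>, and on the circle \<open>z\<close> and \<open>cnj z\<close>
    are the characters of index 1 and -1.\<close>
  define c where "c = (complex_of_real (p 1) - \<i> * of_real (p \<i>)) / 2"
  define d where "d = (complex_of_real (p 1) + \<i> * of_real (p \<i>)) / 2"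
  have "of_real (p z) = c * z + d * cnj z" for z
  proof -
    have "p z = p (Re z *\<^sub>R 1 + Im z *\<^sub>R \<i>)"
      by (rule arg_cong[of _ _ p]) (simp add: complex_eq_iff)
    also have "\<dots> = Re z * p 1 + Im z * p \<i>" by (simp only: add scaleR real_scaleR_def)
    finally show ?thesis unfolding c_def d_def by (simp add: complex_eq_iff field_simps)
  qed
  then have "(\<lambda>t. of_real (p (cis (2 * pi * t))) * h t) =
     (\<lambda>t. c * (cis (2 * pi * of_int 1 * t) * h t) + d * (cis (2 * pi * of_int (-1) * t) * h t))"
    by (simp add: cis_cnj fun_eq_iff algebra_simps)
  then show ?case
    using fourier_null_cis[OF linear.prems, of 1] fourier_null_cis[OF linear.prems, of "-1"]
    by (auto intro!: fourier_null_add fourier_null_scale)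
next
  case (const c)
  then show ?case by (intro fourier_null_scale)
next
  case (add f g)
  then show ?case by (auto simp: distrib_right intro!: fourier_null_add)
next
  case (mult f g)
  then show ?case by (simp add: mult.assoc)
qed

text \<open>On the unit circle Stone-Weierstrass gives a polynomial \<open>p\<close> uniformly close
  to \<open>f\<close>. Since \<open>f\<close> is orthogonal to \<open>p\<close>, the integral of
  \<open>f * f\<close> equals that of \<open>(f - p) * f\<close> and is arbitrarily small.\<close>

lemma fourier_unique:
  fixes f :: "real \<Rightarrow> real"
  assumes cont: "continuous_on UNIV f" and per: "\<And>t k. f (t + of_int k) = f t"
    and null: "\<And>n::int. integral {0..1} (\<lambda>t. of_real (f t) * cis (2 * pi * of_int n * t)) = 0"
  shows "f t = 0"
proof -
  define g where "g z = f (Arg z / (2 * pi))" for z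
  have g: "g (cis (2 * pi * t)) = f t" for t
  proof -
    have "cis (Arg (cis (2 * pi * t))) = cis (2 * pi * t)" by (simp add: cis_Arg)
    then have "sin (Arg (cis (2 * pi * t))) = sin (2 * pi * t) \<and> cos (Arg (cis (2 * pi * t))) = cos (2 * pi * t)"
      by (metis cis.sel)
    then obtain k :: int where "Arg (cis (2 * pi * t)) = 2 * pi * t + 2 * pi * of_int k"
      unfolding sin_cos_eq_iff by auto
    then have "Arg (cis (2 * pi * t)) / (2 * pi) = t + of_int k" by (simp add: field_simps)
    then show ?thesis unfolding g_def by (simp add: per)
  qed
  have gcont: "continuous_on (sphere 0 1) g"
    unfolding continuous_on_eq_continuous_within
  proof
    fix z0 :: complex assume z0: "z0 \<in> sphere 0 1"
    define t0 where "t0 = Arg z0 / (2 * pi)"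
    have "z0 \<noteq> 0" using z0 by auto
    then have z0': "z0 = cis (2 * pi * t0)" using z0 by (simp add: t0_def cis_Arg sgn_eq)
    \<comment> \<open>Measuring the angle relative to \<open>z0\<close> keeps the argument near 0
      and so avoids the branch cut; periodicity of \<open>f\<close> makes both choices of angle
      agree.\<close>
    have eq: "g z = f (t0 + Arg (z / z0) / (2 * pi))" if "z \<in> sphere 0 1" for z
    proof -
      have "z / z0 \<noteq> 0" "norm (z / z0) = 1" using that z0 by (auto simp: norm_divide)
      then have "cis (Arg (z / z0)) = z / z0" by (simp add: cis_Arg sgn_eq)
      moreover have "2 * pi * (t0 + Arg (z / z0) / (2 * pi)) = 2 * pi * t0 + Arg (z / z0)"
        by (simp add: field_simps)
      moreover have "cis (2 * pi * t0 + Arg (z / z0)) = z0 * cis (Arg (z / z0))"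
        unfolding z0'[symmetric] cis_mult[symmetric] by (rule refl)
      ultimately have "cis (2 * pi * (t0 + Arg (z / z0) / (2 * pi))) = z"
        using \<open>z0 \<noteq> 0\<close> by simp
      then show ?thesis using g by metis
    qed
    have *: "continuous (at z0 within sphere 0 1) (\<lambda>z. f (t0 + Arg (z / z0) / (2 * pi)))"
    proof -
      have f: "isCont f x" for x using cont by (simp add: continuous_on_eq_continuous_at)
      have "isCont (\<lambda>z. Arg (z / z0)) z0"
      proof (rule isCont_o2[where g=Arg and f="\<lambda>z. z / z0"])
        show "isCont (\<lambda>z. z / z0) z0" using \<open>z0 \<noteq> 0\<close> by (rule isCont_divide[OF continuous_ident continuous_const])
        show "isCont Arg (z0 / z0)" using \<open>z0 \<noteq> 0\<close> by (intro continuous_at_Arg) auto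
      qed
      then have a: "isCont (\<lambda>z. t0 + Arg (z / z0) / (2 * pi)) z0"
        unfolding isCont_def by (rule tendsto_add[OF tendsto_const tendsto_divide[OF _ tendsto_const]]) simp
      show ?thesis
        by (rule continuous_at_imp_continuous_at_within[OF isCont_o2[where g=f, OF a f]])
    qed
    show "continuous (at z0 within sphere 0 1) g"
      by (rule continuous_transform_within[OF * zero_less_one z0]) (use eq in auto)
  qed
  have cf: "continuous_on {0..1} f" using cont by (rule continuous_on_subset) simp
  have null': "fourier_null (\<lambda>t. of_real (f t))"
    unfolding fourier_null_def using null cf by (auto intro!: continuous_on_of_real)
  obtain B where B: "B > 0" "\<And>t. t \<in> {0..1} \<Longrightarrow> \<bar>f t\<bar> \<le> B"
  proof -
    have "bounded (f ` {0..1})"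
      by (intro compact_imp_bounded compact_continuous_image cf) auto
    then show ?thesis using that unfolding bounded_pos by auto
  qed
  have small: "integral {0..1} (\<lambda>t. f t * f t) \<le> e * B" if e: "e > 0" for e
  proof -
    obtain p where p: "real_polynomial_function p" "\<And>z. z \<in> sphere 0 1 \<Longrightarrow> \<bar>g z - p z\<bar> < e"
      using Stone_Weierstrass_real_polynomial_function[OF _ gcont e] by auto
    let ?p = "\<lambda>t. p (cis (2 * pi * t))"
    have "continuous_on UNIV p" using p(1)
      by (simp add: continuous_on_polymonial_function real_polynomial_function_eq)
    then have pc: "continuous_on {0..1} ?p"
      by (rule continuous_on_compose2[where g=p]) (auto intro!: continuous_intros)
    have "integral {0..1} (\<lambda>t. of_real (?p t) * complex_of_real (f t) * cis (2 * pi * of_int 0 * t)) = 0"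
      using fourier_null_poly[OF p(1) null'] unfolding fourier_null_def by blast
    then have "integral {0..1} (\<lambda>t. complex_of_real (?p t * f t)) = 0" by simp
    moreover have "((\<lambda>t. complex_of_real (?p t * f t)) has_integral of_real (integral {0..1} (\<lambda>t. ?p t * f t))) {0..1}"
      by (intro has_integral_of_real integrable_integral integrable_continuous_interval continuous_intros cf pc)
    then have "integral {0..1} (\<lambda>t. complex_of_real (?p t * f t)) = of_real (integral {0..1} (\<lambda>t. ?p t * f t))"
      by (rule integral_unique)
    ultimately have "integral {0..1} (\<lambda>t. ?p t * f t) = 0"
      by (metis of_real_eq_0_iff)
    then have "integral {0..1} (\<lambda>t. f t * f t) = integral {0..1} (\<lambda>t. f t * f t) - integral {0..1} (\<lambda>t. ?p t * f t)"
      by simp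
    also have "\<dots> = integral {0..1} (\<lambda>t. f t * f t - ?p t * f t)"
      by (intro Henstock_Kurzweil_Integration.integral_diff[symmetric] integrable_continuous_interval continuous_intros cf pc)
    also have "\<dots> \<le> integral {0..1::real} (\<lambda>t. e * B)"
    proof (intro integral_le integrable_continuous_interval continuous_intros cf pc)
      fix t :: real assume t: "t \<in> {0..1}"
      have "f t * f t - ?p t * f t \<le> \<bar>(f t - ?p t) * f t\<bar>" by (simp add: algebra_simps)
      also have "\<dots> = \<bar>f t - ?p t\<bar> * \<bar>f t\<bar>" by (rule abs_mult)
      also have "\<dots> \<le> e * B"
        using p(2)[of "cis (2 * pi * t)"] B(2)[OF t] g[of t] by (intro mult_mono) auto
      finally show "f t * f t - ?p t * f t \<le> e * B" .
    qed
    finally show ?thesis by simp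
  qed
  have "integral {0..1} (\<lambda>t. f t * f t) \<le> 0"
  proof (rule field_le_epsilon)
    fix e :: real assume "e > 0"
    then show "integral {0..1} (\<lambda>t. f t * f t) \<le> 0 + e"
      using small[of "e / B"] B by simp
  qed
  moreover have "integral {0..1} (\<lambda>t. f t * f t) \<ge> 0"
    by (intro integral_nonneg integrable_continuous_interval continuous_intros cf) auto
  ultimately have "integral {0..1} (\<lambda>t. f t * f t) = 0" by simp
  then have "\<forall>t\<in>{0..1}. f t * f t = 0"
    by (subst (asm) integral_eq_0_iff) (auto intro!: continuous_intros cf)
  moreover have "f t = f (frac t)"
    using per[of "frac t" "\<lfloor>t\<rfloor>"] by (simp add: frac_def)
  moreover have "frac t \<in> {0..1}" using frac_lt_1[of t] by (simp add: less_imp_le)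
  ultimately show ?thesis by auto
qed

section \<open>Poisson summation for the Gaussian\<close>

text \<open>Kept to nonnegative functions so that no integrability is asked. It serves Poisson
  summation with period 1 and the unfolding of angles with period \<open>2 * pi\<close>.\<close>

lemma nn_integral_periodization:
  fixes p a :: real
  assumes p: "p > 0" and f[measurable]: "f \<in> borel_measurable borel"
  shows "(\<integral>\<^sup>+x. f x \<partial>lborel) =
    (\<integral>\<^sup>+k. (\<integral>\<^sup>+x. f (x + p * of_int k) * indicator {a..<a + p} x \<partial>lborel) \<partial>count_space (UNIV :: int set))"
proof -
  define S where "S k = {a + p * of_int k..<a + p * of_int k + p}" for k :: int
  have [measurable]: "S k \<in> sets borel" for k by (simp add: S_def)
  have S: "x \<in> S k \<longleftrightarrow> k = \<lfloor>(x - a) / p\<rfloor>" for x k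
  proof -
    have "k = \<lfloor>(x - a) / p\<rfloor> \<longleftrightarrow> of_int k \<le> (x - a) / p \<and> (x - a) / p < of_int k + 1"
      using floor_eq_iff[of "(x - a) / p" k] by auto
    then show ?thesis using p by (auto simp: S_def field_simps)
  qed
  have "f x = (\<integral>\<^sup>+k. f x * indicator (S k) x \<partial>count_space (UNIV :: int set))" for x
  proof -
    have "(\<integral>\<^sup>+k. f x * indicator (S k) x \<partial>count_space (UNIV :: int set)) =
      (\<Sum>k\<in>{\<lfloor>(x - a) / p\<rfloor>}. f x * indicator (S k) x)"
      by (rule nn_integral_count_space') (auto simp: S)
    then show ?thesis by (simp add: S)
  qed
  then have "(\<integral>\<^sup>+x. f x \<partial>lborel) = (\<integral>\<^sup>+x. (\<integral>\<^sup>+k. f x * indicator (S k) x \<partial>count_space (UNIV :: int set)) \<partial>lborel)"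
    by simp
  also have "\<dots> = (\<integral>\<^sup>+k. (\<integral>\<^sup>+x. f x * indicator (S k) x \<partial>lborel) \<partial>count_space (UNIV :: int set))"
    by (rule nn_integral_count_space_nn_integral) auto
  also have "\<dots> = (\<integral>\<^sup>+k. (\<integral>\<^sup>+x. f (x + p * of_int k) * indicator {a..<a + p} x \<partial>lborel) \<partial>count_space (UNIV :: int set))"
  proof (rule nn_integral_cong)
    fix k :: int
    show "(\<integral>\<^sup>+x. f x * indicator (S k) x \<partial>lborel) = (\<integral>\<^sup>+x. f (x + p * of_int k) * indicator {a..<a + p} x \<partial>lborel)"
      by (subst nn_integral_real_affine[where c=1 and t="p * of_int k"])
         (auto simp: S_def add.commute indicator_def intro!: nn_integral_cong)
  qed
  finally show ?thesis .
qed

lemma summable_on_if_nn_integral_finite: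
  fixes g :: "'a \<Rightarrow> real"
  assumes "\<And>x. x \<in> X \<Longrightarrow> g x \<ge> 0" "(\<integral>\<^sup>+x. ennreal (g x) \<partial>count_space X) < \<infinity>"
  shows "g summable_on X"
proof -
  have "(\<integral>\<^sup>+x. ennreal (norm (g x)) \<partial>count_space X) = (\<integral>\<^sup>+x. ennreal (g x) \<partial>count_space X)"
    using assms(1) by (intro nn_integral_cong) auto
  then have "integrable (count_space X) g"
    using assms(2) by (intro integrableI_bounded) auto
  then have "(\<lambda>x. norm (g x)) summable_on X"
    unfolding abs_summable_equivalent abs_summable_on_def .
  then show ?thesis by (rule abs_summable_summable)
qed

text \<open>Applied to a Gaussian times a character, this identifies the Fourier coefficients of the
  periodized Gaussian with values of its Fourier transform.\<close>

lemma infsum_integral_unit_intervals: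
  fixes h :: "real \<Rightarrow> complex"
  assumes h: "integrable lborel h" and cont: "continuous_on UNIV h"
  shows "(\<Sum>\<^sub>\<infinity>k\<in>(UNIV :: int set). integral {0..1} (\<lambda>s. h (s + of_int k))) = (\<integral>u. h u \<partial>lborel)"
proof -
  define f where "f k u = indicator {of_int k..<of_int k + 1} u *\<^sub>R h u" for k :: int and u :: real
  have [measurable]: "h \<in> borel_measurable borel" using h by auto
  have iff: "u \<in> {of_int k..<of_int k + 1} \<longleftrightarrow> k = \<lfloor>u\<rfloor>" for u :: real and k
    using floor_eq_iff[of u k] by auto
  have int: "integrable lborel (f k)" for k
    unfolding f_def by (rule integrable_mult_indicator[OF _ h]) auto
  have pt: "((\<lambda>k. f k u) has_sum h u) UNIV" for u
  proof -
    have "((\<lambda>k. f k u) has_sum f \<lfloor>u\<rfloor> u) {\<lfloor>u\<rfloor>}" by (rule has_sum_finiteI) auto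
    then have "((\<lambda>k. f k u) has_sum f \<lfloor>u\<rfloor> u) UNIV"
      by (subst (asm) has_sum_cong_neutral[where T=UNIV and g="\<lambda>k. f k u"])
         (auto simp: f_def indicator_def iff simp del: atLeastLessThan_iff)
    moreover have "f \<lfloor>u\<rfloor> u = h u" by (simp add: f_def indicator_def iff del: atLeastLessThan_iff)
    ultimately show ?thesis by simp
  qed
  have ptn: "(\<lambda>k. norm (f k u)) summable_on UNIV" for u
  proof -
    have "(\<lambda>k. norm (f k u)) summable_on {\<lfloor>u\<rfloor>}" by simp
    then show ?thesis
      by (subst (asm) summable_on_cong_neutral[where T=UNIV and g="\<lambda>k. norm (f k u)"])
         (auto simp: f_def indicator_def iff simp del: atLeastLessThan_iff)
  qed
  have nrm: "(\<lambda>k. \<integral>u. norm (f k u) \<partial>lborel) summable_on UNIV"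
  proof (rule summable_on_if_nn_integral_finite)
    have "(\<integral>\<^sup>+k. ennreal (\<integral>u. norm (f k u) \<partial>lborel) \<partial>count_space UNIV) =
      (\<integral>\<^sup>+k. (\<integral>\<^sup>+u. norm (h (u + 1 * of_int k)) * indicator {0..<0 + 1} u \<partial>lborel) \<partial>count_space (UNIV::int set))"
    proof (rule nn_integral_cong)
      fix k :: int
      have "ennreal (\<integral>u. norm (f k u) \<partial>lborel) = (\<integral>\<^sup>+u. norm (f k u) \<partial>lborel)"
        using int[of k] by (intro nn_integral_eq_integral[symmetric]) auto
      also have "\<dots> = (\<integral>\<^sup>+u. norm (f k (of_int k + 1 * u)) \<partial>lborel)"
        using borel_measurable_integrable[OF int[of k]]
        by (subst nn_integral_real_affine[where c=1 and t="of_int k"]) auto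
      also have "\<dots> = (\<integral>\<^sup>+u. norm (h (u + 1 * of_int k)) * indicator {0..<0 + 1} u \<partial>lborel)"
        by (intro nn_integral_cong) (auto simp: f_def indicator_def add.commute)
      finally show "ennreal (\<integral>u. norm (f k u) \<partial>lborel) = \<dots>" .
    qed
    also have "\<dots> = (\<integral>\<^sup>+u. norm (h u) \<partial>lborel)"
      using nn_integral_periodization[of 1 "\<lambda>u. ennreal (norm (h u))" 0]
      by (simp add: ennreal_mult' ennreal_indicator)
    also have "\<dots> < \<infinity>" using h by (simp add: integrable_iff_bounded)
    finally show "(\<integral>\<^sup>+k. ennreal (\<integral>u. norm (f k u) \<partial>lborel) \<partial>count_space UNIV) < \<infinity>" .
  qed auto
  have "(\<integral>u. f k u \<partial>lborel) = integral {0..1} (\<lambda>s. h (s + of_int k))" for k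
  proof -
    have "(\<integral>u. f k u \<partial>lborel) = (\<integral>u. f k (of_int k + 1 * u) \<partial>lborel)"
      by (subst lborel_integral_real_affine[where c=1 and t="of_int k"]) auto
    also have "\<dots> = (\<integral>u. indicator {0..1} u *\<^sub>R h (u + of_int k) \<partial>lborel)"
    proof (rule integral_cong_AE)
      \<comment> \<open>The half-open and the closed unit interval differ only in the point
        1.\<close>
      show "AE u in lborel. f k (of_int k + 1 * u) = indicator {0..1} u *\<^sub>R h (u + of_int k)"
        using AE_lborel_singleton[of 1]
        by eventually_elim (auto simp: f_def indicator_def add.commute)
    qed (auto simp: f_def)
    also have "\<dots> = (LINT u:{0..1}|lborel. h (u + of_int k))"
      by (simp add: set_lebesgue_integral_def)
    also have "\<dots> = integral {0..1} (\<lambda>s. h (s + of_int k))"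
    proof (rule set_borel_integral_eq_integral(2), rule borel_integrable_compact[unfolded set_integrable_def[symmetric]])
      show "continuous_on {0..1} (\<lambda>s. h (s + of_int k))"
        by (rule continuous_on_compose2[OF cont]) (auto intro!: continuous_intros)
    qed auto
    finally show ?thesis .
  qed
  moreover have "(\<integral>u. (\<Sum>\<^sub>\<infinity>k\<in>UNIV. f k u) \<partial>lborel) = (\<Sum>\<^sub>\<infinity>k\<in>UNIV. \<integral>u. f k u \<partial>lborel)"
    by (rule integral_infsum_swap) (use int ptn nrm in \<open>auto simp: lborel.sigma_finite_measure_axioms\<close>)
  ultimately show ?thesis using infsumI[OF pt] by simp
qed

text \<open>A rescaling of the characteristic function of the standard normal distribution.\<close>

lemma gaussian_fourier:
  fixes y t :: real
  assumes y: "y > 0"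
  defines "h \<equiv> \<lambda>u. of_real (exp (- pi / y * u\<^sup>2)) * cis (2 * pi * t * u)"
  shows "integrable lborel h" "(\<integral>u. h u \<partial>lborel) = of_real (sqrt y * exp (- pi * y * t\<^sup>2))"
proof -
  \<comment> \<open>Chosen so that \<open>(c * u)^2 / 2\<close> is the exponent
    \<open>pi / y * u^2\<close>; \<open>r\<close> is the frequency that turns into
    \<open>2 * pi * t\<close> under the same substitution.\<close>
  define c where "c = sqrt (2 * pi / y)"
  have c: "c > 0" "c\<^sup>2 = 2 * pi / y" using y by (auto simp: c_def)
  define r where "r = 2 * pi * t / c"
  define g where "g x = std_normal_density x *\<^sub>R iexp (r * x)" for x
  have g: "integrable lborel g"
  proof (rule Bochner_Integration.integrable_bound)
    show "integrable lborel std_normal_density" by (rule integrable_normal_density) simp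
    show "g \<in> borel_measurable lborel" unfolding g_def
      by (auto intro!: borel_measurable_scaleR borel_measurable_continuous_onI continuous_intros)
  qed (auto simp: g_def)
  have "char std_normal_distribution r = (\<integral>x. g x \<partial>lborel)"
    unfolding char_def g_def by (subst integral_density) (auto simp: normal_density_nonneg)
  then have 1: "(\<integral>x. g x \<partial>lborel) = of_real (exp (- (r\<^sup>2) / 2))"
    unfolding char_std_normal_distribution by simp
  have gh: "g (0 + c * u) = of_real (1 / sqrt (2 * pi)) * h u" for u
  proof -
    have "(c * u)\<^sup>2 / 2 = pi / y * u\<^sup>2" using c by (simp add: power_mult_distrib)
    then have "std_normal_density (c * u) = 1 / sqrt (2 * pi) * exp (- pi / y * u\<^sup>2)"
      by (simp add: std_normal_density_def)
    moreover have "r * (c * u) = 2 * pi * t * u" using c by (simp add: r_def)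
    then have "iexp (r * (c * u)) = cis (2 * pi * t * u)" by (simp only: cis_conv_exp)
    ultimately show ?thesis
      unfolding g_def h_def by (simp only: add_0_left scaleR_conv_of_real of_real_mult mult.assoc)
  qed
  have "integrable lborel (\<lambda>u. g (0 + c * u))"
    using g c by (intro lborel_integrable_real_affine) auto
  then have "integrable lborel (\<lambda>u. of_real (sqrt (2 * pi)) * (of_real (1 / sqrt (2 * pi)) * h u))"
    unfolding gh by (rule integrable_mult_right)
  then show "integrable lborel h" by (simp add: mult.assoc[symmetric] of_real_mult[symmetric] del: of_real_mult)
  have "(\<integral>x. g x \<partial>lborel) = of_real c * (of_real (1 / sqrt (2 * pi)) * (\<integral>u. h u \<partial>lborel))"
    using c lborel_integral_real_affine[of c g 0] by (simp only: gh integral_mult_right_zero scaleR_conv_of_real abs_of_pos)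
  moreover have "c * (1 / sqrt (2 * pi)) = 1 / sqrt y" using y by (simp add: c_def real_sqrt_divide)
  ultimately have "of_real (1 / sqrt y) * (\<integral>u. h u \<partial>lborel) = of_real (exp (- (r\<^sup>2) / 2))"
    using 1 by (metis mult.assoc of_real_mult)
  moreover have "r\<^sup>2 / 2 = pi * y * t\<^sup>2"
    using c y by (simp add: r_def power_divide power_mult_distrib power2_eq_square)
  ultimately show "(\<integral>u. h u \<partial>lborel) = of_real (sqrt y * exp (- pi * y * t\<^sup>2))"
    using y by (simp add: field_simps)
qed

lemma series_integral:
  fixes f :: "int \<Rightarrow> real \<Rightarrow> complex"
  assumes cont: "\<And>k. continuous_on {0..1} (f k)"
    and bound: "\<And>k s. s \<in> {0..1} \<Longrightarrow> norm (f k s) \<le> M k" and M: "M summable_on UNIV"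
  shows "integral {0..1} (\<lambda>s. \<Sum>\<^sub>\<infinity>k. f k s) = (\<Sum>\<^sub>\<infinity>k. integral {0..1} (f k))"
proof -
  have u: "uniform_limit {0..1} (\<lambda>X s. \<Sum>k\<in>X. f k s) (\<lambda>s. \<Sum>\<^sub>\<infinity>k. f k s) (finite_subsets_at_top UNIV)"
    using bound M by (intro Weierstrass_m_test_general) auto
  obtain I J where I: "\<And>X. ((\<lambda>s. \<Sum>k\<in>X. f k s) has_integral I X) {0..1}"
    and J: "((\<lambda>s. \<Sum>\<^sub>\<infinity>k. f k s) has_integral J) {0..1}" and lim: "(I \<longlongrightarrow> J) (finite_subsets_at_top UNIV)"
    by (rule uniform_limit_integral[OF u]) (auto intro!: continuous_intros cont)
  have IX: "I X = (\<Sum>k\<in>X. integral {0..1} (f k))" for X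
  proof (cases "finite X")
    case True
    then show ?thesis using I[of X] by (subst integral_sum[symmetric])
      (auto intro!: integrable_continuous_interval cont simp: integral_unique)
  next
    case False
    then show ?thesis using I[of X] by (simp add: has_integral_0_eq)
  qed
  have "((\<lambda>k. integral {0..1} (f k)) has_sum J) UNIV"
    using lim
    unfolding has_sum_def ext[OF IX, symmetric] .
  then show ?thesis using J by (simp add: integral_unique infsumI)
qed

lemma series_continuous:
  fixes f :: "int \<Rightarrow> real \<Rightarrow> complex"
  assumes cont: "\<And>k. continuous_on A (f k)"
    and bound: "\<And>k s. s \<in> A \<Longrightarrow> norm (f k s) \<le> M k" and M: "M summable_on UNIV"
  shows "continuous_on A (\<lambda>s. \<Sum>\<^sub>\<infinity>k. f k s)"
proof (rule uniform_limit_theorem)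
  show "uniform_limit A (\<lambda>X s. \<Sum>k\<in>X. f k s) (\<lambda>s. \<Sum>\<^sub>\<infinity>k. f k s) (finite_subsets_at_top UNIV)"
    using bound M by (intro Weierstrass_m_test_general) auto
qed (auto intro!: continuous_intros cont)

lemma integral_cis:
  fixes m :: int
  shows "integral {0..1} (\<lambda>s. cis (2 * pi * of_int m * s)) = (if m = 0 then 1 else 0)"
proof (cases "m = 0")
  case False
  define c where "c = \<i> * of_real (2 * pi * of_int m)"
  have c: "c \<noteq> 0" using False by (simp add: c_def)
  have cis: "cis (2 * pi * of_int m * s) = exp (c * of_real s)" for s
    by (simp add: cis_conv_exp c_def mult.assoc)
  have "((\<lambda>s. exp (c * of_real s)) has_integral (exp (c * of_real 1) / c - exp (c * of_real 0) / c)) {0..1}"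
  proof (rule fundamental_theorem_of_calculus)
    fix x :: real assume "x \<in> {0..1}"
    have "((\<lambda>z. exp (c * z) / c) has_field_derivative exp (c * of_real x)) (at (of_real x))"
      using c by (auto intro!: derivative_eq_intros)
    then show "((\<lambda>s. exp (c * of_real s) / c) has_vector_derivative exp (c * of_real x)) (at x within {0..1})"
      by (rule has_vector_derivative_real_field)
  qed simp
  moreover have "exp (c * of_real 1) = 1"
    using cis_multiple_2pi[of "of_int m"] cis[of 1] by simp
  ultimately show ?thesis unfolding cis using False by (simp add: integral_unique)
qed simp

lemma infsum_single:
  fixes f :: "'a \<Rightarrow> 'b::{comm_monoid_add,t2_space}"
  assumes "\<And>x. x \<noteq> a \<Longrightarrow> f x = 0"
  shows "(\<Sum>\<^sub>\<infinity>x. f x) = f a"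
proof -
  have "(\<Sum>\<^sub>\<infinity>x\<in>UNIV. f x) = (\<Sum>\<^sub>\<infinity>x\<in>{a}. f x)"
    by (rule infsum_cong_neutral) (use assms in auto)
  then show ?thesis by simp
qed

lemma infsum_of_real:
  "(\<Sum>\<^sub>\<infinity>x\<in>A. complex_of_real (f x)) = of_real (\<Sum>\<^sub>\<infinity>x\<in>A. f x)"
proof (cases "f summable_on A")
  case True
  then show ?thesis by (intro infsumI has_sum_of_real) auto
next
  case False
  then have "\<not> (\<lambda>x. complex_of_real (f x)) summable_on A"
    using summable_on_Re[of "\<lambda>x. complex_of_real (f x)" A] by auto
  then show ?thesis using False by (simp add: infsum_not_exists)
qed

text \<open>A summable majorant, uniform for bounded \<open>s\<close>, as the M-test requires. It
  rests on \<open>(s + k)^2 + s^2 \<ge> k^2 / 2\<close>.\<close>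

lemma gaussian_shift_bound:
  fixes c s R k :: real
  assumes "c \<ge> 0" "\<bar>s\<bar> \<le> R"
  shows "exp (- c * (s + k)\<^sup>2) \<le> exp (c * R\<^sup>2) * exp (- (c / 2) * k\<^sup>2)"
proof -
  have "s\<^sup>2 \<le> R\<^sup>2" using assms(2) by (metis abs_ge_zero power2_abs power_mono)
  moreover have "(s + k)\<^sup>2 + s\<^sup>2 - k\<^sup>2 / 2 = 2 * (s + k / 2)\<^sup>2" by (simp add: power2_eq_square field_simps)
  then have "(s + k)\<^sup>2 + s\<^sup>2 - k\<^sup>2 / 2 \<ge> 0" by simp
  ultimately have "k\<^sup>2 / 2 - R\<^sup>2 \<le> (s + k)\<^sup>2" by simp
  then have "c * (k\<^sup>2 / 2 - R\<^sup>2) \<le> c * (s + k)\<^sup>2" using assms(1) by (rule mult_left_mono)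
  then show ?thesis by (simp add: exp_add[symmetric] algebra_simps)
qed

text \<open>Both sides are continuous and 1-periodic in \<open>s\<close> and have the same Fourier
  coefficients, so \<open>fourier_unique\<close> applies to their difference. Pointwise convergence
  of a general Fourier series never enters.\<close>

lemma poisson_summation_gaussian:
  fixes y s :: real
  assumes y: "y > 0"
  shows "(\<Sum>\<^sub>\<infinity>b::int. of_real (exp (- pi * y * (of_int b)\<^sup>2)) * cis (2 * pi * of_int b * s)) =
    of_real (1 / sqrt y * (\<Sum>\<^sub>\<infinity>k::int. exp (- (pi / y) * (s + of_int k)\<^sup>2)))"
proof -
  define f where "f k s = complex_of_real (exp (- (pi / y) * (s + of_int k)\<^sup>2))" for k :: int and s
  define g where "g b s = complex_of_real (exp (- pi * y * (of_int b)\<^sup>2)) * cis (2 * pi * of_int b * s)" for b :: int and s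
  define G where "G s = (\<Sum>\<^sub>\<infinity>k. f k s)" for s
  define T where "T s = (\<Sum>\<^sub>\<infinity>b. g b s)" for s
  define M where "M R k = exp (pi / y * R\<^sup>2) * exp (- (pi / y / 2) * (of_int k)\<^sup>2)" for R :: real and k :: int
  define L where "L b = exp (- (pi * y) * (of_int b)\<^sup>2)" for b :: int
  have M: "M R summable_on UNIV" for R
    unfolding M_def using y by (intro summable_on_cmult_right gaussian_summable) auto
  have L: "L summable_on UNIV"
    unfolding L_def using y by (intro gaussian_summable) auto
  have fM: "norm (f k s) \<le> M R k" if "\<bar>s\<bar> \<le> R" for k s R
    using gaussian_shift_bound[of "pi / y" s R "of_int k"] that y unfolding f_def M_def by simp
  have gL: "norm (g b s) \<le> L b" for b s
    unfolding g_def L_def by (simp add: norm_mult)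
  have fc: "continuous_on A (f k)" for A k
    unfolding f_def by (intro continuous_intros)
  have gc: "continuous_on A (g b)" for A b
    unfolding g_def by (intro continuous_intros)
  have Tc: "continuous_on UNIV T"
    unfolding T_def by (rule series_continuous[OF gc gL L])
  have Gc: "continuous_on UNIV G"
  proof -
    \<comment> \<open>The terms of \<open>G\<close> are dominated uniformly only on bounded sets, so
      continuity is shown on an interval around each point.\<close>
    have "isCont G x" for x
    proof -
      have "continuous_on {- (\<bar>x\<bar> + 1)<..<\<bar>x\<bar> + 1} G"
        unfolding G_def by (rule series_continuous[OF fc fM M, of _ "\<bar>x\<bar> + 1"]) auto
      then show ?thesis by (rule continuous_on_interior) auto
    qed
    then show ?thesis by (simp add: continuous_on_eq_continuous_at)
  qed
  have ReG: "of_real (Re (G s)) = G s" for s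
    unfolding G_def f_def infsum_of_real by simp
  have ReT: "of_real (Re (T s)) = T s" for s
  proof -
    have "bij (uminus :: int \<Rightarrow> int)" by (rule bij_uminus)
    then have "T s = (\<Sum>\<^sub>\<infinity>b. g (- b) s)"
      unfolding T_def by (rule infsum_reindex_bij_betw[symmetric])
    also have "\<dots> = (\<Sum>\<^sub>\<infinity>b. cnj (g b s))" by (simp add: g_def cis_cnj)
    also have "\<dots> = cnj (T s)" unfolding T_def by (rule infsum_cnj)
    finally show ?thesis by (metis Reals_cnj_iff of_real_Re)
  qed
  \<comment> \<open>\<open>fourier_unique\<close> is about real functions; \<open>ReG\<close> and
    \<open>ReT\<close> say that passing to real parts loses nothing.\<close>
  define D where "D s = Re (G s) - sqrt y * Re (T s)" for s
  have D0: "D s = 0" for s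
  proof (rule fourier_unique[where f=D])
    show "continuous_on UNIV D"
      unfolding D_def by (intro continuous_intros Gc Tc)
    fix t :: real and k :: int
    have "bij (\<lambda>j::int. j + k)" by (rule o_bij[where g="\<lambda>j. j - k"]) auto
    then have "G t = (\<Sum>\<^sub>\<infinity>j. f (j + k) t)"
      unfolding G_def by (rule infsum_reindex_bij_betw[symmetric])
    then have "G (t + of_int k) = G t"
      unfolding G_def f_def by (simp add: add_ac)
    moreover have "g b (t + of_int k) = g b t" for b
      unfolding g_def using cis_add_int[of "of_int b * t" "b * k"] by (simp add: algebra_simps)
    ultimately show "D (t + of_int k) = D t" unfolding D_def T_def by simp
  next
    fix n :: int
    define h where "h = (\<lambda>u. of_real (exp (- pi / y * u\<^sup>2)) * cis (2 * pi * of_int n * u))"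
    have h: "integrable lborel h" "(\<integral>u. h u \<partial>lborel) = of_real (sqrt y * exp (- pi * y * (of_int n)\<^sup>2))"
      unfolding h_def using gaussian_fourier[OF y, of "of_int n"] by auto
    have hc: "continuous_on UNIV h" unfolding h_def by (intro continuous_intros)
    have hs: "h (s + of_int k) = f k s * cis (2 * pi * of_int n * s)" for s k
      unfolding h_def f_def using cis_add_int[of "of_int n * s" "n * k"] by (simp add: algebra_simps)
    have "integral {0..1} (\<lambda>s. G s * cis (2 * pi * of_int n * s)) =
        integral {0..1} (\<lambda>s. \<Sum>\<^sub>\<infinity>k. f k s * cis (2 * pi * of_int n * s))"
      unfolding G_def by (simp add: infsum_cmult_left')
    also have "\<dots> = (\<Sum>\<^sub>\<infinity>k. integral {0..1} (\<lambda>s. f k s * cis (2 * pi * of_int n * s)))"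
    proof (rule series_integral[OF _ _ M])
      show "norm (f k s * cis (2 * pi * of_int n * s)) \<le> M 1 k" if "s \<in> {0..1}" for k s
        using fM[of s 1 k] that by (simp add: norm_mult)
    qed (intro continuous_intros fc)
    also have "\<dots> = of_real (sqrt y * exp (- pi * y * (of_int n)\<^sup>2))"
      using infsum_integral_unit_intervals[OF h(1) hc] h(2) by (simp add: hs)
    finally have 1: "integral {0..1} (\<lambda>s. G s * cis (2 * pi * of_int n * s)) = of_real (sqrt y * exp (- pi * y * (of_int n)\<^sup>2))" .
    have gn: "g b s * cis (2 * pi * of_int n * s) = of_real (L b) * cis (2 * pi * of_int (b + n) * s)" for b s
      unfolding g_def L_def by (simp add: cis_mult algebra_simps)
    have "integral {0..1} (\<lambda>s. T s * cis (2 * pi * of_int n * s)) =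
        integral {0..1} (\<lambda>s. \<Sum>\<^sub>\<infinity>k. g k s * cis (2 * pi * of_int n * s))"
      unfolding T_def by (simp add: infsum_cmult_left')
    also have "\<dots> = (\<Sum>\<^sub>\<infinity>k. integral {0..1} (\<lambda>s. g k s * cis (2 * pi * of_int n * s)))"
    proof (rule series_integral[OF _ _ L])
      show "norm (g k s * cis (2 * pi * of_int n * s)) \<le> L k" for k s
        using gL[of k s] by (simp add: norm_mult)
    qed (intro continuous_intros gc)
    also have "\<dots> = (\<Sum>\<^sub>\<infinity>k. of_real (L k) * (if k + n = 0 then 1 else 0))"
      by (simp only: gn integral_mult_right integral_cis)
    also have "\<dots> = of_real (L (- n))"
      by (subst infsum_single[where a="- n"]) auto
    finally have 2: "integral {0..1} (\<lambda>s. T s * cis (2 * pi * of_int n * s)) = of_real (exp (- pi * y * (of_int n)\<^sup>2))"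
      by (simp add: L_def)
    have "integral {0..1} (\<lambda>t. of_real (D t) * cis (2 * pi * of_int n * t)) =
       integral {0..1} (\<lambda>t. G t * cis (2 * pi * of_int n * t) - of_real (sqrt y) * (T t * cis (2 * pi * of_int n * t)))"
      unfolding D_def by (simp add: ReG ReT algebra_simps)
    also have "\<dots> = integral {0..1} (\<lambda>t. G t * cis (2 * pi * of_int n * t)) -
      of_real (sqrt y) * integral {0..1} (\<lambda>t. T t * cis (2 * pi * of_int n * t))"
      by (subst Henstock_Kurzweil_Integration.integral_diff)
        (auto intro!: integrable_continuous_interval continuous_intros continuous_on_subset[OF Gc] continuous_on_subset[OF Tc])
    also have "\<dots> = 0" unfolding 1 2 by simp
    finally show "integral {0..1} (\<lambda>t. of_real (D t) * cis (2 * pi * of_int n * t)) = 0" .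
  qed
  have "G s = of_real (sqrt y) * T s"
    using D0[of s] unfolding D_def by (metis ReG ReT of_real_mult eq_iff_diff_eq_0)
  then have "T s = of_real (1 / sqrt y) * G s" using y by simp
  then show ?thesis unfolding T_def G_def f_def g_def infsum_of_real by simp
qed

section \<open>The theta series and its modular invariance\<close>

text \<open>The contribution of one pair of complementary planes with fluxes \<open>a\<close> and
  \<open>b\<close>. The constant \<open>2 * pi^2 * \<beta>\<close> is \<beta>/2 times the square of
  the flux unit \<open>2 * pi\<close>.\<close>

definition theta_pair :: "real \<Rightarrow> real \<Rightarrow> complex" where
  "theta_pair \<beta> \<theta> = (\<Sum>\<^sub>\<infinity>(a, b)\<in>(UNIV :: (int \<times> int) set).
     of_real (exp (- 2 * pi\<^sup>2 * \<beta> * ((of_int a)\<^sup>2 + (of_int b)\<^sup>2))) * cis (- \<theta> * of_int a * of_int b))"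

text \<open>The theta series of the binary quadratic form
  \<open>|k + \<tau> a|^2 / Im \<tau>\<close>, which has determinant one; \<tau> in the upper half
  plane parametrizes such forms.\<close>

definition lattice_theta :: "complex \<Rightarrow> real" where
  "lattice_theta \<tau> = (\<Sum>\<^sub>\<infinity>(a, k)\<in>(UNIV :: (int \<times> int) set).
     exp (- pi * (cmod (of_int k + \<tau> * of_int a))\<^sup>2 / Im \<tau>))"

lemma gaussian_summable_pair:
  fixes c d :: real
  assumes "c > 0" "d > 0"
  shows "(\<lambda>(a, b). exp (- c * (of_int a)\<^sup>2) * exp (- d * (of_int b)\<^sup>2)) summable_on (UNIV :: (int \<times> int) set)"
proof -
  have "(\<lambda>p. norm (case p of (a, b) \<Rightarrow> exp (- c * (of_int a)\<^sup>2) * exp (- d * (of_int b)\<^sup>2))) summable_on (SIGMA a:(UNIV::int set). (UNIV :: int set))"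
    unfolding Infinite_Sum.abs_summable_on_Sigma_iff
  proof (intro conjI ballI)
    show "(\<lambda>b. norm (case (a, b) of (a, b) \<Rightarrow> exp (- c * (of_int a)\<^sup>2) * exp (- d * (of_int b)\<^sup>2))) summable_on UNIV" for a :: int
      using gaussian_summable[OF assms(2)] by (auto intro: summable_on_cmult_right)
    show "(\<lambda>a. norm (\<Sum>\<^sub>\<infinity>b::int. norm (case (a, b) of (a, b) \<Rightarrow> exp (- c * (of_int a)\<^sup>2) * exp (- d * (of_int b)\<^sup>2)))) summable_on (UNIV :: int set)"
      using gaussian_summable[OF assms(1)] by (auto simp: infsum_cmult_right' abs_mult intro: summable_on_cmult_left)
  qed
  then show ?thesis using abs_summable_summable by fastforce
qed

lemma lattice_theta_term:
  assumes "Im \<tau> > 0"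
  shows "exp (- pi * (cmod (of_int k + \<tau> * of_int a))\<^sup>2 / Im \<tau>) =
    exp (- pi * Im \<tau> * (of_int a)\<^sup>2) * exp (- (pi / Im \<tau>) * (Re \<tau> * of_int a + of_int k)\<^sup>2)"
  unfolding cmod_power2
  using assms by (simp add: exp_add[symmetric] field_simps power2_eq_square)

lemma lattice_theta_summable:
  assumes y: "Im \<tau> > 0"
  shows "(\<lambda>(a, k). exp (- pi * (cmod (of_int k + \<tau> * of_int a))\<^sup>2 / Im \<tau>)) summable_on (UNIV :: (int \<times> int) set)"
proof (rule summable_on_comparison_test)
  define x y where "x = Re \<tau>" and "y = Im \<tau>"
  \<comment> \<open>A diagonal lower bound for the quadratic form is sought. Splitting off
    \<open>K\<close> costs \<open>(x * A)^2\<close>, which may exceed the available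
    \<open>y^2 * A^2\<close>; with the weight \<open>r\<close> the cost stays below half of
    it.\<close>
  define r where "r = y\<^sup>2 / (y\<^sup>2 + 2 * x\<^sup>2)"
  have y: "y > 0" using assms by (simp add: y_def)
  then have den: "y\<^sup>2 + 2 * x\<^sup>2 > 0" by (intro add_pos_nonneg) auto
  have r: "r > 0" "r \<le> 1" "r * x\<^sup>2 \<le> y\<^sup>2 / 2"
    unfolding r_def using y den by (auto simp: field_simps)
  show "(\<lambda>(a, k). exp (- (pi * y / 2) * (of_int a)\<^sup>2) * exp (- (pi / y * r / 2) * (of_int k)\<^sup>2)) summable_on (UNIV :: (int \<times> int) set)"
    using y r by (intro gaussian_summable_pair) auto
  fix p :: "int \<times> int"
  obtain a k where p: "p = (a, k)" by (cases p)
  define A K where "A = real_of_int a" and "K = real_of_int k"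
  have "(x * A + K)\<^sup>2 + (x * A)\<^sup>2 - K\<^sup>2 / 2 = 2 * (x * A + K / 2)\<^sup>2" by (simp add: power2_eq_square field_simps)
  then have "(x * A + K)\<^sup>2 \<ge> K\<^sup>2 / 2 - (x * A)\<^sup>2" using zero_le_power2[of "x * A + K / 2"] by linarith
  then have "r * (K\<^sup>2 / 2 - (x * A)\<^sup>2) \<le> r * (x * A + K)\<^sup>2" using r by (intro mult_left_mono) auto
  also have "\<dots> \<le> 1 * (x * A + K)\<^sup>2" using r by (intro mult_right_mono) auto
  finally have "r * K\<^sup>2 / 2 - (r * x\<^sup>2) * A\<^sup>2 \<le> (x * A + K)\<^sup>2" by (simp add: power_mult_distrib algebra_simps)
  moreover have "(r * x\<^sup>2) * A\<^sup>2 \<le> (y\<^sup>2 / 2) * A\<^sup>2" using r by (intro mult_right_mono) auto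
  ultimately have "r * K\<^sup>2 / 2 + y\<^sup>2 / 2 * A\<^sup>2 \<le> y\<^sup>2 * A\<^sup>2 + (x * A + K)\<^sup>2" by (simp add: field_simps)
  then have "pi / y * (r * K\<^sup>2 / 2 + y\<^sup>2 / 2 * A\<^sup>2) \<le> pi / y * (y\<^sup>2 * A\<^sup>2 + (x * A + K)\<^sup>2)"
    using y by (intro mult_left_mono) auto
  then have "exp (- (pi / y * (y\<^sup>2 * A\<^sup>2 + (x * A + K)\<^sup>2))) \<le> exp (- (pi / y * (r * K\<^sup>2 / 2 + y\<^sup>2 / 2 * A\<^sup>2)))"
    by simp
  moreover have "- (pi / y * (y\<^sup>2 * A\<^sup>2 + (x * A + K)\<^sup>2)) = - pi * y * A\<^sup>2 + - (pi / y) * (x * A + K)\<^sup>2"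
    "- (pi / y * (r * K\<^sup>2 / 2 + y\<^sup>2 / 2 * A\<^sup>2)) = - (pi * y / 2) * A\<^sup>2 + - (pi / y * r / 2) * K\<^sup>2"
    using y by (simp_all add: field_simps power2_eq_square)
  ultimately have "exp (- pi * y * A\<^sup>2) * exp (- (pi / y) * (x * A + K)\<^sup>2) \<le>
     exp (- (pi * y / 2) * A\<^sup>2) * exp (- (pi / y * r / 2) * K\<^sup>2)"
    by (simp only: exp_add)
  then show "(case p of (a, k) \<Rightarrow> exp (- pi * (cmod (of_int k + \<tau> * of_int a))\<^sup>2 / Im \<tau>)) \<le>
     (case p of (a, k) \<Rightarrow> exp (- (pi * y / 2) * (of_int a)\<^sup>2) * exp (- (pi / y * r / 2) * (of_int k)\<^sup>2))"
    using lattice_theta_term[OF assms, of k a] unfolding p A_def K_def x_def y_def by simp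
qed auto

lemma theta_pair_summable:
  assumes "\<beta> > 0"
  shows "(\<lambda>p. norm (case p of (a, b) \<Rightarrow> of_real (exp (- 2 * pi\<^sup>2 * \<beta> * ((of_int a)\<^sup>2 + (of_int b)\<^sup>2))) * cis (- \<theta> * of_int a * of_int b)))
    summable_on (UNIV :: (int \<times> int) set)"
proof -
  have "norm (case p of (a, b) \<Rightarrow> of_real (exp (- 2 * pi\<^sup>2 * \<beta> * ((of_int a)\<^sup>2 + (of_int b)\<^sup>2))) * cis (- \<theta> * of_int a * of_int b)) =
    (case p of (a, b) \<Rightarrow> exp (- (2 * pi\<^sup>2 * \<beta>) * (of_int a)\<^sup>2) * exp (- (2 * pi\<^sup>2 * \<beta>) * (of_int b)\<^sup>2))" for p :: "int \<times> int"
    by (cases p) (simp add: norm_mult exp_add[symmetric] algebra_simps)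
  then show ?thesis using gaussian_summable_pair[of "2 * pi\<^sup>2 * \<beta>" "2 * pi\<^sup>2 * \<beta>"] assms by simp
qed

text \<open>For fixed \<open>a\<close> the phase is a character in \<open>b\<close>, so Poisson
  summation in \<open>b\<close> turns it into the shift \<open>- \<theta> * a / (2 * pi)\<close>,
  the real part of \<tau> entering the quadratic form. The factor
  \<open>1 / sqrt (2 * pi * \<beta>)\<close> is the Poisson factor.\<close>

lemma theta_pair_eq_lattice_theta:
  assumes \<beta>: "\<beta> > 0"
  shows "theta_pair \<beta> \<theta> = of_real (1 / sqrt (2 * pi * \<beta>) * lattice_theta (tau \<beta> \<theta>))"
proof -
  define y x where "y = 2 * pi * \<beta>" and "x = \<theta> / (2 * pi)"
  have y: "y > 0" using \<beta> by (simp add: y_def)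
  have tau: "Re (tau \<beta> \<theta>) = x" "Im (tau \<beta> \<theta>) = y" by (simp_all add: tau_def x_def y_def)
  define f where "f a b = complex_of_real (exp (- 2 * pi\<^sup>2 * \<beta> * ((of_int a)\<^sup>2 + (of_int b)\<^sup>2))) * cis (- \<theta> * of_int a * of_int b)" for a b :: int
  define F where "F a k = exp (- pi * (cmod (of_int k + tau \<beta> \<theta> * of_int a))\<^sup>2 / Im (tau \<beta> \<theta>))" for a k :: int
  have F: "F a k = exp (- pi * y * (of_int a)\<^sup>2) * exp (- (pi / y) * (x * of_int a + of_int k)\<^sup>2)" for a k
    unfolding F_def using lattice_theta_term[of "tau \<beta> \<theta>" k a] y by (simp only: tau)
  have inner: "(\<Sum>\<^sub>\<infinity>b. f a b) = of_real (1 / sqrt y * (\<Sum>\<^sub>\<infinity>k. F a k))" for a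
  proof -
    have "f a b = of_real (exp (- pi * y * (of_int a)\<^sup>2)) *
       (of_real (exp (- pi * y * (of_int b)\<^sup>2)) * cis (2 * pi * of_int b * (- x * of_int a)))" for b
    proof -
      have "- 2 * pi\<^sup>2 * \<beta> * ((of_int a)\<^sup>2 + (of_int b)\<^sup>2) = - pi * y * (of_int a)\<^sup>2 + - pi * y * (of_int b)\<^sup>2"
        by (simp add: y_def power2_eq_square algebra_simps)
      moreover have "- \<theta> * of_int a * of_int b = 2 * pi * of_int b * (- x * of_int a)"
        by (simp add: x_def)
      ultimately show ?thesis by (simp only: f_def exp_add of_real_mult mult.assoc)
    qed
    then have "(\<Sum>\<^sub>\<infinity>b. f a b) = of_real (exp (- pi * y * (of_int a)\<^sup>2)) *
       (\<Sum>\<^sub>\<infinity>b::int. of_real (exp (- pi * y * (of_int b)\<^sup>2)) * cis (2 * pi * of_int b * (- x * of_int a)))"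
      by (simp only: infsum_cmult_right')
    also have "\<dots> = of_real (exp (- pi * y * (of_int a)\<^sup>2)) *
       of_real (1 / sqrt y * (\<Sum>\<^sub>\<infinity>k::int. exp (- (pi / y) * (- x * of_int a + of_int k)\<^sup>2)))"
      by (simp only: poisson_summation_gaussian[OF y])
    \<comment> \<open>Reversing the sign of \<open>k\<close> turns the shift by
      \<open>- x * a\<close> into one by \<open>x * a\<close>.\<close>
    also have "(\<Sum>\<^sub>\<infinity>k::int. exp (- (pi / y) * (- x * of_int a + of_int k)\<^sup>2)) =
      (\<Sum>\<^sub>\<infinity>k::int. exp (- (pi / y) * (- x * of_int a + of_int (- k))\<^sup>2))"
      by (rule infsum_reindex_bij_betw[OF bij_uminus, symmetric])
    also have "\<dots> = (\<Sum>\<^sub>\<infinity>k::int. exp (- (pi / y) * (x * of_int a + of_int k)\<^sup>2))"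
      by (intro infsum_cong) (simp add: power2_eq_square algebra_simps)
    finally show ?thesis by (simp add: F infsum_cmult_right')
  qed
  have sf: "(\<lambda>(a, b). f a b) summable_on UNIV \<times> UNIV"
    using abs_summable_summable[OF theta_pair_summable[OF \<beta>, of \<theta>]] unfolding f_def by simp
  have sF: "(\<lambda>(a, k). F a k) summable_on UNIV \<times> UNIV"
    unfolding F_def using lattice_theta_summable[of "tau \<beta> \<theta>"] y by (simp add: tau)
  have "theta_pair \<beta> \<theta> = (\<Sum>\<^sub>\<infinity>(a, b)\<in>UNIV \<times> UNIV. f a b)"
    unfolding theta_pair_def f_def by simp
  also have "\<dots> = (\<Sum>\<^sub>\<infinity>a. \<Sum>\<^sub>\<infinity>b. f a b)"
    using infsum_Sigma'_banach[OF sf] by simp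
  also have "\<dots> = of_real (1 / sqrt y * (\<Sum>\<^sub>\<infinity>a. \<Sum>\<^sub>\<infinity>k. F a k))"
    by (simp only: inner infsum_of_real infsum_cmult_right')
  also have "(\<Sum>\<^sub>\<infinity>a. \<Sum>\<^sub>\<infinity>k. F a k) = (\<Sum>\<^sub>\<infinity>(a, k)\<in>UNIV \<times> UNIV. F a k)"
    using infsum_Sigma'_banach[OF sF] by simp
  also have "\<dots> = lattice_theta (tau \<beta> \<theta>)"
    unfolding lattice_theta_def F_def by simp
  finally show ?thesis by (simp only: y_def)
qed

lemma Im_moebius:
  fixes a b c d :: int
  assumes det: "a * d - b * c = 1" and y: "Im \<tau> > 0"
  shows "of_int c * \<tau> + of_int d \<noteq> 0"
    and "Im ((of_int a * \<tau> + of_int b) / (of_int c * \<tau> + of_int d)) = Im \<tau> / (cmod (of_int c * \<tau> + of_int d))\<^sup>2"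
proof -
  show "of_int c * \<tau> + of_int d \<noteq> 0"
  proof
    assume 0: "of_int c * \<tau> + of_int d = 0"
    then have "Im (of_int c * \<tau> + of_int d) = 0" by simp
    then have "c = 0" using y by simp
    with 0 have "d = 0" by simp
    with \<open>c = 0\<close> det show False by simp
  qed
  have "real_of_int (a * d - b * c) = 1" using det by simp
  then have "(real_of_int a * of_int d - of_int b * of_int c) * Im \<tau> = Im \<tau>" by simp
  then have "Im ((of_int a * \<tau> + of_int b) * cnj (of_int c * \<tau> + of_int d)) = Im \<tau>"
    by (simp add: algebra_simps)
  then show "Im ((of_int a * \<tau> + of_int b) / (of_int c * \<tau> + of_int d)) = Im \<tau> / (cmod (of_int c * \<tau> + of_int d))\<^sup>2"
    by (metis Im_complex_div_eq_0 complex_div_cnj Im_divide_of_real of_real_power)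
qed

text \<open>Multiplying \<open>k + \<tau>' * m\<close> by the denominator \<open>w\<close> gives a
  point of the lattice spanned by 1 and \<tau>, whose coordinates are \<phi>; the inverse integer
  matrix inverts \<phi>. The factor \<open>|w|^2\<close> lost in the norm is regained from
  \<open>Im \<tau>'\<close>.\<close>

lemma lattice_theta_modular:
  fixes a b c d :: int
  assumes det: "a * d - b * c = 1" and y: "Im \<tau> > 0"
  shows "lattice_theta ((of_int a * \<tau> + of_int b) / (of_int c * \<tau> + of_int d)) = lattice_theta \<tau>"
proof -
  define w where "w = of_int c * \<tau> + of_int d"
  define \<tau>' where "\<tau>' = (of_int a * \<tau> + of_int b) / w"
  have w: "w \<noteq> 0" and Im: "Im \<tau>' = Im \<tau> / (cmod w)\<^sup>2"
    using Im_moebius[OF det y] by (simp_all add: w_def \<tau>'_def)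
  define \<phi> where "\<phi> = (\<lambda>(m, k). (k * c + m * a, k * d + m * b))"
  have bij: "bij \<phi>"
  proof (rule o_bij[where g="\<lambda>(p, q). (d * p - c * q, a * q - b * p)"])
    have *: "a * d = 1 + b * c" using det by simp
    have "d * (k * c + m * a) - c * (k * d + m * b) = m * (a * d - b * c)"
      "a * (k * d + m * b) - b * (k * c + m * a) = k * (a * d - b * c)" for k m
      by (simp_all add: algebra_simps)
    then show "(\<lambda>(p, q). (d * p - c * q, a * q - b * p)) \<circ> \<phi> = id"
      by (simp add: \<phi>_def fun_eq_iff det)
    have "(a * q - b * p) * c + (d * p - c * q) * a = p * (a * d - b * c)"
      "(a * q - b * p) * d + (d * p - c * q) * b = q * (a * d - b * c)" for p q
      by (simp_all add: algebra_simps)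
    then show "\<phi> \<circ> (\<lambda>(p, q). (d * p - c * q, a * q - b * p)) = id"
      by (simp add: \<phi>_def fun_eq_iff det)
  qed
  define F where "F = (\<lambda>(a, k). exp (- pi * (cmod (of_int k + \<tau> * of_int a))\<^sup>2 / Im \<tau>))"
  have "exp (- pi * (cmod (of_int k + \<tau>' * of_int m))\<^sup>2 / Im \<tau>') = F (\<phi> (m, k))" for m k
  proof -
    have "of_int k + \<tau>' * of_int m = (of_int (k * d + m * b) + \<tau> * of_int (k * c + m * a)) / w"
      unfolding \<tau>'_def using w by (simp add: field_simps) (simp add: w_def algebra_simps)
    then have "(cmod (of_int k + \<tau>' * of_int m))\<^sup>2 / Im \<tau>' =
       (cmod (of_int (k * d + m * b) + \<tau> * of_int (k * c + m * a)))\<^sup>2 / Im \<tau>"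
      unfolding Im using w y by (simp add: norm_divide power_divide)
    then show ?thesis unfolding F_def \<phi>_def
      by (simp only: prod.case times_divide_eq_right[symmetric])
  qed
  then have "lattice_theta \<tau>' = (\<Sum>\<^sub>\<infinity>p. F (\<phi> p))"
    unfolding lattice_theta_def by (intro infsum_cong) (auto simp: split_def)
  also have "\<dots> = (\<Sum>\<^sub>\<infinity>p. F p)" by (rule infsum_reindex_bij_betw[OF bij])
  finally show ?thesis unfolding lattice_theta_def F_def \<tau>'_def w_def .
qed

section \<open>Lattice forms and their fluxes\<close>

lemma indices_1: "indices 1 = {[\<mu>] | \<mu>. \<mu> \<in> {1..4}}"
  unfolding indices_def by (auto simp: length_Suc_conv)

lemma indices_2: "indices 2 = {[\<mu>, \<nu>] | \<mu> \<nu>. \<mu> \<in> {1..4} \<and> \<nu> \<in> {1..4}}"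
  unfolding indices_def by (auto simp: length_Suc_conv numeral_2_eq_2)

lemma dirs_cases: "\<mu> \<in> {1..4::nat} \<longleftrightarrow> \<mu> = 1 \<or> \<mu> = 2 \<or> \<mu> = 3 \<or> \<mu> = 4"
  by auto

lemma increasing_indices_2_iff: "increasing_indices 2 = {[\<mu>, \<nu>] | \<mu> \<nu>. \<mu> \<in> {1..4} \<and> \<nu> \<in> {1..4} \<and> \<mu> < \<nu>}"
  unfolding increasing_indices_def indices_2 by auto

lemma increasing_indices_3_iff: "increasing_indices 3 = {[\<mu>, \<nu>, \<rho>] | \<mu> \<nu> \<rho>. \<mu> \<in> {1..4} \<and> \<nu> \<in> {1..4} \<and> \<rho> \<in> {1..4} \<and> \<mu> < \<nu> \<and> \<nu> < \<rho>}"
  unfolding increasing_indices_def indices_def by (auto simp: length_Suc_conv numeral_3_eq_3)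

lemma increasing_indices_2: "increasing_indices 2 = {[1,2],[1,3],[1,4],[2,3],[2,4],[3,4]}"
proof
  show "increasing_indices 2 \<subseteq> {[1,2],[1,3],[1,4],[2,3],[2,4],[3,4]}"
  proof
    fix "is" assume "is \<in> increasing_indices 2"
    then obtain \<mu> \<nu> where is_eq: "is = [\<mu>, \<nu>]" and *: "\<mu> \<in> {1..4}" "\<nu> \<in> {1..4}" "\<mu> < \<nu>"
      unfolding increasing_indices_2_iff by blast
    show "is \<in> {[1,2],[1,3],[1,4],[2,3],[2,4],[3,4]}"
      using * unfolding is_eq dirs_cases by (elim disjE) simp_all
  qed
qed (simp add: increasing_indices_def indices_def)

lemma increasing_indices_subset: "increasing_indices r \<subseteq> indices r"
  unfolding increasing_indices_def by auto

lemma finite_indices: "finite (indices r)"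
  unfolding indices_def using finite_lists_length_eq[of "{1..4::nat}" r] by (simp add: conj_commute)

lemma ext_deriv_1:
  "ext_deriv N \<alpha> (x, [\<mu>, \<nu>]) = cobdry N (\<lambda>x \<mu>. \<alpha> (x, [\<mu>])) x \<mu> \<nu>"
  unfolding ext_deriv_def cobdry_def by (simp add: omit_nth_def numeral_2_eq_2 lessThan_Suc)

lemma ext_deriv_2:
  "ext_deriv N \<alpha> (x, [\<mu>, \<nu>, \<rho>]) = \<alpha> (shift N x \<mu>, [\<nu>, \<rho>]) - \<alpha> (x, [\<nu>, \<rho>])
     - (\<alpha> (shift N x \<nu>, [\<mu>, \<rho>]) - \<alpha> (x, [\<mu>, \<rho>])) + (\<alpha> (shift N x \<rho>, [\<mu>, \<nu>]) - \<alpha> (x, [\<mu>, \<nu>]))"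
  unfolding ext_deriv_def by (simp add: omit_nth_def numeral_3_eq_3 numeral_2_eq_2 lessThan_Suc)

text \<open>The constraint in the partition function tests increasing triples only. The differential
  is alternating in its three indices, so these triples determine all others.\<close>

lemma closed2I:
  fixes F :: "site \<Rightarrow> nat \<Rightarrow> nat \<Rightarrow> 'a::comm_ring_1"
  assumes diag: "\<And>x \<mu>. x \<in> lattice N \<Longrightarrow> \<mu> \<in> {1..4} \<Longrightarrow> F x \<mu> \<mu> = 0"
    and anti: "\<And>x \<mu> \<nu>. x \<in> lattice N \<Longrightarrow> \<mu> \<in> {1..4} \<Longrightarrow> \<nu> \<in> {1..4} \<Longrightarrow> F x \<mu> \<nu> = - F x \<nu> \<mu>"
    and closed: "\<And>x \<mu> \<nu> \<rho>. x \<in> lattice N \<Longrightarrow> \<mu> \<in> {1..4} \<Longrightarrow> \<nu> \<in> {1..4} \<Longrightarrow> \<rho> \<in> {1..4} \<Longrightarrow> \<mu> < \<nu> \<Longrightarrow> \<nu> < \<rho> \<Longrightarrow>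
       F (shift N x \<mu>) \<nu> \<rho> - F x \<nu> \<rho> - (F (shift N x \<nu>) \<mu> \<rho> - F x \<mu> \<rho>) + (F (shift N x \<rho>) \<mu> \<nu> - F x \<mu> \<nu>) = 0"
  shows "closed2 N F"
  unfolding closed2_def
proof (intro ballI conjI)
  fix x and \<mu> \<nu> \<rho> :: nat assume x: "x \<in> lattice N" and \<mu>: "\<mu> \<in> {1..4}" and \<nu>: "\<nu> \<in> {1..4}" and \<rho>: "\<rho> \<in> {1..4}"
  define d where "d \<mu> \<nu> \<rho> = F (shift N x \<mu>) \<nu> \<rho> - F x \<nu> \<rho> - (F (shift N x \<nu>) \<mu> \<rho> - F x \<mu> \<rho>) + (F (shift N x \<rho>) \<mu> \<nu> - F x \<mu> \<nu>)" for \<mu> \<nu> \<rho>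
  have sl: "shift N x \<mu> \<in> lattice N" if "\<mu> \<in> {1..4}" for \<mu> using shift_lattice[OF x that] .
  have sw1: "d \<nu> \<mu> \<rho> = - d \<mu> \<nu> \<rho>" if "\<mu> \<in> {1..4}" "\<nu> \<in> {1..4}" "\<rho> \<in> {1..4}" for \<mu> \<nu> \<rho>
    using anti[OF x that(1,2)] anti[OF sl[OF that(3)] that(1,2)] by (simp add: d_def)
  have sw2: "d \<mu> \<rho> \<nu> = - d \<mu> \<nu> \<rho>" if "\<mu> \<in> {1..4}" "\<nu> \<in> {1..4}" "\<rho> \<in> {1..4}" for \<mu> \<nu> \<rho>
    using anti[OF x that(2,3)] anti[OF sl[OF that(1)] that(2,3)] by (simp add: d_def)
  have eq1: "d \<mu> \<mu> \<rho> = 0" if "\<mu> \<in> {1..4}" "\<rho> \<in> {1..4}" for \<mu> \<rho>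
    using diag[OF x that(1)] diag[OF sl[OF that(2)] that(1)] by (simp add: d_def)
  have inc: "d \<mu> \<nu> \<rho> = 0" if "\<mu> \<in> {1..4}" "\<nu> \<in> {1..4}" "\<rho> \<in> {1..4}" "\<mu> < \<nu>" "\<nu> < \<rho>" for \<mu> \<nu> \<rho>
    using closed[OF x that] by (simp add: d_def)
  have s1: "d \<mu> \<nu> \<rho> = 0" if "d \<nu> \<mu> \<rho> = 0" "\<mu> \<in> {1..4}" "\<nu> \<in> {1..4}" "\<rho> \<in> {1..4}" for \<mu> \<nu> \<rho>
    using sw1[OF that(2-4)] that(1) by simp
  have s2: "d \<mu> \<nu> \<rho> = 0" if "d \<mu> \<rho> \<nu> = 0" "\<mu> \<in> {1..4}" "\<nu> \<in> {1..4}" "\<rho> \<in> {1..4}" for \<mu> \<nu> \<rho>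
    using sw2[OF that(2-4)] that(1) by simp
  have le: "d \<mu> \<nu> \<rho> = 0" if "\<mu> \<in> {1..4}" "\<nu> \<in> {1..4}" "\<rho> \<in> {1..4}" "\<mu> \<le> \<nu>" "\<nu> \<le> \<rho>" for \<mu> \<nu> \<rho>
  proof -
    have "\<mu> \<le> \<nu>" "\<nu> \<le> \<rho>" using that by auto
    then consider "\<mu> = \<nu>" | "\<nu> = \<rho>" | "\<mu> < \<nu>" "\<nu> < \<rho>"
      using le_neq_implies_less by blast
    then show ?thesis
    proof cases
      case 2
      then show ?thesis using s1 s2 eq1 that by metis
    qed (use inc eq1 that in auto)
  qed
  \<comment> \<open>One case for each ordering of the three indices; each is sorted by at most three
    adjacent swaps \<open>s1\<close> and \<open>s2\<close>.\<close>
  consider "\<mu> \<le> \<nu>" "\<nu> \<le> \<rho>" | "\<mu> \<le> \<rho>" "\<rho> \<le> \<nu>" | "\<nu> \<le> \<mu>" "\<mu> \<le> \<rho>" | "\<nu> \<le> \<rho>" "\<rho> \<le> \<mu>" | "\<rho> \<le> \<mu>" "\<mu> \<le> \<nu>" | "\<rho> \<le> \<nu>" "\<nu> \<le> \<mu>"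
    using nat_le_linear[of \<mu> \<nu>] nat_le_linear[of \<nu> \<rho>] nat_le_linear[of \<mu> \<rho>] by blast
  then have "d \<mu> \<nu> \<rho> = 0"
  proof cases
    case 1 then show ?thesis using le \<mu> \<nu> \<rho> by blast
  next
    case 2 then show ?thesis using s2[OF le] \<mu> \<nu> \<rho> by blast
  next
    case 3 then show ?thesis using s1[OF le] \<mu> \<nu> \<rho> by blast
  next
    case 4 then show ?thesis using s1[OF s2[OF le]] \<mu> \<nu> \<rho> by blast
  next
    case 5 then show ?thesis using s2[OF s1[OF le]] \<mu> \<nu> \<rho> by blast
  next
    case 6 then show ?thesis using s1[OF s2[OF s1[OF le]]] \<mu> \<nu> \<rho> by blast
  qed
  then show "F (shift N x \<mu>) \<nu> \<rho> - F x \<nu> \<rho> - (F (shift N x \<nu>) \<mu> \<rho> - F x \<mu> \<rho>) + (F (shift N x \<rho>) \<mu> \<nu> - F x \<mu> \<nu>) = 0"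
    unfolding d_def .
qed (simp add: diag, rule anti)

lemma closed2_add:
  assumes "closed2 N F" "closed2 N G"
  shows "closed2 N (\<lambda>x \<mu> \<nu>. F x \<mu> \<nu> + G x \<mu> \<nu>)"
proof -
  have "closed2 N (\<lambda>x \<mu> \<nu>. 0 - G x \<mu> \<nu>)"
    by (rule closed2_diff[OF _ assms(2)]) (simp add: closed2_def)
  from closed2_diff[OF assms(1) this] show ?thesis by simp
qed

lemma closed2_flux_form:
  assumes "\<And>\<mu>. m \<mu> \<mu> = 0" "\<And>\<mu> \<nu>. m \<mu> \<nu> = - m \<nu> \<mu>"
  shows "closed2 N (flux_form N m)"
proof (rule closed2I)
  show "flux_form N m x \<mu> \<nu> = - flux_form N m x \<nu> \<mu>" for x \<mu> \<nu>
    using assms(2)[of \<mu> \<nu>] by (auto simp: flux_form_def)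
qed (simp_all add: assms(1) flux_form_def shift_other)

lemma closed2_const:
  assumes "\<And>\<mu>. m \<mu> \<mu> = 0" "\<And>\<mu> \<nu>. m \<mu> \<nu> = - m \<nu> \<mu>"
  shows "closed2 N (\<lambda>x. m)"
  by (rule closed2I) (rule assms | simp)+

text \<open>The pairs belong to the complementary planes 12 and 34, 13 and 24, 14 and 23. Grouping
  them so makes the flux sum a product of three series.\<close>

type_synonym fluxes = "(int \<times> int) \<times> (int \<times> int) \<times> (int \<times> int)"

text \<open>The sign of the entry \<open>(2, 4)\<close> makes the topological charge a sum of three products.\<close>

definition upper_flux_matrix :: "fluxes \<Rightarrow> nat \<Rightarrow> nat \<Rightarrow> int" where
  "upper_flux_matrix q \<mu> \<nu> = (case q of ((a, a'), (b, b'), (c, c')) \<Rightarrow>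
     if (\<mu>, \<nu>) = (1, 2) then a else if (\<mu>, \<nu>) = (3, 4) then a' else
     if (\<mu>, \<nu>) = (1, 3) then b else if (\<mu>, \<nu>) = (2, 4) then - b' else
     if (\<mu>, \<nu>) = (1, 4) then c else if (\<mu>, \<nu>) = (2, 3) then c' else 0)"

definition flux_matrix :: "fluxes \<Rightarrow> nat \<Rightarrow> nat \<Rightarrow> int" where
  "flux_matrix q \<mu> \<nu> = upper_flux_matrix q \<mu> \<nu> - upper_flux_matrix q \<nu> \<mu>"

text \<open>Links are coded as in \<open>gauge_measure\<close>, so that its product can be split
  along this set.\<close>

definition free_links :: "nat \<Rightarrow> (site \<times> nat list) set" where
  "free_links N = {(x, [\<mu>]) | x \<mu>. x \<in> lattice N \<and> \<mu> \<in> {1..4} \<and> \<not> gauge_fixed N x \<mu>}"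

definition extend_links :: "nat \<Rightarrow> (site \<times> nat list \<Rightarrow> 'a::comm_ring_1) \<Rightarrow> site \<Rightarrow> nat \<Rightarrow> 'a" where
  "extend_links N l x \<mu> = (if (x, [\<mu>]) \<in> free_links N then l (x, [\<mu>]) else 0)"

text \<open>The parametrization of the closed integer 2-forms by fluxes and free link variables. It
  is restricted to the index set because members of \<open>forms\<close> are extensional.\<close>

definition closed_form :: "nat \<Rightarrow> fluxes \<times> (site \<times> nat list \<Rightarrow> int) \<Rightarrow> int form" where
  "closed_form N = (\<lambda>(q, l). \<lambda>(x, is)\<in>lattice N \<times> indices 2.
     flux_form N (flux_matrix q) x (is ! 0) (is ! 1) + cobdry N (extend_links N l) x (is ! 0) (is ! 1))"

lemma flux_matrix_anti: "flux_matrix q \<mu> \<nu> = - flux_matrix q \<nu> \<mu>"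
  unfolding flux_matrix_def by simp

lemma flux_matrix_diag [simp]: "flux_matrix q \<mu> \<mu> = 0"
  unfolding flux_matrix_def by simp

lemma flux_matrix_simps:
  "flux_matrix ((a, a'), (b, b'), (c, c')) 1 2 = a" "flux_matrix ((a, a'), (b, b'), (c, c')) 3 4 = a'"
  "flux_matrix ((a, a'), (b, b'), (c, c')) 1 3 = b" "flux_matrix ((a, a'), (b, b'), (c, c')) 2 4 = - b'"
  "flux_matrix ((a, a'), (b, b'), (c, c')) 1 4 = c" "flux_matrix ((a, a'), (b, b'), (c, c')) 2 3 = c'"
  unfolding flux_matrix_def upper_flux_matrix_def by simp_all

lemma free_links_subset: "free_links N \<subseteq> lattice N \<times> indices 1"
  unfolding free_links_def indices_1 by auto

lemma finite_free_links: "finite (free_links N)"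
  using finite_subset[OF free_links_subset] finite_lattice finite_indices by blast

lemma extend_links_fixed: "gauge_fixed N x \<mu> \<Longrightarrow> extend_links N l x \<mu> = 0"
  unfolding extend_links_def free_links_def by auto

lemma extend_links_restrict:
  assumes "\<And>x \<mu>. x \<in> lattice N \<Longrightarrow> \<mu> \<in> {1..4} \<Longrightarrow> gauge_fixed N x \<mu> \<Longrightarrow> l x \<mu> = 0" "x \<in> lattice N" "\<mu> \<in> {1..4}"
  shows "extend_links N (\<lambda>p\<in>free_links N. l (fst p) (hd (snd p))) x \<mu> = l x \<mu>"
  unfolding extend_links_def using assms by (auto simp: free_links_def)

lemma cobdry_cong:
  assumes "\<And>x \<mu>. x \<in> lattice N \<Longrightarrow> \<mu> \<in> {1..4} \<Longrightarrow> l x \<mu> = l' x \<mu>" "x \<in> lattice N" "\<mu> \<in> {1..4}" "\<nu> \<in> {1..4}"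
  shows "cobdry N l x \<mu> \<nu> = cobdry N l' x \<mu> \<nu>"
  unfolding cobdry_def using assms by (simp add: shift_lattice)

lemma closed_form_apply:
  assumes "x \<in> lattice N" "\<mu> \<in> {1..4}" "\<nu> \<in> {1..4}"
  shows "closed_form N (q, l) (x, [\<mu>, \<nu>]) = flux_form N (flux_matrix q) x \<mu> \<nu> + cobdry N (extend_links N l) x \<mu> \<nu>"
  using assms unfolding closed_form_def indices_2 by auto

definition closed_forms :: "nat \<Rightarrow> int form set" where
  "closed_forms N = {n \<in> forms N 2. \<forall>x\<in>lattice N. \<forall>is\<in>increasing_indices 3. ext_deriv N n (x, is) = 0}"

lemma forms_2_anti:
  assumes "n \<in> forms N 2" "x \<in> lattice N" "\<mu> \<in> {1..4}" "\<nu> \<in> {1..4}"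
  shows "n (x, [\<mu>, \<nu>]) = - n (x, [\<nu>, \<mu>])"
proof -
  have "[\<nu>, \<mu>] \<in> indices 2" using assms(3,4) unfolding indices_2 by blast
  then have "\<forall>i j. i < j \<and> j < 2 \<longrightarrow> n (x, [\<nu>, \<mu>][i := [\<nu>, \<mu>] ! j, j := [\<nu>, \<mu>] ! i]) = - n (x, [\<nu>, \<mu>])"
    using assms(1,2) unfolding forms_def by blast
  from this[rule_format, of 0 1] show ?thesis by simp
qed

lemma forms_2_eqI:
  fixes n n' :: "int form"
  assumes n: "n \<in> forms N 2" and n': "n' \<in> forms N 2"
    and eq: "\<And>x \<mu> \<nu>. x \<in> lattice N \<Longrightarrow> \<mu> \<in> {1..4} \<Longrightarrow> \<nu> \<in> {1..4} \<Longrightarrow> \<mu> < \<nu> \<Longrightarrow> n (x, [\<mu>, \<nu>]) = n' (x, [\<mu>, \<nu>])"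
  shows "n = n'"
proof (rule extensionalityI[of _ "lattice N \<times> indices 2"])
  fix p assume "p \<in> lattice N \<times> indices 2"
  then obtain x \<mu> \<nu> where p: "p = (x, [\<mu>, \<nu>])" and x: "x \<in> lattice N" and \<mu>: "\<mu> \<in> {1..4}" and \<nu>: "\<nu> \<in> {1..4}"
    unfolding indices_2 by auto
  note anti = forms_2_anti[OF n x \<mu> \<nu>] forms_2_anti[OF n' x \<mu> \<nu>]
  consider "\<mu> < \<nu>" | "\<nu> < \<mu>" | "\<mu> = \<nu>" using nat_neq_iff by blast
  then show "n p = n' p" unfolding p
    by cases (use eq[OF x \<mu> \<nu>] eq[OF x \<nu> \<mu>] anti in auto)
qed (use n n' in \<open>auto simp: forms_def\<close>)

lemma closed_forms_closed2:
  assumes "n \<in> closed_forms N"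
  shows "closed2 N (\<lambda>x \<mu> \<nu>. n (x, [\<mu>, \<nu>]))"
proof (rule closed2I)
  have n: "n \<in> forms N 2" using assms unfolding closed_forms_def by blast
  show anti: "n (x, [\<mu>, \<nu>]) = - n (x, [\<nu>, \<mu>])" if "x \<in> lattice N" "\<mu> \<in> {1..4}" "\<nu> \<in> {1..4}" for x \<mu> \<nu>
    by (rule forms_2_anti[OF n that])
  show "n (x, [\<mu>, \<mu>]) = 0" if "x \<in> lattice N" "\<mu> \<in> {1..4}" for x \<mu>
    using anti[OF that that(2)] by simp
  fix x \<mu> \<nu> \<rho> assume "x \<in> lattice N" "\<mu> \<in> {1..4}" "\<nu> \<in> {1..4}" "\<rho> \<in> {1..4::nat}" "\<mu> < \<nu>" "\<nu> < \<rho>"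
  then have "ext_deriv N n (x, [\<mu>, \<nu>, \<rho>]) = 0"
    using assms unfolding closed_forms_def increasing_indices_3_iff by blast
  then show "n (shift N x \<mu>, [\<nu>, \<rho>]) - n (x, [\<nu>, \<rho>]) - (n (shift N x \<nu>, [\<mu>, \<rho>]) - n (x, [\<mu>, \<rho>]))
     + (n (shift N x \<rho>, [\<mu>, \<nu>]) - n (x, [\<mu>, \<nu>])) = 0" unfolding ext_deriv_2 .
qed

lemma closed_form_in: "closed_form N p \<in> closed_forms N"
proof (cases p)
  case (Pair q l)
  have cl: "closed2 N (\<lambda>x \<mu> \<nu>. closed_form N (q, l) (x, [\<mu>, \<nu>]))"
    by (subst closed2_cong[where G="\<lambda>x \<mu> \<nu>. flux_form N (flux_matrix q) x \<mu> \<nu> + cobdry N (extend_links N l) x \<mu> \<nu>"])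
      (simp_all add: closed_form_apply, intro closed2_add closed2_cobdry closed2_flux_form flux_matrix_anti flux_matrix_diag)
  have "closed_form N (q, l) \<in> forms N 2"
    unfolding forms_def
  proof (intro CollectI conjI ballI allI impI)
    show "closed_form N (q, l) \<in> extensional (lattice N \<times> indices 2)"
      unfolding closed_form_def by simp
    fix x "is" i j assume x: "x \<in> lattice N" and "is \<in> indices 2" and ij: "i < j \<and> j < (2::nat)"
    then obtain \<mu> \<nu> where is_eq: "is = [\<mu>, \<nu>]" "\<mu> \<in> {1..4}" "\<nu> \<in> {1..4}" unfolding indices_2 by auto
    have "i = 0" "j = 1" using ij by auto
    moreover have "closed_form N (q, l) (x, [\<nu>, \<mu>]) = - closed_form N (q, l) (x, [\<mu>, \<nu>])"
      using cl x is_eq unfolding closed2_def by blast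
    ultimately show "closed_form N (q, l) (x, is[i := is ! j, j := is ! i]) = - closed_form N (q, l) (x, is)"
      using is_eq by simp
  qed
  moreover have "ext_deriv N (closed_form N (q, l)) (x, is) = 0" if x: "x \<in> lattice N" and i: "is \<in> increasing_indices 3" for x "is"
  proof -
    obtain \<mu> \<nu> \<rho> where is_eq: "is = [\<mu>, \<nu>, \<rho>]" and "\<mu> \<in> {1..4}" "\<nu> \<in> {1..4}" "\<rho> \<in> {1..4}"
      using i unfolding increasing_indices_3_iff by blast
    then show ?thesis using cl x unfolding is_eq ext_deriv_2 closed2_def by blast
  qed
  ultimately show ?thesis unfolding Pair closed_forms_def by blast
qed

lemma origin_lattice: "N \<ge> 1 \<Longrightarrow> (\<lambda>i\<in>{1..4}. 0) \<in> lattice N"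
  unfolding lattice_def by auto

lemma flux_matrix_inj:
  assumes "\<And>\<mu> \<nu>. \<mu> \<in> {1..4} \<Longrightarrow> \<nu> \<in> {1..4} \<Longrightarrow> \<mu> \<noteq> \<nu> \<Longrightarrow> flux_matrix q \<mu> \<nu> = flux_matrix q' \<mu> \<nu>"
  shows "q = q'"
proof -
  obtain a a' b b' c c' where q: "q = ((a, a'), (b, b'), (c, c'))" by (metis surj_pair)
  obtain d d' e e' f f' where q': "q' = ((d, d'), (e, e'), (f, f'))" by (metis surj_pair)
  show ?thesis
    using assms[of 1 2] assms[of 3 4] assms[of 1 3] assms[of 2 4] assms[of 1 4] assms[of 2 3]
    unfolding q q' flux_matrix_simps by simp
qed

text \<open>Stokes recovers the fluxes; the difference of the two link fields then has zero
  coboundary and vanishes on the gauge-fixed links, so \<open>cobdry_inj\<close> makes it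
  zero.\<close>

lemma closed_form_inj:
  assumes N: "N \<ge> 1"
  shows "inj_on (closed_form N) (UNIV \<times> (free_links N \<rightarrow>\<^sub>E UNIV))"
proof (rule inj_onI, clarify)
  fix q q' l l' assume l: "l \<in> free_links N \<rightarrow>\<^sub>E UNIV" and l': "l' \<in> free_links N \<rightarrow>\<^sub>E UNIV"
    and eq: "closed_form N (q, l) = closed_form N (q', l')"
  define F where "F x \<mu> \<nu> = closed_form N (q, l) (x, [\<mu>, \<nu>])" for x \<mu> \<nu>
  have F: "F x \<mu> \<nu> = flux_form N (flux_matrix q) x \<mu> \<nu> + cobdry N (extend_links N l) x \<mu> \<nu>"
    "F x \<mu> \<nu> = flux_form N (flux_matrix q') x \<mu> \<nu> + cobdry N (extend_links N l') x \<mu> \<nu>"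
    if "x \<in> lattice N" "\<mu> \<in> {1..4}" "\<nu> \<in> {1..4}" for x \<mu> \<nu>
    using that closed_form_apply unfolding F_def by (metis eq)+
  have "flux_matrix q \<mu> \<nu> = flux_matrix q' \<mu> \<nu>" if "\<mu> \<in> {1..4}" "\<nu> \<in> {1..4}" "\<mu> \<noteq> \<nu>" for \<mu> \<nu>
    using flux_eq[of N F, OF F(1) that origin_lattice[OF N]] flux_eq[of N F, OF F(2) that origin_lattice[OF N]] that by simp
  then have q: "q = q'" by (rule flux_matrix_inj)
  have "extend_links N l x \<mu> - extend_links N l' x \<mu> = 0" if "x \<in> lattice N" "\<mu> \<in> {1..4}" for x \<mu>
  proof (rule cobdry_inj[OF _ _ that])
    fix x and \<nu> \<rho> :: nat assume "x \<in> lattice N" "\<nu> \<in> {1..4}" "\<rho> \<in> {1..4}"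
    then show "cobdry N (\<lambda>x \<mu>. extend_links N l x \<mu> - extend_links N l' x \<mu>) x \<nu> \<rho> = 0"
      using F[of x \<nu> \<rho>] q unfolding cobdry_def by simp
  qed (simp add: extend_links_fixed)
  then have *: "extend_links N l x \<mu> = extend_links N l' x \<mu>" if "x \<in> lattice N" "\<mu> \<in> {1..4}" for x \<mu>
    using that by simp
  have "l = l'"
  proof (rule PiE_ext[OF l l'])
    fix p assume p: "p \<in> free_links N"
    then obtain x \<mu> where "p = (x, [\<mu>])" "x \<in> lattice N" "\<mu> \<in> {1..4}" unfolding free_links_def by auto
    then show "l p = l' p" using *[of x \<mu>] p by (simp add: extend_links_def)
  qed
  then show "q = q' \<and> l = l'" using q by simp
qed

lemma closed_form_surj:
  assumes N: "N \<ge> 1" and n: "n \<in> closed_forms N"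
  shows "n \<in> closed_form N ` (UNIV \<times> (free_links N \<rightarrow>\<^sub>E UNIV))"
proof -
  obtain l m where l: "\<And>x \<nu>. x \<in> lattice N \<Longrightarrow> \<nu> \<in> {1..4} \<Longrightarrow> gauge_fixed N x \<nu> \<Longrightarrow> l x \<nu> = 0"
    and m: "\<And>x \<nu> \<rho>. x \<in> lattice N \<Longrightarrow> \<nu> \<in> {1..4} \<Longrightarrow> \<rho> \<in> {1..4} \<Longrightarrow>
       n (x, [\<nu>, \<rho>]) = flux_form N m x \<nu> \<rho> + cobdry N l x \<nu> \<rho>"
    using closed2_decomposition[OF closed_forms_closed2[OF n] N] by metis
  \<comment> \<open>The sign at (2, 4) undoes the one in \<open>upper_flux_matrix\<close>.\<close>
  define q where "q = ((m 1 2, m 3 4), (m 1 3, - m 2 4), (m 1 4, m 2 3))"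
  define l' where "l' = (\<lambda>p\<in>free_links N. l (fst p) (hd (snd p)))"
  have nf: "n \<in> forms N 2" and cf: "closed_form N (q, l') \<in> forms N 2"
    using n closed_form_in[of N "(q, l')"] unfolding closed_forms_def by blast+
  have el: "extend_links N l' x \<mu> = l x \<mu>" if "x \<in> lattice N" "\<mu> \<in> {1..4}" for x \<mu>
    unfolding l'_def using extend_links_restrict[of N l, OF l that] by blast
  have lt: "n (x, [\<mu>, \<nu>]) = closed_form N (q, l') (x, [\<mu>, \<nu>])"
    if x: "x \<in> lattice N" and \<mu>: "\<mu> \<in> {1..4}" and \<nu>: "\<nu> \<in> {1..4}" and "\<mu> < \<nu>" for x \<mu> \<nu>
  proof -
    have "flux_matrix q \<mu> \<nu> = m \<mu> \<nu>"
      using \<mu> \<nu> \<open>\<mu> < \<nu>\<close> unfolding dirs_cases q_def by (auto simp: flux_matrix_simps[simplified] )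
    then show ?thesis
      unfolding closed_form_apply[OF x \<mu> \<nu>] m[OF x \<mu> \<nu>] using cobdry_cong[of N "extend_links N l'" l, OF el x \<mu> \<nu>]
      by (simp add: flux_form_def)
  qed
  have "n = closed_form N (q, l')"
    by (rule forms_2_eqI[OF nf cf lt])
  moreover have "l' \<in> free_links N \<rightarrow>\<^sub>E UNIV" unfolding l'_def by simp
  ultimately show ?thesis by blast
qed

lemma bij_betw_closed_form:
  assumes N: "N \<ge> 1"
  shows "bij_betw (closed_form N) (UNIV \<times> (free_links N \<rightarrow>\<^sub>E UNIV)) (closed_forms N)"
  unfolding bij_betw_def using closed_form_inj[OF N] closed_form_surj[OF N] closed_form_in by blast

text \<open>A lattice version of Hodge decomposition: over the reals the concentrated flux may be
  spread evenly over the \<open>N^2\<close> plaquettes of each 2-torus at the price of a coboundary.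
  That coboundary and the one of \<open>A\<close> are absorbed together into the field
  \<open>c\<close> on the free links.\<close>

lemma real_decomposition:
  fixes A :: "site \<Rightarrow> nat \<Rightarrow> real"
  assumes N: "N \<ge> 1"
  obtains c where "c \<in> free_links N \<rightarrow>\<^sub>E UNIV"
    "\<And>x \<mu> \<nu>. x \<in> lattice N \<Longrightarrow> \<mu> \<in> {1..4} \<Longrightarrow> \<nu> \<in> {1..4} \<Longrightarrow>
       cobdry N A x \<mu> \<nu> + 2 * pi * flux_form N (\<lambda>\<mu> \<nu>. of_int (flux_matrix q \<mu> \<nu>)) x \<mu> \<nu> =
       cobdry N (extend_links N c) x \<mu> \<nu> + 2 * pi / real N ^ 2 * of_int (flux_matrix q \<mu> \<nu>)"
proof -
  define m where "m \<mu> \<nu> = 2 * pi * real_of_int (flux_matrix q \<mu> \<nu>)" for \<mu> \<nu>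
  define G where "G x \<mu> \<nu> = flux_form N m x \<mu> \<nu> + cobdry N A x \<mu> \<nu>" for x \<mu> \<nu>
  \<comment> \<open>All fluxes of this form vanish, so the \<open>flux_form\<close> part of its
    decomposition is zero.\<close>
  define F where "F x \<mu> \<nu> = G x \<mu> \<nu> - m \<mu> \<nu> / real N ^ 2" for x \<mu> \<nu>
  have anti: "m \<mu> \<nu> = - m \<nu> \<mu>" "m \<mu> \<mu> = 0" for \<mu> \<nu>
    unfolding m_def using flux_matrix_anti[of q \<mu> \<nu>] by simp_all
  have "closed2 N G" unfolding G_def
    by (intro closed2_add closed2_cobdry closed2_flux_form anti)
  moreover have "closed2 N (\<lambda>x \<mu> \<nu>. m \<mu> \<nu> / real N ^ 2)"
  proof (rule closed2_const)
    show "m \<mu> \<nu> / real N ^ 2 = - (m \<nu> \<mu> / real N ^ 2)" for \<mu> \<nu>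
      using anti(1)[of \<mu> \<nu>] by simp
  qed (simp add: anti(2))
  ultimately have cl: "closed2 N F" unfolding F_def by (rule closed2_diff)
  obtain l m' where l: "\<And>x \<nu>. x \<in> lattice N \<Longrightarrow> \<nu> \<in> {1..4} \<Longrightarrow> gauge_fixed N x \<nu> \<Longrightarrow> l x \<nu> = 0"
    and m': "\<And>x \<nu> \<rho>. x \<in> lattice N \<Longrightarrow> \<nu> \<in> {1..4} \<Longrightarrow> \<rho> \<in> {1..4} \<Longrightarrow>
       F x \<nu> \<rho> = flux_form N m' x \<nu> \<rho> + cobdry N l x \<nu> \<rho>"
    using closed2_decomposition[OF cl N] by metis
  define c where "c = (\<lambda>p\<in>free_links N. l (fst p) (hd (snd p)))"
  have el: "extend_links N c x \<mu> = l x \<mu>" if "x \<in> lattice N" "\<mu> \<in> {1..4}" for x \<mu>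
    unfolding c_def using extend_links_restrict[of N l, OF l that] by blast
  have "F x \<mu> \<nu> = cobdry N l x \<mu> \<nu>" if x: "x \<in> lattice N" and \<mu>: "\<mu> \<in> {1..4}" and \<nu>: "\<nu> \<in> {1..4}" for x \<mu> \<nu>
  proof (cases "\<mu> = \<nu>")
    case True
    then show ?thesis by (simp add: anti(2) F_def G_def flux_form_def cobdry_def)
  next
    case False
    have "m' \<mu> \<nu> = (\<Sum>s<N. \<Sum>t<N. F (x(\<mu> := s, \<nu> := t)) \<mu> \<nu>)"
      by (rule flux_eq[symmetric, OF m']) (use False \<mu> \<nu> x in auto)
    also have "\<dots> = (\<Sum>s<N. \<Sum>t<N. G (x(\<mu> := s, \<nu> := t)) \<mu> \<nu>) - real N * (real N * (m \<mu> \<nu> / real N ^ 2))"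
      unfolding F_def by (simp add: sum_subtractf)
    also have "(\<Sum>s<N. \<Sum>t<N. G (x(\<mu> := s, \<nu> := t)) \<mu> \<nu>) = m \<mu> \<nu>"
      by (rule flux_eq) (use False \<mu> \<nu> x in \<open>auto simp: G_def\<close>)
    also have "m \<mu> \<nu> - real N * (real N * (m \<mu> \<nu> / real N ^ 2)) = 0"
      using N by (simp add: power2_eq_square)
    finally show ?thesis using m'[OF x \<mu> \<nu>] by (simp add: flux_form_def)
  qed
  then have "G x \<mu> \<nu> = cobdry N (extend_links N c) x \<mu> \<nu> + m \<mu> \<nu> / real N ^ 2"
    if "x \<in> lattice N" "\<mu> \<in> {1..4}" "\<nu> \<in> {1..4}" for x \<mu> \<nu>
    using cobdry_cong[of N "extend_links N c" l, OF el that] that unfolding F_def by (metis diff_add_cancel)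
  moreover have "flux_form N m x \<mu> \<nu> = 2 * pi * flux_form N (\<lambda>\<mu> \<nu>. of_int (flux_matrix q \<mu> \<nu>)) x \<mu> \<nu>" for x \<mu> \<nu>
    by (simp add: flux_form_def m_def)
  ultimately show ?thesis using that[of c] by (simp add: G_def m_def c_def add.commute)
qed

section \<open>Topological charge and action of a closed form\<close>

lemma levi_civita_not_distinct:
  assumes "length is = 4" "\<not> distinct is"
  shows "levi_civita is = 0"
proof -
  let ?p = "\<lambda>i. if i \<in> {1..4} then is ! (i - 1) else i"
  have "\<not> ?p permutes {1..4}"
  proof
    assume "?p permutes {1..4}"
    then have inj: "inj ?p" by (rule permutes_inj)
    obtain i j where ij: "i < 4" "j < 4" "i \<noteq> j" "is ! i = is ! j"
      using assms unfolding distinct_conv_nth by auto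
    have "?p (Suc i) = ?p (Suc j)" using ij by auto
    then show False using injD[OF inj] ij(3) by blast
  qed
  then show ?thesis unfolding levi_civita_def Let_def by (rule if_not_P)
qed

lemma levi_civita_eqI:
  assumes p: "p permutes {1..4}" and "p 1 = is ! 0" "p 2 = is ! 1" "p 3 = is ! 2" "p 4 = is ! 3" "sign p = s"
  shows "levi_civita is = s"
proof -
  have "(\<lambda>i. if i \<in> {1..4} then is ! (i - 1) else i) = p"
  proof
    fix i :: nat
    show "(if i \<in> {1..4} then is ! (i - 1) else i) = p i"
    proof (cases "i \<in> {1..4}")
      case True
      then have "i = 1 \<or> i = 2 \<or> i = 3 \<or> i = 4" unfolding dirs_cases .
      then show ?thesis using assms by (elim disjE) simp_all
    next
      case False
      then show ?thesis using permutes_not_in[OF p False] by (simp only: if_False)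
    qed
  qed
  then show ?thesis unfolding levi_civita_def Let_def using assms by simp
qed

lemma levi_civita_values:
  "levi_civita [1, 2, 3, 4] = 1" "levi_civita [1, 3, 2, 4] = - 1" "levi_civita [1, 4, 2, 3] = 1"
  "levi_civita [2, 3, 1, 4] = 1" "levi_civita [2, 4, 1, 3] = - 1" "levi_civita [3, 4, 1, 2] = 1"
proof -
  note rules = permutes_compose permutes_swap_id
  note simps = sign_compose permutation_swap_id permutation_compose sign_swap_id
  show "levi_civita [1, 2, 3, 4] = 1"
    by (rule levi_civita_eqI[where p=id]) (simp_all add: permutes_id)
  show "levi_civita [1, 3, 2, 4] = - 1"
    by (rule levi_civita_eqI[where p="Transposition.transpose 2 3"], intro rules) (simp_all add: simps Transposition.transpose_def)
  show "levi_civita [1, 4, 2, 3] = 1"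
    by (rule levi_civita_eqI[where p="Transposition.transpose 2 3 \<circ> Transposition.transpose 2 4"], intro rules) (simp_all add: simps Transposition.transpose_def)
  show "levi_civita [2, 3, 1, 4] = 1"
    by (rule levi_civita_eqI[where p="Transposition.transpose 1 3 \<circ> Transposition.transpose 1 2"], intro rules) (simp_all add: simps Transposition.transpose_def)
  show "levi_civita [2, 4, 1, 3] = - 1"
    by (rule levi_civita_eqI[where p="Transposition.transpose 1 3 \<circ> (Transposition.transpose 1 4 \<circ> Transposition.transpose 1 2)"], intro rules) (simp_all add: simps Transposition.transpose_def)
  show "levi_civita [3, 4, 1, 2] = 1"
    by (rule levi_civita_eqI[where p="Transposition.transpose 1 3 \<circ> Transposition.transpose 2 4"], intro rules) (simp_all add: simps Transposition.transpose_def)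
qed

text \<open>The integral over the torus of the lattice cup product.\<close>

definition cup :: "nat \<Rightarrow> (site \<Rightarrow> nat \<Rightarrow> nat \<Rightarrow> real) \<Rightarrow> (site \<Rightarrow> nat \<Rightarrow> nat \<Rightarrow> real) \<Rightarrow> real" where
  "cup N F G = (\<Sum>x\<in>lattice N.
     F x 1 2 * G (shift N (shift N x 1) 2) 3 4 - F x 1 3 * G (shift N (shift N x 1) 3) 2 4 +
     F x 1 4 * G (shift N (shift N x 1) 4) 2 3 + F x 2 3 * G (shift N (shift N x 2) 3) 1 4 -
     F x 2 4 * G (shift N (shift N x 2) 4) 1 3 + F x 3 4 * G (shift N (shift N x 3) 4) 1 2)"

lemma sum_increasing_indices_2:
  fixes f :: "nat list \<Rightarrow> real"
  shows "(\<Sum>is\<in>increasing_indices 2. f is) = f [1,2] + f [1,3] + f [1,4] + f [2,3] + f [2,4] + f [3,4]"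
  unfolding increasing_indices_2 by (simp add: add_ac)

lemma top_charge_cup:
  "top_charge N F = cup N (\<lambda>x \<mu> \<nu>. F (x, [\<mu>, \<nu>])) (\<lambda>x \<mu> \<nu>. F (x, [\<mu>, \<nu>])) / (8 * pi\<^sup>2)"
proof -
  have "(\<Sum>\<mu>\<nu>\<in>increasing_indices 2. \<Sum>\<rho>\<sigma>\<in>increasing_indices 2.
        of_int (levi_civita (\<mu>\<nu> @ \<rho>\<sigma>)) * F (x, \<mu>\<nu>) * F (shift N (shift N x (\<mu>\<nu> ! 0)) (\<mu>\<nu> ! 1), \<rho>\<sigma>)) =
     F (x, [1, 2]) * F (shift N (shift N x 1) 2, [3, 4]) - F (x, [1, 3]) * F (shift N (shift N x 1) 3, [2, 4]) +
     F (x, [1, 4]) * F (shift N (shift N x 1) 4, [2, 3]) + F (x, [2, 3]) * F (shift N (shift N x 2) 3, [1, 4]) -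
     F (x, [2, 4]) * F (shift N (shift N x 2) 4, [1, 3]) + F (x, [3, 4]) * F (shift N (shift N x 3) 4, [1, 2])" for x
    unfolding sum_increasing_indices_2
    by (simp add: levi_civita_not_distinct levi_civita_values levi_civita_values[simplified])
  then show ?thesis unfolding top_charge_def cup_def by simp
qed

text \<open>Summation by parts. Because \<open>g\<close> is taken at the far corner of the
  plaquette, only forward differences of \<open>g\<close> remain; this is what the shift in the
  topological charge is for.\<close>

lemma sum_cobdry_mult:
  fixes g :: "site \<Rightarrow> 'a::comm_ring_1"
  assumes "\<mu> \<in> {1..4}" "\<nu> \<in> {1..4}"
  shows "(\<Sum>x\<in>lattice N. cobdry N c x \<mu> \<nu> * g (shift N (shift N x \<mu>) \<nu>)) =
    (\<Sum>x\<in>lattice N. c x \<mu> * (g (shift N (shift N x \<mu>) \<nu>) - g (shift N x \<mu>)) -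
       c x \<nu> * (g (shift N (shift N x \<nu>) \<mu>) - g (shift N x \<nu>)))"
proof -
  have 1: "(\<Sum>x\<in>lattice N. c (shift N x \<mu>) \<nu> * g (shift N (shift N x \<mu>) \<nu>)) = (\<Sum>x\<in>lattice N. c x \<nu> * g (shift N x \<nu>))"
    by (rule sum_shift[OF assms(1), of "\<lambda>x. c x \<nu> * g (shift N x \<nu>)"])
  have 2: "(\<Sum>x\<in>lattice N. c (shift N x \<nu>) \<mu> * g (shift N (shift N x \<nu>) \<mu>)) = (\<Sum>x\<in>lattice N. c x \<mu> * g (shift N x \<mu>))"
    by (rule sum_shift[OF assms(2), of "\<lambda>x. c x \<mu> * g (shift N x \<mu>)"])
  show ?thesis
    unfolding cobdry_def left_diff_distrib right_diff_distrib sum_subtractf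
    using 1 2 by (simp add: shift_commute[of N _ \<mu> \<nu>])
qed

lemma sum_cobdry:
  assumes "\<mu> \<in> {1..4}" "\<nu> \<in> {1..4}"
  shows "(\<Sum>x\<in>lattice N. cobdry N c x \<mu> \<nu>) = 0"
  using sum_cobdry_mult[OF assms, of N c "\<lambda>_. 1"] by simp

text \<open>The Leibniz rule of the cup product: after summation by parts, \<open>c x \<mu>\<close>
  is multiplied, up to sign, by the differential of \<open>G\<close> in the other three directions
  at the site shifted by \<mu>.\<close>

lemma cup_cobdry_closed:
  assumes "closed2 N G"
  shows "cup N (cobdry N c) G = 0"
proof -
  have d: "G (shift N x \<mu>) \<nu> \<rho> - G x \<nu> \<rho> - (G (shift N x \<nu>) \<mu> \<rho> - G x \<mu> \<rho>) + (G (shift N x \<rho>) \<mu> \<nu> - G x \<mu> \<nu>) = 0"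
    if "x \<in> lattice N" "\<mu> \<in> {1..4}" "\<nu> \<in> {1..4}" "\<rho> \<in> {1..4}" for x \<mu> \<nu> \<rho>
    using assms that unfolding closed2_def by blast
  define b where "b x \<mu> \<nu> \<rho> \<sigma> = c x \<mu> * (G (shift N (shift N x \<mu>) \<nu>) \<rho> \<sigma> - G (shift N x \<mu>) \<rho> \<sigma>) -
       c x \<nu> * (G (shift N (shift N x \<nu>) \<mu>) \<rho> \<sigma> - G (shift N x \<nu>) \<rho> \<sigma>)" for x \<mu> \<nu> \<rho> \<sigma>
  have b: "(\<Sum>x\<in>lattice N. cobdry N c x \<mu> \<nu> * G (shift N (shift N x \<mu>) \<nu>) \<rho> \<sigma>) = (\<Sum>x\<in>lattice N. b x \<mu> \<nu> \<rho> \<sigma>)"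
    if "\<mu> \<in> {1..4}" "\<nu> \<in> {1..4}" for \<mu> \<nu> \<rho> \<sigma>
    unfolding b_def by (rule sum_cobdry_mult[OF that, of N c "\<lambda>x. G x \<rho> \<sigma>"])
  have "cup N (cobdry N c) G = (\<Sum>x\<in>lattice N. b x 1 2 3 4 - b x 1 3 2 4 + b x 1 4 2 3 + b x 2 3 1 4 - b x 2 4 1 3 + b x 3 4 1 2)"
    unfolding cup_def sum.distrib sum_subtractf by (simp add: b)
  also have "\<dots> = 0"
  proof (rule sum.neutral, rule ballI)
    fix x assume x: "x \<in> lattice N"
    have 1: "G (shift N (shift N x 1) 2) 3 4 - G (shift N x 1) 3 4 - (G (shift N (shift N x 1) 3) 2 4 - G (shift N x 1) 2 4) + (G (shift N (shift N x 1) 4) 2 3 - G (shift N x 1) 2 3) = 0"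
      and 2: "G (shift N (shift N x 2) 1) 3 4 - G (shift N x 2) 3 4 - (G (shift N (shift N x 2) 3) 1 4 - G (shift N x 2) 1 4) + (G (shift N (shift N x 2) 4) 1 3 - G (shift N x 2) 1 3) = 0"
      and 3: "G (shift N (shift N x 3) 1) 2 4 - G (shift N x 3) 2 4 - (G (shift N (shift N x 3) 2) 1 4 - G (shift N x 3) 1 4) + (G (shift N (shift N x 3) 4) 1 2 - G (shift N x 3) 1 2) = 0"
      and 4: "G (shift N (shift N x 4) 1) 2 3 - G (shift N x 4) 2 3 - (G (shift N (shift N x 4) 2) 1 3 - G (shift N x 4) 1 3) + (G (shift N (shift N x 4) 3) 1 2 - G (shift N x 4) 1 2) = 0"
      by (rule d[OF shift_lattice[OF x]]; simp)+
    have "b x 1 2 3 4 - b x 1 3 2 4 + b x 1 4 2 3 + b x 2 3 1 4 - b x 2 4 1 3 + b x 3 4 1 2 =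
      c x 1 * (G (shift N (shift N x 1) 2) 3 4 - G (shift N x 1) 3 4 - (G (shift N (shift N x 1) 3) 2 4 - G (shift N x 1) 2 4) + (G (shift N (shift N x 1) 4) 2 3 - G (shift N x 1) 2 3)) -
      c x 2 * (G (shift N (shift N x 2) 1) 3 4 - G (shift N x 2) 3 4 - (G (shift N (shift N x 2) 3) 1 4 - G (shift N x 2) 1 4) + (G (shift N (shift N x 2) 4) 1 3 - G (shift N x 2) 1 3)) +
      c x 3 * (G (shift N (shift N x 3) 1) 2 4 - G (shift N x 3) 2 4 - (G (shift N (shift N x 3) 2) 1 4 - G (shift N x 3) 1 4) + (G (shift N (shift N x 3) 4) 1 2 - G (shift N x 3) 1 2)) -
      c x 4 * (G (shift N (shift N x 4) 1) 2 3 - G (shift N x 4) 2 3 - (G (shift N (shift N x 4) 2) 1 3 - G (shift N x 4) 1 3) + (G (shift N (shift N x 4) 3) 1 2 - G (shift N x 4) 1 2))"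
      unfolding b_def by (simp only: algebra_simps)
    then show "b x 1 2 3 4 - b x 1 3 2 4 + b x 1 4 2 3 + b x 2 3 1 4 - b x 2 4 1 3 + b x 3 4 1 2 = 0"
      unfolding 1 2 3 4 by simp
  qed
  finally show ?thesis .
qed

lemma card_lattice: "card (lattice N) = N ^ 4"
  unfolding lattice_def by (simp add: card_PiE)

lemma cup_const_cobdry: "cup N (\<lambda>x. K) (cobdry N c) = 0"
proof -
  have "(\<Sum>x\<in>lattice N. k * cobdry N c (shift N (shift N x \<mu>) \<nu>) \<rho> \<sigma>) = 0"
    if "\<mu> \<in> {1..4}" "\<nu> \<in> {1..4}" "\<rho> \<in> {1..4}" "\<sigma> \<in> {1..4}" for k \<mu> \<nu> \<rho> \<sigma>
  proof -
    have "(\<Sum>x\<in>lattice N. cobdry N c (shift N (shift N x \<mu>) \<nu>) \<rho> \<sigma>) = 0"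
      using sum_shift[OF that(1), where f="\<lambda>x. cobdry N c (shift N x \<nu>) \<rho> \<sigma>"]
        sum_shift[OF that(2), where f="\<lambda>x. cobdry N c x \<rho> \<sigma>"] sum_cobdry[OF that(3,4), of N c] by simp
    then show ?thesis by (simp add: sum_distrib_left[symmetric])
  qed
  then show ?thesis unfolding cup_def sum.distrib sum_subtractf by simp
qed

lemma cup_const_const: "cup N (\<lambda>x. K) (\<lambda>x. K) = 2 * real N ^ 4 * (K 1 2 * K 3 4 - K 1 3 * K 2 4 + K 1 4 * K 2 3)"
  unfolding cup_def by (simp add: card_lattice algebra_simps)

lemma cup_add_left: "cup N (\<lambda>x \<mu> \<nu>. F x \<mu> \<nu> + F' x \<mu> \<nu>) G = cup N F G + cup N F' G"
  unfolding cup_def sum.distrib[symmetric] by (simp add: algebra_simps)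

lemma cup_add_right: "cup N F (\<lambda>x \<mu> \<nu>. G x \<mu> \<nu> + G' x \<mu> \<nu>) = cup N F G + cup N F G'"
  unfolding cup_def sum.distrib[symmetric] by (simp add: algebra_simps)

lemma cup_cong:
  assumes "\<And>x \<mu> \<nu>. x \<in> lattice N \<Longrightarrow> \<mu> \<in> {1..4} \<Longrightarrow> \<nu> \<in> {1..4} \<Longrightarrow> F x \<mu> \<nu> = F' x \<mu> \<nu>"
    and "\<And>x \<mu> \<nu>. x \<in> lattice N \<Longrightarrow> \<mu> \<in> {1..4} \<Longrightarrow> \<nu> \<in> {1..4} \<Longrightarrow> G x \<mu> \<nu> = G' x \<mu> \<nu>"
  shows "cup N F G = cup N F' G'"
  unfolding cup_def by (intro sum.cong refl) (simp add: assms shift_lattice)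

lemma cup_cobdry_const:
  assumes "\<And>\<mu>. K \<mu> \<mu> = 0" "\<And>\<mu> \<nu>. K \<mu> \<nu> = - K \<nu> \<mu>"
  shows "cup N (\<lambda>x \<mu> \<nu>. cobdry N c x \<mu> \<nu> + K \<mu> \<nu>) (\<lambda>x \<mu> \<nu>. cobdry N c x \<mu> \<nu> + K \<mu> \<nu>) =
    2 * real N ^ 4 * (K 1 2 * K 3 4 - K 1 3 * K 2 4 + K 1 4 * K 2 3)"
  unfolding cup_add_left cup_add_right
  by (simp add: cup_cobdry_closed closed2_cobdry closed2_const[OF assms] cup_const_cobdry cup_const_const)

section \<open>Action and charge in terms of the fluxes\<close>

definition energy :: "nat \<Rightarrow> (site \<Rightarrow> nat \<Rightarrow> nat \<Rightarrow> real) \<Rightarrow> real" where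
  "energy N F = (\<Sum>x\<in>lattice N. \<Sum>is\<in>increasing_indices 2. (F x (is ! 0) (is ! 1))\<^sup>2)"

lemma energy_cong:
  assumes "\<And>x \<mu> \<nu>. x \<in> lattice N \<Longrightarrow> \<mu> \<in> {1..4} \<Longrightarrow> \<nu> \<in> {1..4} \<Longrightarrow> F x \<mu> \<nu> = F' x \<mu> \<nu>"
  shows "energy N F = energy N F'"
  unfolding energy_def sum_increasing_indices_2 by (intro sum.cong refl) (simp add: assms)

text \<open>Constant and exact forms are orthogonal: the cross term is a constant times the sum of a
  coboundary over the torus.\<close>

lemma energy_cobdry_const:
  "energy N (\<lambda>x \<mu> \<nu>. cobdry N c x \<mu> \<nu> + K \<mu> \<nu>) = energy N (cobdry N c) +
     real N ^ 4 * (\<Sum>is\<in>increasing_indices 2. (K (is ! 0) (is ! 1))\<^sup>2)"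
proof -
  have *: "(\<Sum>x\<in>lattice N. (cobdry N c x \<mu> \<nu> + K \<mu> \<nu>)\<^sup>2) = (\<Sum>x\<in>lattice N. (cobdry N c x \<mu> \<nu>)\<^sup>2) + real N ^ 4 * (K \<mu> \<nu>)\<^sup>2"
    if "\<mu> \<in> {1..4}" "\<nu> \<in> {1..4}" for \<mu> \<nu>
  proof -
    have "(\<Sum>x\<in>lattice N. (cobdry N c x \<mu> \<nu> + K \<mu> \<nu>)\<^sup>2) =
      (\<Sum>x\<in>lattice N. (cobdry N c x \<mu> \<nu>)\<^sup>2) + (\<Sum>x\<in>lattice N. 2 * K \<mu> \<nu> * cobdry N c x \<mu> \<nu>) + (\<Sum>x\<in>lattice N. (K \<mu> \<nu>)\<^sup>2)"
      unfolding sum.distrib[symmetric] by (intro sum.cong refl) (simp add: power2_sum)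
    also have "(\<Sum>x\<in>lattice N. 2 * K \<mu> \<nu> * cobdry N c x \<mu> \<nu>) = 0"
      by (simp add: sum_distrib_left[symmetric] sum_cobdry[OF that])
    finally show ?thesis by (simp add: card_lattice)
  qed
  show ?thesis
    unfolding energy_def sum_increasing_indices_2 sum.distrib by (simp add: *) (simp add: algebra_simps)
qed

definition flux_charge :: "fluxes \<Rightarrow> int" where
  "flux_charge q = (case q of ((a, a'), (b, b'), (c, c')) \<Rightarrow> a * a' + b * b' + c * c')"

definition flux_norm :: "fluxes \<Rightarrow> int" where
  "flux_norm q = (case q of ((a, a'), (b, b'), (c, c')) \<Rightarrow> a\<^sup>2 + a'\<^sup>2 + (b\<^sup>2 + b'\<^sup>2) + (c\<^sup>2 + c'\<^sup>2))"

lemma flux_charge_matrix: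
  "flux_charge q = flux_matrix q 1 2 * flux_matrix q 3 4 - flux_matrix q 1 3 * flux_matrix q 2 4 + flux_matrix q 1 4 * flux_matrix q 2 3"
proof -
  obtain a a' b b' c c' where q: "q = ((a, a'), (b, b'), (c, c'))" by (metis surj_pair)
  show ?thesis unfolding q flux_matrix_simps by (simp add: flux_charge_def)
qed

lemma field_strength_eq:
  assumes "x \<in> lattice N" "\<mu> \<in> {1..4}" "\<nu> \<in> {1..4}"
  shows "field_strength N A (closed_form N (q, l)) (x, [\<mu>, \<nu>]) =
    cobdry N (\<lambda>x \<mu>. A (x, [\<mu>]) + 2 * pi * extend_links N (\<lambda>p. real_of_int (l p)) x \<mu>) x \<mu> \<nu> +
    2 * pi * flux_form N (\<lambda>\<mu> \<nu>. of_int (flux_matrix q \<mu> \<nu>)) x \<mu> \<nu>"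
proof -
  have "real_of_int (extend_links N l x \<mu>) = extend_links N (\<lambda>p. real_of_int (l p)) x \<mu>" for x \<mu>
    by (simp add: extend_links_def)
  then show ?thesis
    unfolding field_strength_def ext_deriv_1 closed_form_apply[OF assms]
    by (simp add: cobdry_def flux_form_def algebra_simps)
qed

text \<open>The order of quantifiers is the point: \<open>c\<close> depends on the flux and on the
  values \<open>t\<close> of the gauge-fixed links, not on the free links or on \<open>l\<close>. It
  can therefore be removed later by a translation of the integration variables.\<close>

lemma field_strength_decomposition:
  fixes t :: "real form"
  assumes N: "N \<ge> 1"
  shows "\<exists>c\<in>free_links N \<rightarrow>\<^sub>E UNIV. \<forall>A l. (\<forall>p\<in>lattice N \<times> indices 1 - free_links N. A p = t p) \<longrightarrow>
     (\<forall>x\<in>lattice N. \<forall>\<mu>\<in>{1..4}. \<forall>\<nu>\<in>{1..4}.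
       field_strength N A (closed_form N (q, l)) (x, [\<mu>, \<nu>]) =
       cobdry N (extend_links N (\<lambda>p. A p + 2 * pi * real_of_int (l p) + c p)) x \<mu> \<nu> +
       2 * pi / real N ^ 2 * of_int (flux_matrix q \<mu> \<nu>))"
proof -
  \<comment> \<open>The free links stay as variables, so only the gauge-fixed part of the field goes
    into \<open>c\<close>.\<close>
  define t' where "t' x \<mu> = (if (x, [\<mu>]) \<in> free_links N then 0 else t (x, [\<mu>]))" for x \<mu>
  obtain c where c: "c \<in> free_links N \<rightarrow>\<^sub>E UNIV"
    "\<And>x \<mu> \<nu>. x \<in> lattice N \<Longrightarrow> \<mu> \<in> {1..4} \<Longrightarrow> \<nu> \<in> {1..4} \<Longrightarrow>
       cobdry N t' x \<mu> \<nu> + 2 * pi * flux_form N (\<lambda>\<mu> \<nu>. of_int (flux_matrix q \<mu> \<nu>)) x \<mu> \<nu> =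
       cobdry N (extend_links N c) x \<mu> \<nu> + 2 * pi / real N ^ 2 * of_int (flux_matrix q \<mu> \<nu>)"
    using real_decomposition[OF N, of t' q] by metis
  show ?thesis
  proof (rule bexI[OF _ c(1)], intro allI impI ballI)
    fix A :: "real form" and l :: "site \<times> nat list \<Rightarrow> int" and x and \<mu> \<nu> :: nat
    assume "\<forall>p\<in>lattice N \<times> indices 1 - free_links N. A p = t p"
      and x: "x \<in> lattice N" "\<mu> \<in> {1..4}" "\<nu> \<in> {1..4}"
    then have A: "\<And>p. p \<in> lattice N \<times> indices 1 - free_links N \<Longrightarrow> A p = t p" by blast
    have "cobdry N (\<lambda>x \<mu>. A (x, [\<mu>]) + 2 * pi * extend_links N (\<lambda>p. real_of_int (l p)) x \<mu>) x \<mu> \<nu> =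
      cobdry N (\<lambda>x \<mu>. t' x \<mu> + extend_links N (\<lambda>p. A p + 2 * pi * real_of_int (l p)) x \<mu>) x \<mu> \<nu>"
      by (rule cobdry_cong[OF _ x]) (auto simp: t'_def extend_links_def indices_1[simplified] intro!: A)
    also have "\<dots> = cobdry N t' x \<mu> \<nu> + cobdry N (extend_links N (\<lambda>p. A p + 2 * pi * real_of_int (l p))) x \<mu> \<nu>"
      by (rule cobdry_add)
    moreover have "extend_links N (\<lambda>p. A p + 2 * pi * real_of_int (l p) + c p) =
       (\<lambda>x \<mu>. extend_links N (\<lambda>p. A p + 2 * pi * real_of_int (l p)) x \<mu> + extend_links N c x \<mu>)"
      by (simp add: extend_links_def fun_eq_iff)
    ultimately show "field_strength N A (closed_form N (q, l)) (x, [\<mu>, \<nu>]) =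
       cobdry N (extend_links N (\<lambda>p. A p + 2 * pi * real_of_int (l p) + c p)) x \<mu> \<nu> +
       2 * pi / real N ^ 2 * of_int (flux_matrix q \<mu> \<nu>)"
      unfolding field_strength_eq[OF x] using c(2)[OF x] by (simp add: cobdry_add)
  qed
qed

text \<open>Only the constant part of the field strength contributes. Its factor
  \<open>2 * pi / N^2\<close> squared, times the \<open>2 * N^4\<close> of
  \<open>cup_cobdry_const\<close>, cancels the normalization \<open>8 * pi^2\<close>, so the charge
  is an integer.\<close>

lemma top_charge_closed_form:
  assumes N: "N \<ge> 1"
  shows "top_charge N (field_strength N A (closed_form N (q, l))) = of_int (flux_charge q)"
proof -
  obtain c0 where c0: "\<And>A' l x \<mu> \<nu>. \<forall>p\<in>lattice N \<times> indices 1 - free_links N. A' p = A p \<Longrightarrow>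
       x \<in> lattice N \<Longrightarrow> \<mu> \<in> {1..4} \<Longrightarrow> \<nu> \<in> {1..4} \<Longrightarrow>
       field_strength N A' (closed_form N (q, l)) (x, [\<mu>, \<nu>]) =
       cobdry N (extend_links N (\<lambda>p. A' p + 2 * pi * real_of_int (l p) + c0 p)) x \<mu> \<nu> +
       2 * pi / real N ^ 2 * of_int (flux_matrix q \<mu> \<nu>)"
    using field_strength_decomposition[OF N, of A q] by blast
  define c where "c = (\<lambda>p. A p + 2 * pi * real_of_int (l p) + c0 p)"
  have c: "field_strength N A (closed_form N (q, l)) (x, [\<mu>, \<nu>]) =
       cobdry N (extend_links N c) x \<mu> \<nu> + 2 * pi / real N ^ 2 * of_int (flux_matrix q \<mu> \<nu>)"
    if "x \<in> lattice N" "\<mu> \<in> {1..4}" "\<nu> \<in> {1..4}" for x \<mu> \<nu>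
    unfolding c_def by (rule c0[OF _ that]) simp
  define K where "K \<mu> \<nu> = 2 * pi / real N ^ 2 * of_int (flux_matrix q \<mu> \<nu>)" for \<mu> \<nu>
  have K: "K \<mu> \<nu> = - K \<nu> \<mu>" "K \<mu> \<mu> = 0" for \<mu> \<nu>
    unfolding K_def using flux_matrix_anti[of q \<mu> \<nu>] by simp_all
  have "cup N (\<lambda>x \<mu> \<nu>. field_strength N A (closed_form N (q, l)) (x, [\<mu>, \<nu>])) (\<lambda>x \<mu> \<nu>. field_strength N A (closed_form N (q, l)) (x, [\<mu>, \<nu>])) =
    cup N (\<lambda>x \<mu> \<nu>. cobdry N (extend_links N c) x \<mu> \<nu> + K \<mu> \<nu>) (\<lambda>x \<mu> \<nu>. cobdry N (extend_links N c) x \<mu> \<nu> + K \<mu> \<nu>)"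
    by (rule cup_cong) (simp_all add: c K_def)
  also have "\<dots> = 2 * real N ^ 4 * (K 1 2 * K 3 4 - K 1 3 * K 2 4 + K 1 4 * K 2 3)"
    by (rule cup_cobdry_const) (rule K)+
  also have "\<dots> = 8 * pi\<^sup>2 * of_int (flux_charge q)"
    unfolding flux_charge_matrix K_def using N by (simp add: field_simps power2_eq_square power4_eq_xxxx)
  finally show ?thesis unfolding top_charge_cup by simp
qed

lemma energy_closed_form:
  fixes t :: "real form"
  assumes N: "N \<ge> 1"
  shows "\<exists>c\<in>free_links N \<rightarrow>\<^sub>E UNIV. \<forall>A l. (\<forall>p\<in>lattice N \<times> indices 1 - free_links N. A p = t p) \<longrightarrow>
       (\<Sum>x\<in>lattice N. \<Sum>\<mu>\<nu>\<in>increasing_indices 2. (field_strength N A (closed_form N (q, l)) (x, \<mu>\<nu>))\<^sup>2) =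
       energy N (cobdry N (extend_links N (\<lambda>p. A p + 2 * pi * real_of_int (l p) + c p))) + 4 * pi\<^sup>2 * of_int (flux_norm q)"
proof -
  obtain c where c: "c \<in> free_links N \<rightarrow>\<^sub>E UNIV"
    "\<And>A l x \<mu> \<nu>. \<forall>p\<in>lattice N \<times> indices 1 - free_links N. A p = t p \<Longrightarrow>
       x \<in> lattice N \<Longrightarrow> \<mu> \<in> {1..4} \<Longrightarrow> \<nu> \<in> {1..4} \<Longrightarrow>
       field_strength N A (closed_form N (q, l)) (x, [\<mu>, \<nu>]) =
       cobdry N (extend_links N (\<lambda>p. A p + 2 * pi * real_of_int (l p) + c p)) x \<mu> \<nu> +
       2 * pi / real N ^ 2 * of_int (flux_matrix q \<mu> \<nu>)"
    using field_strength_decomposition[OF N, of t q] by blast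
  define K where "K \<mu> \<nu> = 2 * pi / real N ^ 2 * of_int (flux_matrix q \<mu> \<nu>)" for \<mu> \<nu>
  show ?thesis
  proof (rule bexI[OF _ c(1)], intro allI impI)
    fix A :: "real form" and l :: "site \<times> nat list \<Rightarrow> int"
    assume A: "\<forall>p\<in>lattice N \<times> indices 1 - free_links N. A p = t p"
    have "(\<Sum>x\<in>lattice N. \<Sum>\<mu>\<nu>\<in>increasing_indices 2. (field_strength N A (closed_form N (q, l)) (x, \<mu>\<nu>))\<^sup>2) =
      energy N (\<lambda>x \<mu> \<nu>. field_strength N A (closed_form N (q, l)) (x, [\<mu>, \<nu>]))"
      unfolding energy_def sum_increasing_indices_2 by simp
    also have "\<dots> = energy N (\<lambda>x \<mu> \<nu>. cobdry N (extend_links N (\<lambda>p. A p + 2 * pi * real_of_int (l p) + c p)) x \<mu> \<nu> + K \<mu> \<nu>)"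
      unfolding K_def by (rule energy_cong) (rule c(2)[OF A])
    also have "\<dots> = energy N (cobdry N (extend_links N (\<lambda>p. A p + 2 * pi * real_of_int (l p) + c p))) +
       real N ^ 4 * (\<Sum>is\<in>increasing_indices 2. (K (is ! 0) (is ! 1))\<^sup>2)"
      by (rule energy_cobdry_const)
    also have "real N ^ 4 * (\<Sum>is\<in>increasing_indices 2. (K (is ! 0) (is ! 1))\<^sup>2) = 4 * pi\<^sup>2 * of_int (flux_norm q)"
    proof -
      obtain a a' b b' d d' where q: "q = ((a, a'), (b, b'), (d, d'))" by (metis surj_pair)
      \<comment> \<open>The number of sites cancels the \<open>N^4\<close> in the squared constant
        field, so the flux weight does not depend on the lattice size.\<close>
      have "real N ^ 4 * (2 * pi / real N ^ 2 * r)\<^sup>2 = 4 * pi\<^sup>2 * r\<^sup>2" for r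
        using N by (simp add: power_mult_distrib power_divide field_simps)
      then show ?thesis
        unfolding sum_increasing_indices_2 K_def q
        by (simp add: distrib_left flux_norm_def flux_matrix_simps[simplified] flux_matrix_simps)
    qed
    finally show "(\<Sum>x\<in>lattice N. \<Sum>\<mu>\<nu>\<in>increasing_indices 2. (field_strength N A (closed_form N (q, l)) (x, \<mu>\<nu>))\<^sup>2) =
       energy N (cobdry N (extend_links N (\<lambda>p. A p + 2 * pi * real_of_int (l p) + c p))) + 4 * pi\<^sup>2 * of_int (flux_norm q)" .
  qed
qed

section \<open>Unfolding products of circles\<close>

abbreviation circle_measure :: "real measure" where
  "circle_measure \<equiv> uniform_measure lborel {-pi..<pi}"

text \<open>The normalisation makes the unfolding of the circle measure free of powers of \<open>2 \<pi>\<close>.\<close>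

definition line_measure :: "real measure" where
  "line_measure = density lborel (\<lambda>_. ennreal (1 / (2 * pi)))"

lemma sets_line_measure [simp, measurable_cong]: "sets line_measure = sets borel"
  by (simp add: line_measure_def)

lemma space_line_measure [simp]: "space line_measure = UNIV"
  by (simp add: line_measure_def)

lemma prob_space_circle_measure: "prob_space circle_measure"
  by (rule prob_space_uniform_measure) auto

lemma nn_integral_line_measure:
  "f \<in> borel_measurable borel \<Longrightarrow> (\<integral>\<^sup>+x. f x \<partial>line_measure) = ennreal (1 / (2 * pi)) * (\<integral>\<^sup>+x. f x \<partial>lborel)"
  unfolding line_measure_def by (subst nn_integral_density) (auto simp: nn_integral_cmult)

lemma sigma_finite_line_measure: "sigma_finite_measure line_measure"
  unfolding line_measure_def
  by (rule sigma_finite_measure.sigma_finite_iff_density_finite[THEN iffD2])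
     (auto simp: lborel.sigma_finite_measure_axioms)

lemma nn_integral_line_measure_unfold:
  assumes f[measurable]: "f \<in> borel_measurable borel"
  shows "(\<integral>\<^sup>+x. f x \<partial>line_measure) =
    (\<integral>\<^sup>+k. (\<integral>\<^sup>+x. f (x + 2 * pi * of_int k) \<partial>circle_measure) \<partial>count_space (UNIV :: int set))"
proof -
  have e: "emeasure lborel {-pi..<pi} = ennreal (2 * pi)"
    by (subst emeasure_lborel_Ico) (simp_all add: order_trans[of "- pi" 0 pi])
  have *: "(\<integral>\<^sup>+x. f (x + 2 * pi * of_int k) \<partial>circle_measure) =
     ennreal (1 / (2 * pi)) * (\<integral>\<^sup>+x. f (x + 2 * pi * of_int k) * indicator {-pi..<-pi + 2 * pi} x \<partial>lborel)" for k :: int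
  proof -
    have "(\<integral>\<^sup>+x. f (x + 2 * pi * of_int k) \<partial>circle_measure) =
      (\<integral>\<^sup>+x. f (x + 2 * pi * of_int k) * indicator {-pi..<pi} x \<partial>lborel) / ennreal (2 * pi)"
      unfolding e[symmetric] by (rule nn_integral_uniform_measure) measurable
    also have "\<dots> = ennreal (1 / (2 * pi)) * (\<integral>\<^sup>+x. f (x + 2 * pi * of_int k) * indicator {-pi..<pi} x \<partial>lborel)"
      unfolding divide_ennreal_def by (subst inverse_ennreal) (simp_all add: inverse_eq_divide mult.commute)
    finally show ?thesis by simp
  qed
  have "(\<integral>\<^sup>+x. f x \<partial>line_measure) = ennreal (1 / (2 * pi)) * (\<integral>\<^sup>+k. (\<integral>\<^sup>+x. f (x + 2 * pi * of_int k) * indicator {-pi..<-pi + 2 * pi} x \<partial>lborel) \<partial>count_space (UNIV :: int set))"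
    unfolding nn_integral_line_measure[OF f] by (subst nn_integral_periodization[OF _ f, of "2 * pi" "- pi"]) simp_all
  also have "\<dots> = (\<integral>\<^sup>+k. ennreal (1 / (2 * pi)) * (\<integral>\<^sup>+x. f (x + 2 * pi * of_int k) * indicator {-pi..<-pi + 2 * pi} x \<partial>lborel) \<partial>count_space (UNIV :: int set))"
    by (rule nn_integral_cmult[symmetric]) simp
  finally show ?thesis unfolding * .
qed

lemma indicator_PiE:
  assumes "finite I" "x \<in> extensional I"
  shows "indicator (PiE I A) x = (\<Prod>i\<in>I. indicator (A i) (x i) :: ennreal)"
proof (cases "x \<in> PiE I A")
  case True
  then show ?thesis by (auto intro!: prod.neutral[symmetric] simp: indicator_def PiE_iff)
next
  case False
  then obtain i where "i \<in> I" "x i \<notin> A i" using assms(2) by (auto simp: PiE_iff)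
  then have "(\<Prod>i\<in>I. indicator (A i) (x i) :: ennreal) = 0" using assms(1) by (intro prod_zero) (auto intro!: bexI[of _ i])
  then show ?thesis using False by simp
qed

interpretation line: product_sigma_finite "\<lambda>_. line_measure"
  by (simp add: product_sigma_finite_def sigma_finite_line_measure)

interpretation circle: product_sigma_finite "\<lambda>_. circle_measure"
  by (simp add: product_sigma_finite_def prob_space_imp_sigma_finite[OF prob_space_circle_measure])

interpretation integers: product_sigma_finite "\<lambda>_. count_space (UNIV :: int set)"
  by (simp add: product_sigma_finite_def sigma_finite_measure_count_space)

text \<open>Checked on boxes, which determine a product measure. The translation serves to remove
  the gauge-fixed data, the dilation to extract the power of \<beta>.\<close>

lemma PiM_line_measure_affine:
  assumes I: "finite I" and s: "s > 0"
  defines "L \<equiv> PiM I (\<lambda>_. line_measure)"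
  shows "scale_measure (ennreal ((1 / s) ^ card I)) (distr L L (\<lambda>x. \<lambda>i\<in>I. x i / s + c i)) = L"
  unfolding L_def
proof (rule line.PiM_eqI[OF I], fold L_def)
  fix A :: "_ \<Rightarrow> real set" assume A: "\<And>i. i \<in> I \<Longrightarrow> A i \<in> sets line_measure"
  then have [measurable]: "\<And>i. i \<in> I \<Longrightarrow> A i \<in> sets borel" by simp
  interpret L: finite_product_sigma_finite "\<lambda>_. line_measure" I by standard fact
  let ?D = "distr L L (\<lambda>x. \<lambda>i\<in>I. x i / s + c i)"
  have m: "(\<lambda>x. \<lambda>i\<in>I. x i / s + c i) \<in> measurable L L"
    unfolding L_def by (rule measurable_restrict) measurable
  have "(\<lambda>x. \<lambda>i\<in>I. x i / s + c i) -` PiE I A \<inter> space L = PiE I (\<lambda>i. (\<lambda>y. y / s + c i) -` A i)"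
    by (auto simp: L_def space_PiM PiE_iff)
  then have "emeasure ?D (PiE I A) = emeasure L (PiE I (\<lambda>i. (\<lambda>y. y / s + c i) -` A i))"
    using A I by (subst emeasure_distr[OF m]) (auto simp: L_def intro!: sets_PiM_I_finite)
  also have "\<dots> = (\<Prod>i\<in>I. emeasure line_measure ((\<lambda>y. y / s + c i) -` A i))"
    unfolding L_def by (rule L.measure_times) (auto intro!: measurable_sets_borel[where M=borel])
  also have "\<dots> = (\<Prod>i\<in>I. ennreal s * emeasure line_measure (A i))"
  proof (rule prod.cong[OF refl])
    fix i assume i[simp]: "i \<in> I"
    have [measurable]: "A i \<in> sets borel" "(\<lambda>y. y / s + c i) -` A i \<in> sets borel"
      by (auto intro!: measurable_sets_borel[where M=borel])
    have "emeasure line_measure ((\<lambda>y. y / s + c i) -` A i) = ennreal (1 / (2 * pi)) * (\<integral>\<^sup>+x. indicator ((\<lambda>y. y / s + c i) -` A i) x \<partial>lborel)"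
      by (simp add: nn_integral_line_measure[symmetric] del: nn_integral_indicator) simp
    also have "(\<integral>\<^sup>+x. indicator ((\<lambda>y. y / s + c i) -` A i) x \<partial>lborel) = ennreal s * (\<integral>\<^sup>+x. indicator (A i) x \<partial>lborel)"
      using s by (subst nn_integral_real_affine[where c=s and t="- s * c i"])
        (auto simp: indicator_def diff_divide_distrib simp del: nn_integral_indicator intro!: arg_cong2[where f="(*)"] nn_integral_cong)
    also have "ennreal (1 / (2 * pi)) * (ennreal s * (\<integral>\<^sup>+x. indicator (A i) x \<partial>lborel)) = ennreal s * (ennreal (1 / (2 * pi)) * (\<integral>\<^sup>+x. indicator (A i) x \<partial>lborel))"
      by (simp only: mult.left_commute)
    also have "ennreal (1 / (2 * pi)) * (\<integral>\<^sup>+x. indicator (A i) x \<partial>lborel) = emeasure line_measure (A i)"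
      by (simp add: nn_integral_line_measure[symmetric] del: nn_integral_indicator) simp
    finally show "emeasure line_measure ((\<lambda>y. y / s + c i) -` A i) = ennreal s * emeasure line_measure (A i)" .
  qed
  also have "\<dots> = ennreal (s ^ card I) * (\<Prod>i\<in>I. emeasure line_measure (A i))"
    using s by (simp add: prod.distrib ennreal_power)
  finally show "emeasure (scale_measure (ennreal ((1 / s) ^ card I)) ?D) (PiE I A) = (\<Prod>i\<in>I. emeasure line_measure (A i))"
    using s by (simp add: mult.assoc[symmetric] ennreal_mult'[symmetric] power_mult_distrib[symmetric])
qed (simp add: L_def)

lemma nn_integral_PiM_line_affine:
  assumes I: "finite I" and s: "s > 0" and f: "f \<in> borel_measurable (PiM I (\<lambda>_. line_measure))"
  defines "L \<equiv> PiM I (\<lambda>_. line_measure)"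
  shows "(\<integral>\<^sup>+x. f x \<partial>L) = ennreal ((1 / s) ^ card I) * (\<integral>\<^sup>+x. f (\<lambda>i\<in>I. x i / s + c i) \<partial>L)"
proof -
  let ?D = "distr L L (\<lambda>x. \<lambda>i\<in>I. x i / s + c i)"
  have m: "(\<lambda>x. \<lambda>i\<in>I. x i / s + c i) \<in> measurable L L"
    unfolding L_def by (rule measurable_restrict) measurable
  have "(\<integral>\<^sup>+x. f x \<partial>L) = (\<integral>\<^sup>+x. f x \<partial>scale_measure (ennreal ((1 / s) ^ card I)) ?D)"
    unfolding L_def by (simp only: PiM_line_measure_affine[OF I s])
  also have "\<dots> = ennreal ((1 / s) ^ card I) * (\<integral>\<^sup>+x. f x \<partial>?D)"
    by (rule nn_integral_scale_measure) (simp add: f L_def)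
  also have "(\<integral>\<^sup>+x. f x \<partial>?D) = (\<integral>\<^sup>+x. f (\<lambda>i\<in>I. x i / s + c i) \<partial>L)"
    by (rule nn_integral_distr[OF m]) (simp add: f L_def)
  finally show ?thesis .
qed

lemmas nn_integral_PiM_line_translate = nn_integral_PiM_line_affine[where s=1, simplified]
lemmas nn_integral_PiM_line_scale = nn_integral_PiM_line_affine[where c="\<lambda>_. 0", simplified]

text \<open>The map adding \<open>2 * pi * l\<close> to the angles pushes counting measure times
  circle measure to line measure. On a box everything factors, which reduces the claim to a single
  circle.\<close>

lemma nn_integral_PiM_line_unfold:
  assumes I: "finite I" and f: "f \<in> borel_measurable (PiM I (\<lambda>_. line_measure))"
  shows "(\<integral>\<^sup>+x. f x \<partial>PiM I (\<lambda>_. line_measure)) =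
    (\<integral>\<^sup>+l. (\<integral>\<^sup>+x. f (\<lambda>i\<in>I. x i + 2 * pi * of_int (l i)) \<partial>PiM I (\<lambda>_. circle_measure)) \<partial>PiM I (\<lambda>_. count_space (UNIV :: int set)))"
proof -
  let ?Z = "PiM I (\<lambda>_. count_space (UNIV :: int set))" and ?C = "PiM I (\<lambda>_. circle_measure)" and ?L = "PiM I (\<lambda>_. line_measure)"
  define \<phi> where "\<phi> = (\<lambda>p. \<lambda>i\<in>I. snd p i + 2 * pi * of_int (fst p i :: int))"
  interpret Z: finite_product_sigma_finite "\<lambda>_. count_space (UNIV :: int set)" I by standard fact
  interpret C: finite_product_sigma_finite "\<lambda>_. circle_measure" I by standard fact
  have m[measurable]: "\<phi> \<in> measurable (?Z \<Otimes>\<^sub>M ?C) ?L"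
    unfolding \<phi>_def by (rule measurable_restrict) measurable
  have P: "distr (?Z \<Otimes>\<^sub>M ?C) ?L \<phi> = ?L"
  proof (rule line.PiM_eqI[OF I])
    fix A :: "_ \<Rightarrow> real set" assume A: "\<And>i. i \<in> I \<Longrightarrow> A i \<in> sets line_measure"
    then have Am[measurable]: "\<And>i. i \<in> I \<Longrightarrow> A i \<in> sets borel" by simp
    have S[measurable]: "PiE I A \<in> sets ?L" using A I by (intro sets_PiM_I_finite) auto
    have "emeasure (distr (?Z \<Otimes>\<^sub>M ?C) ?L \<phi>) (PiE I A) = (\<integral>\<^sup>+x. indicator (PiE I A) x \<partial>distr (?Z \<Otimes>\<^sub>M ?C) ?L \<phi>)"
      by simp
    also have "\<dots> = (\<integral>\<^sup>+p. indicator (PiE I A) (\<phi> p) \<partial>(?Z \<Otimes>\<^sub>M ?C))"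
      by (rule nn_integral_distr) auto
    also have "\<dots> = (\<integral>\<^sup>+l. \<integral>\<^sup>+x. indicator (PiE I A) (\<phi> (l, x)) \<partial>?C \<partial>?Z)"
      by (rule C.nn_integral_fst[symmetric]) measurable
    also have "\<dots> = (\<integral>\<^sup>+l. \<integral>\<^sup>+x. (\<Prod>i\<in>I. indicator (A i) (x i + 2 * pi * of_int (l i))) \<partial>?C \<partial>?Z)"
      unfolding \<phi>_def by (intro nn_integral_cong) (subst indicator_PiE[OF I], auto intro!: prod.cong)
    also have "\<dots> = (\<integral>\<^sup>+l. (\<Prod>i\<in>I. \<integral>\<^sup>+y. indicator (A i) (y + 2 * pi * of_int (l i)) \<partial>circle_measure) \<partial>?Z)"
      by (intro nn_integral_cong circle.product_nn_integral_prod I) (auto intro!: borel_measurable_indicator')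
    also have "\<dots> = (\<Prod>i\<in>I. \<integral>\<^sup>+k. \<integral>\<^sup>+y. indicator (A i) (y + 2 * pi * of_int k) \<partial>circle_measure \<partial>count_space UNIV)"
      by (rule integers.product_nn_integral_prod[OF I]) auto
    also have "\<dots> = (\<Prod>i\<in>I. emeasure line_measure (A i))"
      by (intro prod.cong refl) (subst nn_integral_line_measure_unfold[symmetric], auto)
    finally show "emeasure (distr (?Z \<Otimes>\<^sub>M ?C) ?L \<phi>) (PiE I A) = (\<Prod>i\<in>I. emeasure line_measure (A i))" .
  qed simp
  have "(\<integral>\<^sup>+x. f x \<partial>?L) = (\<integral>\<^sup>+x. f x \<partial>distr (?Z \<Otimes>\<^sub>M ?C) ?L \<phi>)" by (simp only: P)
  also have "\<dots> = (\<integral>\<^sup>+p. f (\<phi> p) \<partial>(?Z \<Otimes>\<^sub>M ?C))"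
    by (rule nn_integral_distr[OF m]) (simp add: f)
  also have "\<dots> = (\<integral>\<^sup>+l. \<integral>\<^sup>+x. f (\<phi> (l, x)) \<partial>?C \<partial>?Z)"
    by (rule C.nn_integral_fst[symmetric]) (use f in measurable)
  finally show ?thesis by (simp add: \<phi>_def)
qed

section \<open>Counting links and summing over fluxes\<close>

text \<open>The tree contributes \<open>(N - 1) * N ^ (4 - \<mu>)\<close> links in direction \<mu>,
  and the link closing the circle through the origin is the extra one.\<close>

lemma card_gauge_fixed:
  assumes N: "N \<ge> 1" and \<mu>: "\<mu> \<in> {1..4}"
  shows "card {x \<in> lattice N. gauge_fixed N x \<mu>} = (N - 1) * N ^ (4 - \<mu>) + 1"
proof -
  \<comment> \<open>\<open>B\<close> collects the starting sites of the tree links, and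
    \<open>z\<close> is the starting site of the closing link.\<close>
  define B where "B = (\<Pi>\<^sub>E \<nu>\<in>{1..4}. if \<nu> < \<mu> then {0} else if \<nu> = \<mu> then {0..<N - 1} else {0..<N})"
  define z where "z = (\<lambda>\<nu>\<in>{1..4}. if \<nu> = \<mu> then N - 1 else 0)"
  have eq: "{x \<in> lattice N. gauge_fixed N x \<mu>} = insert z B"
  proof (intro equalityI subsetI)
    fix x assume "x \<in> {x \<in> lattice N. gauge_fixed N x \<mu>}"
    then have x: "x \<in> lattice N" and g: "gauge_fixed N x \<mu>" by auto
    show "x \<in> insert z B"
    proof (cases "x \<mu> < N - 1")
      case True
      have "x \<in> B"
        unfolding B_def
      proof (rule PiE_I)
        fix \<nu> :: nat assume "\<nu> \<in> {1..4}"
        then show "x \<nu> \<in> (if \<nu> < \<mu> then {0} else if \<nu> = \<mu> then {0..<N - 1} else {0..<N})"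
          using g lattice_less[OF x] True unfolding gauge_fixed_def by auto
      next
        fix \<nu> :: nat assume "\<nu> \<notin> {1..4}"
        then show "x \<nu> = undefined" using x unfolding lattice_def by (rule PiE_arb[rotated])
      qed
      then show ?thesis by simp
    next
      case False
      have z: "z \<in> lattice N" using N unfolding lattice_def z_def by auto
      have "x = z"
      proof (rule lattice_eqI[OF x z])
        fix \<nu> :: nat assume \<nu>: "\<nu> \<in> {1..4}"
        consider "\<nu> < \<mu>" | "\<nu> = \<mu>" | "\<mu> < \<nu>" by (rule linorder_cases)
        then show "x \<nu> = z \<nu>"
          by cases (use \<nu> g lattice_less[OF x \<mu>] False in \<open>auto simp: z_def gauge_fixed_def\<close>)
      qed
      then show ?thesis by simp
    qed
  next
    fix x assume "x \<in> insert z B"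
    then consider "x = z" | "x \<in> B" by blast
    then show "x \<in> {x \<in> lattice N. gauge_fixed N x \<mu>}"
    proof cases
      case 1
      then show ?thesis using N unfolding lattice_def z_def gauge_fixed_def by auto
    next
      case 2
      have x\<nu>: "x \<nu> \<in> (if \<nu> < \<mu> then {0} else if \<nu> = \<mu> then {0..<N - 1} else {0..<N})" if "\<nu> \<in> {1..4}" for \<nu>
        using 2 that unfolding B_def by (rule PiE_mem)
      have "x \<in> lattice N"
        unfolding lattice_def
      proof (rule PiE_I)
        fix \<nu> :: nat assume "\<nu> \<in> {1..4}"
        then show "x \<nu> \<in> {0..<N}" using x\<nu>[of \<nu>] N by (auto split: if_splits)
      next
        fix \<nu> :: nat assume "\<nu> \<notin> {1..4}"
        then show "x \<nu> = undefined" using 2 unfolding B_def by (rule PiE_arb[rotated])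
      qed
      moreover have "gauge_fixed N x \<mu>"
        unfolding gauge_fixed_def using x\<nu> x\<nu>[OF \<mu>] by fastforce
      ultimately show ?thesis by simp
    qed
  qed
  have fin: "finite B" unfolding B_def by (intro finite_PiE) auto
  have "z \<notin> B"
  proof
    assume "z \<in> B"
    then have "z \<mu> \<in> (if \<mu> < \<mu> then {0} else if \<mu> = \<mu> then {0..<N - 1} else {0..<N})"
      unfolding B_def using \<mu> by (rule PiE_mem)
    then show False using \<mu> by (simp add: z_def)
  qed
  then have "card (insert z B) = card B + 1" using fin by simp
  also have "card B = (\<Prod>\<nu>\<in>{1..4}. card (if \<nu> < \<mu> then {0} else if \<nu> = \<mu> then {0..<N - 1} else {0..<N}))"
    unfolding B_def by (rule card_PiE) simp
  also have "\<dots> = (\<Prod>\<nu>\<in>{1,2,3,4}. if \<nu> < \<mu> then 1 else if \<nu> = \<mu> then N - 1 else N)"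
    by (intro prod.cong) (auto simp: dirs_cases[simplified])
  also have "\<dots> = (N - 1) * N ^ (4 - \<mu>)"
    using \<mu> unfolding dirs_cases by (elim disjE) (simp_all add: eval_nat_numeral)
  finally show ?thesis unfolding eq .
qed

text \<open>Of the \<open>4 * N^4\<close> links, a spanning tree takes \<open>N^4 - 1\<close> and
  the winding links take four.\<close>

lemma card_free_links:
  assumes N: "N \<ge> 1"
  shows "card (free_links N) = 3 * N ^ 4 - 3"
proof -
  define F where "F = (SIGMA \<mu>:{1..4}. {x \<in> lattice N. gauge_fixed N x \<mu>})"
  have "bij_betw (\<lambda>(\<mu>, x). (x, [\<mu>])) ({1..4} \<times> lattice N - F) (free_links N)"
    by (rule bij_betw_byWitness[where f'="\<lambda>(x, is). (hd is, x)"]) (auto simp: F_def free_links_def)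
  then have "card (free_links N) = card ({1..4::nat} \<times> lattice N - F)"
    by (simp add: bij_betw_same_card)
  also have "\<dots> = card ({1..4::nat} \<times> lattice N) - card F"
    by (rule card_Diff_subset) (auto simp: F_def finite_lattice)
  also have "card F = (\<Sum>\<mu>\<in>{1..4}. card {x \<in> lattice N. gauge_fixed N x \<mu>})"
    unfolding F_def by (rule card_SigmaI) (auto simp: finite_lattice)
  also have "\<dots> = (\<Sum>\<mu>\<in>{1..4}. (N - 1) * N ^ (4 - \<mu>) + 1)"
    by (intro sum.cong refl card_gauge_fixed N)
  also have "\<dots> = N ^ 4 + 3"
  proof -
    obtain M where M: "N = Suc M" using N by (cases N) auto
    have "{1..4::nat} = {1,2,3,4}" by (auto simp: dirs_cases[simplified])
    then show ?thesis unfolding M by (simp add: eval_nat_numeral algebra_simps)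
  qed
  finally show ?thesis by (simp add: card_cartesian_product card_lattice)
qed

section \<open>The flux sum as the cube of a theta series\<close>

lemma infsum_product:
  fixes f :: "'a \<Rightarrow> complex" and g :: "'b \<Rightarrow> complex"
  assumes f: "(\<lambda>x. norm (f x)) summable_on A" and g: "(\<lambda>y. norm (g y)) summable_on B"
  shows "(\<lambda>p. norm (case p of (x, y) \<Rightarrow> f x * g y)) summable_on A \<times> B"
    and "(\<Sum>\<^sub>\<infinity>(x, y)\<in>A \<times> B. f x * g y) = (\<Sum>\<^sub>\<infinity>x\<in>A. f x) * (\<Sum>\<^sub>\<infinity>y\<in>B. g y)"
proof -
  show s: "(\<lambda>p. norm (case p of (x, y) \<Rightarrow> f x * g y)) summable_on A \<times> B"
    unfolding Infinite_Sum.abs_summable_on_Sigma_iff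
  proof (intro conjI ballI)
    show "(\<lambda>y. norm (case (x, y) of (x, y) \<Rightarrow> f x * g y)) summable_on B" for x
      using g by (auto simp: norm_mult intro: summable_on_cmult_right)
    show "(\<lambda>x. norm (\<Sum>\<^sub>\<infinity>y\<in>B. norm (case (x, y) of (x, y) \<Rightarrow> f x * g y))) summable_on A"
      using f by (auto simp: infsum_cmult_right' norm_mult abs_mult intro: summable_on_cmult_left)
  qed
  have "(\<lambda>p. case p of (x, y) \<Rightarrow> f x * g y) summable_on A \<times> B" using s by (rule abs_summable_summable)
  then have "(\<Sum>\<^sub>\<infinity>(x, y)\<in>A \<times> B. f x * g y) = (\<Sum>\<^sub>\<infinity>x\<in>A. \<Sum>\<^sub>\<infinity>y\<in>B. f x * g y)"
    by (rule infsum_Sigma'_banach[symmetric])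
  then show "(\<Sum>\<^sub>\<infinity>(x, y)\<in>A \<times> B. f x * g y) = (\<Sum>\<^sub>\<infinity>x\<in>A. f x) * (\<Sum>\<^sub>\<infinity>y\<in>B. g y)"
    by (simp add: infsum_cmult_right' infsum_cmult_left')
qed

lemma flux_sum_eq_theta_pair:
  assumes \<beta>: "\<beta> > 0"
  shows "(\<Sum>\<^sub>\<infinity>q. of_real (exp (- 2 * pi\<^sup>2 * \<beta> * of_int (flux_norm q))) * cis (- \<theta> * of_int (flux_charge q))) = theta_pair \<beta> \<theta> ^ 3"
proof -
  define f where "f = (\<lambda>(a, b). of_real (exp (- 2 * pi\<^sup>2 * \<beta> * ((of_int a)\<^sup>2 + (of_int b)\<^sup>2))) * cis (- \<theta> * of_int a * of_int b))"
  have f: "(\<lambda>p. norm (f p)) summable_on UNIV" unfolding f_def by (rule theta_pair_summable[OF \<beta>])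
  have "of_real (exp (- 2 * pi\<^sup>2 * \<beta> * of_int (flux_norm q))) * cis (- \<theta> * of_int (flux_charge q)) =
     (case q of (p1, p23) \<Rightarrow> f p1 * (case p23 of (p2, p3) \<Rightarrow> f p2 * f p3))" for q
  proof -
    obtain a a' b b' c c' where q: "q = ((a, a'), (b, b'), (c, c'))" by (metis surj_pair)
    have 1: "exp (- 2 * pi\<^sup>2 * \<beta> * of_int (flux_norm q)) = exp (- 2 * pi\<^sup>2 * \<beta> * ((of_int a)\<^sup>2 + (of_int a')\<^sup>2)) *
      (exp (- 2 * pi\<^sup>2 * \<beta> * ((of_int b)\<^sup>2 + (of_int b')\<^sup>2)) * exp (- 2 * pi\<^sup>2 * \<beta> * ((of_int c)\<^sup>2 + (of_int c')\<^sup>2)))"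
      unfolding q flux_norm_def exp_add[symmetric] by (simp add: algebra_simps)
    have 2: "cis (- \<theta> * of_int (flux_charge q)) = cis (- \<theta> * of_int a * of_int a') *
      (cis (- \<theta> * of_int b * of_int b') * cis (- \<theta> * of_int c * of_int c'))"
      unfolding q flux_charge_def cis_mult by (simp add: algebra_simps)
    show ?thesis unfolding 1 2 unfolding q f_def by (simp add: mult_ac)
  qed
  then have "(\<Sum>\<^sub>\<infinity>q. of_real (exp (- 2 * pi\<^sup>2 * \<beta> * of_int (flux_norm q))) * cis (- \<theta> * of_int (flux_charge q))) =
    (\<Sum>\<^sub>\<infinity>(p1, p23)\<in>UNIV \<times> (UNIV \<times> UNIV). f p1 * (case p23 of (p2, p3) \<Rightarrow> f p2 * f p3))"
    by simp
  also have "\<dots> = (\<Sum>\<^sub>\<infinity>p. f p) * ((\<Sum>\<^sub>\<infinity>p. f p) * (\<Sum>\<^sub>\<infinity>p. f p))"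
    by (subst infsum_product(2)[OF f infsum_product(1)[OF f f]]) (subst infsum_product(2)[OF f f], rule refl)
  also have "(\<Sum>\<^sub>\<infinity>p. f p) = theta_pair \<beta> \<theta>" unfolding theta_pair_def f_def ..
  finally show ?thesis by (simp add: power3_eq_cube)
qed

section \<open>The Gaussian integral over the links\<close>

definition action :: "nat \<Rightarrow> real form \<Rightarrow> int form \<Rightarrow> real" where
  "action N A n = (\<Sum>x\<in>lattice N. \<Sum>\<mu>\<nu>\<in>increasing_indices 2. (field_strength N A n (x, \<mu>\<nu>))\<^sup>2)"

text \<open>The Gaussian integral over the exact part of the field strength. Its value at \<beta> =
  1 stays an unevaluated constant common to all couplings.\<close>

definition gaussian_volume :: "nat \<Rightarrow> real \<Rightarrow> ennreal" where
  "gaussian_volume N \<beta> = (\<integral>\<^sup>+a. ennreal (exp (- (\<beta> / 2) * energy N (cobdry N (extend_links N a))))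
     \<partial>PiM (free_links N) (\<lambda>_. line_measure))"

lemma gauge_component_measurable:
  assumes "x \<in> lattice N" "\<mu> \<in> {1..4}"
  shows "(\<lambda>A. A (x, [\<mu>])) \<in> borel_measurable (gauge_measure N)"
proof -
  have "(x, [\<mu>]) \<in> lattice N \<times> indices 1" using assms unfolding indices_1 by auto
  then show ?thesis unfolding gauge_measure_def by measurable
qed

lemma action_measurable: "(\<lambda>A. action N A n) \<in> borel_measurable (gauge_measure N)"
proof -
  have "(\<lambda>A. field_strength N A n (x, is)) \<in> borel_measurable (gauge_measure N)"
    if x: "x \<in> lattice N" and i: "is \<in> increasing_indices 2" for x "is"
  proof -
    obtain \<mu> \<nu> where is_eq: "is = [\<mu>, \<nu>]" and \<mu>\<nu>: "\<mu> \<in> {1..4}" "\<nu> \<in> {1..4}"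
      using i unfolding increasing_indices_2_iff by blast
    have [measurable]: "(\<lambda>A. A (x, [\<mu>])) \<in> borel_measurable (gauge_measure N)" "(\<lambda>A. A (x, [\<nu>])) \<in> borel_measurable (gauge_measure N)"
      "(\<lambda>A. A (shift N x \<nu>, [\<mu>])) \<in> borel_measurable (gauge_measure N)" "(\<lambda>A. A (shift N x \<mu>, [\<nu>])) \<in> borel_measurable (gauge_measure N)"
      by (intro gauge_component_measurable shift_lattice x \<mu>\<nu>)+
    show ?thesis unfolding is_eq field_strength_def ext_deriv_1 cobdry_def by measurable
  qed
  then show ?thesis unfolding action_def by (intro borel_measurable_sum borel_measurable_power)
qed

lemma energy_links_measurable:
  "(\<lambda>a. energy N (cobdry N (extend_links N a))) \<in> borel_measurable (PiM (free_links N) (\<lambda>_. line_measure))"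
proof -
  have [measurable]: "(\<lambda>a. extend_links N a x \<mu>) \<in> borel_measurable (PiM (free_links N) (\<lambda>_. line_measure))" for x \<mu>
    unfolding extend_links_def by (cases "(x, [\<mu>]) \<in> free_links N") auto
  show ?thesis unfolding energy_def cobdry_def by measurable
qed

lemma energy_scale:
  "energy N (cobdry N (extend_links N (\<lambda>i\<in>free_links N. a i / s))) = energy N (cobdry N (extend_links N a)) / s\<^sup>2"
proof -
  have "extend_links N (\<lambda>i\<in>free_links N. a i / s) = (\<lambda>x \<mu>. extend_links N a x \<mu> / s)"
    by (simp add: extend_links_def fun_eq_iff)
  then show ?thesis
    unfolding energy_def cobdry_def
    by (simp add: diff_divide_distrib[symmetric] power_divide sum_divide_distrib)
qed

lemma gaussian_volume_scale:
  assumes \<beta>: "\<beta> > 0"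
  shows "gaussian_volume N \<beta> = ennreal ((1 / sqrt \<beta>) ^ card (free_links N)) * gaussian_volume N 1"
proof -
  have [measurable]: "(\<lambda>a. energy N (cobdry N (extend_links N a))) \<in> borel_measurable (PiM (free_links N) (\<lambda>_. line_measure))"
    by (rule energy_links_measurable)
  have "gaussian_volume N \<beta> = ennreal ((1 / sqrt \<beta>) ^ card (free_links N)) *
     (\<integral>\<^sup>+a. ennreal (exp (- (\<beta> / 2) * energy N (cobdry N (extend_links N (\<lambda>i\<in>free_links N. a i / sqrt \<beta>)))))
     \<partial>PiM (free_links N) (\<lambda>_. line_measure))"
    unfolding gaussian_volume_def using \<beta>
    by (intro nn_integral_PiM_line_scale[OF finite_free_links, where s="sqrt \<beta>" and f="\<lambda>a. ennreal (exp (- (\<beta> / 2) * energy N (cobdry N (extend_links N a))))"]) auto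
  then show ?thesis
    unfolding energy_scale gaussian_volume_def using \<beta> by simp
qed

lemma countable_int_PiE: "finite I \<Longrightarrow> countable (I \<rightarrow>\<^sub>E (UNIV :: int set))"
  by (rule countable_PiE) auto

text \<open>For fixed gauge-fixed links \<open>t\<close>, the sum over \<open>l\<close> and the
  integral over the free angles combine to an integral over real variables, where translation
  invariance removes the shift \<open>c\<close>. The result no longer depends on \<open>t\<close>,
  and the remaining angles have total mass one. All integrands are nonnegative, so every exchange is
  Tonelli.\<close>

lemma action_integral:
  assumes N: "N \<ge> 1"
  shows "(\<integral>\<^sup>+l. (\<integral>\<^sup>+A. ennreal (exp (- (\<beta> / 2) * action N A (closed_form N (q, l)))) \<partial>gauge_measure N)
      \<partial>count_space (free_links N \<rightarrow>\<^sub>E UNIV)) =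
    ennreal (exp (- 2 * pi\<^sup>2 * \<beta> * of_int (flux_norm q))) * gaussian_volume N \<beta>"
proof -
  define W where "W = free_links N"
  define T where "T = lattice N \<times> indices 1 - W"
  have W: "finite W" unfolding W_def by (rule finite_free_links)
  have T: "finite T" unfolding T_def using finite_lattice finite_indices by auto
  have TW: "T \<inter> W = {}" "T \<union> W = lattice N \<times> indices 1"
    using free_links_subset[of N] unfolding T_def W_def by auto
  have gauge: "gauge_measure N = PiM (T \<union> W) (\<lambda>_. circle_measure)"
    unfolding TW(2) gauge_measure_def ..
  interpret W: finite_product_sigma_finite "\<lambda>_. circle_measure" W by standard fact
  interpret PT: prob_space "PiM T (\<lambda>_. circle_measure)"
    by (rule prob_space_PiM) (rule prob_space_circle_measure)
  define g where "g l A = ennreal (exp (- (\<beta> / 2) * action N A (closed_form N (q, l))))" for l A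
  have g[measurable]: "g l \<in> borel_measurable (PiM (T \<union> W) (\<lambda>_. circle_measure))" for l
    unfolding g_def gauge[symmetric] using action_measurable by measurable
  have gm[measurable]: "(\<lambda>p. g l (merge T W p)) \<in> borel_measurable (PiM T (\<lambda>_. circle_measure) \<Otimes>\<^sub>M PiM W (\<lambda>_. circle_measure))" for l
    by (rule measurable_compose[OF measurable_merge g])
  have "(\<integral>\<^sup>+l. (\<integral>\<^sup>+A. g l A \<partial>gauge_measure N) \<partial>count_space (W \<rightarrow>\<^sub>E UNIV)) =
    (\<integral>\<^sup>+l. (\<integral>\<^sup>+t. (\<integral>\<^sup>+a. g l (merge T W (t, a)) \<partial>PiM W (\<lambda>_. circle_measure)) \<partial>PiM T (\<lambda>_. circle_measure)) \<partial>count_space (W \<rightarrow>\<^sub>E UNIV))"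
    unfolding gauge by (intro nn_integral_cong circle.product_nn_integral_fold TW T W g)
  also have "\<dots> = (\<integral>\<^sup>+t. (\<integral>\<^sup>+l. (\<integral>\<^sup>+a. g l (merge T W (t, a)) \<partial>PiM W (\<lambda>_. circle_measure)) \<partial>count_space (W \<rightarrow>\<^sub>E UNIV)) \<partial>PiM T (\<lambda>_. circle_measure))"
  proof (rule nn_integral_count_space_nn_integral[symmetric])
    show "countable (W \<rightarrow>\<^sub>E (UNIV :: int set))" by (rule countable_int_PiE[OF W])
    show "(\<lambda>t. \<integral>\<^sup>+a. g l (merge T W (t, a)) \<partial>PiM W (\<lambda>_. circle_measure)) \<in> borel_measurable (PiM T (\<lambda>_. circle_measure))" for l
      by (rule W.borel_measurable_nn_integral_fst[OF gm])
  qed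
  also have "\<dots> = (\<integral>\<^sup>+t. ennreal (exp (- 2 * pi\<^sup>2 * \<beta> * of_int (flux_norm q))) * gaussian_volume N \<beta> \<partial>PiM T (\<lambda>_. circle_measure))"
  proof (rule nn_integral_cong)
    fix t :: "real form"
    \<comment> \<open>This \<open>c\<close> is chosen for the given \<open>t\<close> and
      \<open>q\<close>, before \<open>l\<close> and the free angles vary.\<close>
    obtain c where c: "\<And>A l. \<forall>p\<in>T. A p = t p \<Longrightarrow>
       action N A (closed_form N (q, l)) =
       energy N (cobdry N (extend_links N (\<lambda>p. A p + 2 * pi * real_of_int (l p) + c p))) + 4 * pi\<^sup>2 * of_int (flux_norm q)"
      using energy_closed_form[OF N, of t q] unfolding action_def T_def W_def by blast
    define E where "E x = energy N (cobdry N (extend_links N x))" for x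
    define F where "F x = ennreal (exp (- 2 * pi\<^sup>2 * \<beta> * of_int (flux_norm q))) * ennreal (exp (- (\<beta> / 2) * E x))" for x
    have Em[measurable]: "E \<in> borel_measurable (PiM W (\<lambda>_. line_measure))"
      unfolding E_def W_def by (rule energy_links_measurable)
    have Fm: "F \<in> borel_measurable (PiM W (\<lambda>_. line_measure))"
      unfolding F_def by measurable
    have m: "(\<lambda>x. \<lambda>i\<in>W. x i + c i) \<in> measurable (PiM W (\<lambda>_. line_measure)) (PiM W (\<lambda>_. line_measure))"
      by (rule measurable_restrict) measurable
    have ext: "extend_links N (\<lambda>i\<in>W. x i) = extend_links N x" for x :: "site \<times> nat list \<Rightarrow> real"
      by (simp add: extend_links_def W_def fun_eq_iff)
    have gF: "g l (merge T W (t, a)) = F (\<lambda>i\<in>W. (\<lambda>i\<in>W. a i + 2 * pi * real_of_int (l i)) i + c i)" for l a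
    proof -
      have "extend_links N (\<lambda>p. merge T W (t, a) p + 2 * pi * real_of_int (l p) + c p) =
         extend_links N (\<lambda>i\<in>W. (\<lambda>i\<in>W. a i + 2 * pi * real_of_int (l i)) i + c i)"
        using TW by (auto simp: extend_links_def W_def fun_eq_iff)
      moreover have "action N (merge T W (t, a)) (closed_form N (q, l)) = energy N (cobdry N (extend_links N (\<lambda>p. merge T W (t, a) p + 2 * pi * real_of_int (l p) + c p))) + 4 * pi\<^sup>2 * of_int (flux_norm q)"
        by (rule c) (auto simp: merge_def)
      moreover have "exp (- (\<beta> / 2) * (e + 4 * pi\<^sup>2 * r)) = exp (- 2 * pi\<^sup>2 * \<beta> * r) * exp (- (\<beta> / 2) * e)" for e r
        by (simp add: exp_add[symmetric] algebra_simps)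
      ultimately show ?thesis unfolding g_def F_def E_def by (simp only: ennreal_mult'[symmetric] exp_ge_zero)
    qed
    have "(\<integral>\<^sup>+l. (\<integral>\<^sup>+a. g l (merge T W (t, a)) \<partial>PiM W (\<lambda>_. circle_measure)) \<partial>count_space (W \<rightarrow>\<^sub>E UNIV)) =
       (\<integral>\<^sup>+l. (\<integral>\<^sup>+a. F (\<lambda>i\<in>W. (\<lambda>i\<in>W. a i + 2 * pi * real_of_int (l i)) i + c i) \<partial>PiM W (\<lambda>_. circle_measure)) \<partial>PiM W (\<lambda>_. count_space (UNIV :: int set)))"
      unfolding gF by (subst count_space_PiM_finite[OF W]) auto
    also have "\<dots> = (\<integral>\<^sup>+x. F (\<lambda>i\<in>W. x i + c i) \<partial>PiM W (\<lambda>_. line_measure))"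
      by (rule nn_integral_PiM_line_unfold[OF W, symmetric]) (rule measurable_compose[OF m Fm])
    also have "\<dots> = (\<integral>\<^sup>+x. F x \<partial>PiM W (\<lambda>_. line_measure))"
      by (rule nn_integral_PiM_line_translate[OF W Fm, symmetric])
    also have "\<dots> = ennreal (exp (- 2 * pi\<^sup>2 * \<beta> * of_int (flux_norm q))) * gaussian_volume N \<beta>"
      unfolding F_def gaussian_volume_def E_def[symmetric] W_def[symmetric] by (rule nn_integral_cmult) measurable
    finally show "(\<integral>\<^sup>+l. (\<integral>\<^sup>+a. g l (merge T W (t, a)) \<partial>PiM W (\<lambda>_. circle_measure)) \<partial>count_space (W \<rightarrow>\<^sub>E UNIV)) =
      ennreal (exp (- 2 * pi\<^sup>2 * \<beta> * of_int (flux_norm q))) * gaussian_volume N \<beta>" .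
  qed
  also have "\<dots> = ennreal (exp (- 2 * pi\<^sup>2 * \<beta> * of_int (flux_norm q))) * gaussian_volume N \<beta>"
    by (simp add: PT.emeasure_space_1)
  finally show ?thesis unfolding g_def W_def .
qed

section \<open>The partition function as a theta series\<close>

definition flux_links :: "nat \<Rightarrow> (fluxes \<times> (site \<times> nat list \<Rightarrow> int)) set" where
  "flux_links N = UNIV \<times> (free_links N \<rightarrow>\<^sub>E UNIV)"

text \<open>Separates the integer form from the gauge field in the action, so that Boltzmann weights
  are dominated by a Gaussian in \<open>n\<close> alone.\<close>

lemma square_lower_bound: "2 * pi\<^sup>2 * r\<^sup>2 - a\<^sup>2 \<le> (a + 2 * pi * r)\<^sup>2" for a r :: real
proof -
  have "(a + 2 * pi * r)\<^sup>2 - (2 * pi\<^sup>2 * r\<^sup>2 - a\<^sup>2) = 2 * (a + pi * r)\<^sup>2"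
    by (simp add: power2_eq_square algebra_simps)
  then show ?thesis using zero_le_power2[of "a + pi * r"] by linarith
qed

definition plaquettes :: "nat \<Rightarrow> (site \<times> nat list) set" where
  "plaquettes N = lattice N \<times> increasing_indices 2"

lemma finite_plaquettes: "finite (plaquettes N)"
  unfolding plaquettes_def increasing_indices_2 using finite_lattice by simp

lemma action_plaquettes: "action N A n = (\<Sum>p\<in>plaquettes N. (field_strength N A n p)\<^sup>2)"
  unfolding action_def plaquettes_def sum.cartesian_product by (simp add: case_prod_unfold)

lemma action_lower_bound:
  "2 * pi\<^sup>2 * (\<Sum>p\<in>plaquettes N. (of_int (n p))\<^sup>2) - (\<Sum>p\<in>plaquettes N. (ext_deriv N A p)\<^sup>2) \<le> action N A n"
  unfolding action_plaquettes field_strength_def sum_distrib_left sum_subtractf[symmetric]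
  by (intro sum_mono square_lower_bound)

lemma ext_deriv_bound:
  assumes A: "\<And>p. p \<in> lattice N \<times> indices 1 \<Longrightarrow> \<bar>A p\<bar> \<le> pi"
  shows "(\<Sum>p\<in>plaquettes N. (ext_deriv N A p)\<^sup>2) \<le> real (card (plaquettes N)) * (4 * pi)\<^sup>2"
proof (rule sum_bounded_above)
  fix p assume "p \<in> plaquettes N"
  then obtain x \<mu> \<nu> where p: "p = (x, [\<mu>, \<nu>])" and x: "x \<in> lattice N" and \<mu>: "\<mu> \<in> {1..4}" and \<nu>: "\<nu> \<in> {1..4}"
    unfolding plaquettes_def increasing_indices_2_iff by blast
  have b: "\<bar>A (y, [\<rho>])\<bar> \<le> pi" if "y \<in> lattice N" "\<rho> \<in> {1..4}" for y \<rho>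
  proof -
    have "(y, [\<rho>]) \<in> lattice N \<times> indices 1" using that unfolding indices_1 by blast
    then show ?thesis by (rule A)
  qed
  have "\<bar>ext_deriv N A p\<bar> \<le> 4 * pi"
    unfolding p ext_deriv_1 cobdry_def
    using b[OF x \<mu>] b[OF x \<nu>] b[OF shift_lattice[OF x \<mu>] \<nu>] b[OF shift_lattice[OF x \<nu>] \<mu>] by linarith
  then have "\<bar>ext_deriv N A p\<bar> \<le> \<bar>4 * pi\<bar>" by simp
  then show "(ext_deriv N A p)\<^sup>2 \<le> (4 * pi)\<^sup>2" by (simp only: abs_le_square_iff)
qed

lemma inj_on_restrict_plaquettes: "inj_on (\<lambda>n. restrict n (plaquettes N)) (closed_forms N)"
proof (rule inj_onI)
  fix n n' assume n: "n \<in> closed_forms N" and n': "n' \<in> closed_forms N"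
    and eq: "restrict n (plaquettes N) = restrict n' (plaquettes N)"
  have f: "n \<in> forms N 2" "n' \<in> forms N 2" using n n' unfolding closed_forms_def by auto
  have lt: "n (x, [\<mu>, \<nu>]) = n' (x, [\<mu>, \<nu>])" if "x \<in> lattice N" "\<mu> \<in> {1..4}" "\<nu> \<in> {1..4}" "\<mu> < \<nu>" for x \<mu> \<nu>
  proof -
    have "(x, [\<mu>, \<nu>]) \<in> plaquettes N" using that unfolding plaquettes_def increasing_indices_2_iff by blast
    then show ?thesis using eq by (metis restrict_apply')
  qed
  show "n = n'" by (rule forms_2_eqI[OF f lt])
qed

text \<open>Restriction to increasing index pairs embeds the closed forms into all integer functions
  on the plaquettes, where the sum is a finite product of one-dimensional Gaussian sums.\<close>

lemma gaussian_forms_summable: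
  fixes c :: real
  assumes N: "N \<ge> 1" and c: "c > 0"
  shows "(\<lambda>p. exp (- c * (\<Sum>x\<in>plaquettes N. (of_int (closed_form N p x))\<^sup>2))) summable_on flux_links N"
proof -
  define g where "g k = (\<Prod>x\<in>plaquettes N. exp (- c * (of_int (k x))\<^sup>2))" for k :: "int form"
  define \<phi> where "\<phi> p = restrict (closed_form N p) (plaquettes N)" for p
  have "Infinite_Sum.abs_summable_on (\<lambda>k::int. exp (- c * (of_int k)\<^sup>2)) UNIV"
    using gaussian_summable[OF c] by simp
  then have "Infinite_Set_Sum.abs_summable_on g (PiE (plaquettes N) (\<lambda>_. UNIV))"
    unfolding g_def abs_summable_equivalent
    by (intro abs_summable_on_prod_PiE finite_plaquettes) auto
  then have "(\<lambda>k. norm (g k)) summable_on (PiE (plaquettes N) (\<lambda>_. UNIV))"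
    unfolding abs_summable_equivalent .
  then have "g summable_on (PiE (plaquettes N) (\<lambda>_. UNIV))"
    by (rule abs_summable_summable)
  then have "g summable_on \<phi> ` flux_links N"
    by (rule summable_on_subset) (auto simp: \<phi>_def)
  moreover have "inj_on \<phi> (flux_links N)"
    unfolding \<phi>_def flux_links_def
    by (rule comp_inj_on[OF closed_form_inj[OF N], unfolded o_def])
       (rule inj_on_subset[OF inj_on_restrict_plaquettes], use closed_form_in in blast)
  ultimately have "(g \<circ> \<phi>) summable_on flux_links N"
    by (simp add: summable_on_reindex)
  moreover have "(g \<circ> \<phi>) p = exp (- c * (\<Sum>x\<in>plaquettes N. (of_int (closed_form N p x))\<^sup>2))" for p
    by (simp add: g_def \<phi>_def exp_sum[OF finite_plaquettes, symmetric] sum_distrib_left)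
  ultimately show ?thesis by (simp add: o_def)
qed

lemma boltzmann_bound:
  assumes "\<beta> > 0"
  shows "exp (- (\<beta> / 2) * action N A n) \<le> exp (\<beta> / 2 * (\<Sum>p\<in>plaquettes N. (ext_deriv N A p)\<^sup>2)) *
     exp (- (\<beta> * pi\<^sup>2) * (\<Sum>p\<in>plaquettes N. (of_int (n p))\<^sup>2))"
proof -
  have "\<beta> / 2 * (2 * pi\<^sup>2 * (\<Sum>p\<in>plaquettes N. (of_int (n p))\<^sup>2) - (\<Sum>p\<in>plaquettes N. (ext_deriv N A p)\<^sup>2)) \<le> \<beta> / 2 * action N A n"
    using action_lower_bound assms by (intro mult_left_mono) auto
  then show ?thesis unfolding exp_add[symmetric] by (simp add: algebra_simps)
qed

lemma prob_space_gauge_measure: "prob_space (gauge_measure N)"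
  unfolding gauge_measure_def by (intro prob_space_PiM prob_space_circle_measure)

lemma AE_gauge_measure_bounded: "AE A in gauge_measure N. \<forall>p\<in>lattice N \<times> indices 1. \<bar>A p\<bar> \<le> pi"
proof (rule AE_finite_allI)
  show "finite (lattice N \<times> indices 1)" using finite_lattice finite_indices by auto
  fix p assume p: "p \<in> lattice N \<times> indices 1"
  have "AE y in circle_measure. \<bar>y\<bar> \<le> pi"
    by (rule AE_uniform_measureI) auto
  then show "AE A in gauge_measure N. \<bar>A p\<bar> \<le> pi"
    unfolding gauge_measure_def by (intro AE_PiM_component[OF prob_space_circle_measure p])
qed

text \<open>Here \<open>A\<close> is arbitrary and the majorant may depend on it, because
  \<open>integral_infsum_swap\<close> asks for summability at every point of the measure space, also
  outside the angular box.\<close>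

lemma boltzmann_summable:
  assumes N: "N \<ge> 1" and \<beta>: "\<beta> > 0"
  shows "(\<lambda>p. exp (- (\<beta> / 2) * action N A (closed_form N p))) summable_on flux_links N"
proof (rule summable_on_comparison_test)
  show "(\<lambda>p. exp (\<beta> / 2 * (\<Sum>x\<in>plaquettes N. (ext_deriv N A x)\<^sup>2)) *
     exp (- (\<beta> * pi\<^sup>2) * (\<Sum>x\<in>plaquettes N. (of_int (closed_form N p x))\<^sup>2))) summable_on flux_links N"
    using \<beta> by (intro summable_on_cmult_right gaussian_forms_summable[OF N]) auto
qed (rule boltzmann_bound[OF \<beta>], simp)

lemma boltzmann_integrable:
  assumes \<beta>: "\<beta> > 0"
  shows "integrable (gauge_measure N) (\<lambda>A. exp (- (\<beta> / 2) * action N A n))"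
proof -
  interpret prob_space "gauge_measure N" by (rule prob_space_gauge_measure)
  have [measurable]: "(\<lambda>A. action N A n) \<in> borel_measurable (gauge_measure N)" by (rule action_measurable)
  have "action N A n \<ge> 0" for A unfolding action_def by (intro sum_nonneg) auto
  then show ?thesis using \<beta>
    by (intro integrable_const_bound[of _ 1]) auto
qed

text \<open>A majorant independent of \<open>A\<close> comes from the bound \<pi> on the angles. It
  holds only almost everywhere, since \<open>circle_measure\<close> lives on the whole real
  line.\<close>

lemma boltzmann_integral_summable:
  assumes N: "N \<ge> 1" and \<beta>: "\<beta> > 0"
  shows "(\<lambda>p. \<integral>A. exp (- (\<beta> / 2) * action N A (closed_form N p)) \<partial>gauge_measure N) summable_on flux_links N"
proof -
  interpret prob_space "gauge_measure N" by (rule prob_space_gauge_measure)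
  define w where "w p A = exp (- (\<beta> / 2) * action N A (closed_form N p))" for p A
  define g where "g p = exp (- (\<beta> * pi\<^sup>2) * (\<Sum>x\<in>plaquettes N. (of_int (closed_form N p x))\<^sup>2))" for p
  define K where "K = exp (\<beta> / 2 * (real (card (plaquettes N)) * (4 * pi)\<^sup>2))"
  have int: "integrable (gauge_measure N) (w p)" for p
    unfolding w_def by (rule boltzmann_integrable[OF \<beta>])
  have g: "g summable_on flux_links N"
    unfolding g_def using \<beta> by (intro gaussian_forms_summable[OF N]) auto
  have le: "(\<integral>A. w p A \<partial>gauge_measure N) \<le> K * g p" for p
  proof -
    have "AE A in gauge_measure N. w p A \<le> K * g p"
      using AE_gauge_measure_bounded
    proof eventually_elim
      fix A assume A: "\<forall>p\<in>lattice N \<times> indices 1. \<bar>A p\<bar> \<le> pi"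
      have "w p A \<le> exp (\<beta> / 2 * (\<Sum>p\<in>plaquettes N. (ext_deriv N A p)\<^sup>2)) * g p"
        unfolding w_def g_def by (rule boltzmann_bound[OF \<beta>])
      also have "\<dots> \<le> K * g p"
        unfolding K_def using \<beta> ext_deriv_bound[of N A] A by (intro mult_right_mono) (auto simp: g_def)
      finally show "w p A \<le> K * g p" .
    qed
    then have "(\<integral>A. w p A \<partial>gauge_measure N) \<le> (\<integral>A. K * g p \<partial>gauge_measure N)"
      by (intro integral_mono_AE int) auto
    then show ?thesis by (simp add: prob_space)
  qed
  show ?thesis
    using summable_on_cmult_right[OF g, of K] le unfolding w_def
    by (rule summable_on_comparison_test) auto
qed

section \<open>Assembly of the partition function\<close>

lemma infsum_eq_enn2real_nn_integral:
  fixes g :: "'a \<Rightarrow> real"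
  assumes "\<And>x. x \<in> X \<Longrightarrow> g x \<ge> 0" "g summable_on X"
  shows "(\<Sum>\<^sub>\<infinity>x\<in>X. g x) = enn2real (\<integral>\<^sup>+x. ennreal (g x) \<partial>count_space X)"
proof -
  have "(\<lambda>x. norm (g x)) summable_on X"
    using assms by (subst summable_on_cong[of X _ g]) auto
  then have "(\<Sum>\<^sub>\<infinity>x\<in>X. g x) = (\<integral>x. g x \<partial>count_space X)"
    using infsetsum_infsum[of g X] unfolding abs_summable_equivalent infsetsum_def by simp
  also have "\<dots> = enn2real (\<integral>\<^sup>+x. ennreal (g x) \<partial>count_space X)"
    using assms(1) by (intro integral_eq_nn_integral) (auto simp: AE_count_space)
  finally show ?thesis .
qed

lemma boltzmann_link_sum:
  assumes N: "N \<ge> 1" and \<beta>: "\<beta> > 0"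
  shows "(\<Sum>\<^sub>\<infinity>l\<in>free_links N \<rightarrow>\<^sub>E UNIV. \<integral>A. exp (- (\<beta> / 2) * action N A (closed_form N (q, l))) \<partial>gauge_measure N) =
    exp (- 2 * pi\<^sup>2 * \<beta> * of_int (flux_norm q)) * ((1 / sqrt \<beta>) ^ (3 * N ^ 4 - 3) * enn2real (gaussian_volume N 1))"
proof -
  define w where "w l A = exp (- (\<beta> / 2) * action N A (closed_form N (q, l)))" for l A
  have "(\<lambda>p. \<integral>A. exp (- (\<beta> / 2) * action N A (closed_form N p)) \<partial>gauge_measure N) summable_on Pair q ` (free_links N \<rightarrow>\<^sub>E UNIV)"
    by (rule summable_on_subset[OF boltzmann_integral_summable[OF N \<beta>]]) (auto simp: flux_links_def)
  then have s: "(\<lambda>l. \<integral>A. w l A \<partial>gauge_measure N) summable_on (free_links N \<rightarrow>\<^sub>E UNIV)"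
    by (subst (asm) summable_on_reindex) (auto simp: inj_on_def o_def w_def)
  have "(\<Sum>\<^sub>\<infinity>l\<in>free_links N \<rightarrow>\<^sub>E UNIV. \<integral>A. w l A \<partial>gauge_measure N) =
     enn2real (\<integral>\<^sup>+l. ennreal (\<integral>A. w l A \<partial>gauge_measure N) \<partial>count_space (free_links N \<rightarrow>\<^sub>E UNIV))"
    by (rule infsum_eq_enn2real_nn_integral[OF _ s]) (simp add: w_def)
  also have "(\<integral>\<^sup>+l. ennreal (\<integral>A. w l A \<partial>gauge_measure N) \<partial>count_space (free_links N \<rightarrow>\<^sub>E UNIV)) =
     (\<integral>\<^sup>+l. (\<integral>\<^sup>+A. ennreal (w l A) \<partial>gauge_measure N) \<partial>count_space (free_links N \<rightarrow>\<^sub>E UNIV))"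
    unfolding w_def by (intro nn_integral_cong nn_integral_eq_integral[symmetric] boltzmann_integrable \<beta>) auto
  also have "\<dots> = ennreal (exp (- 2 * pi\<^sup>2 * \<beta> * of_int (flux_norm q))) *
     (ennreal ((1 / sqrt \<beta>) ^ (3 * N ^ 4 - 3)) * gaussian_volume N 1)"
    unfolding w_def action_integral[OF N] gaussian_volume_scale[OF \<beta>] card_free_links[OF N] ..
  finally show ?thesis unfolding w_def using \<beta> by (simp add: enn2real_mult)
qed

text \<open>The phase has modulus one, so the Boltzmann weights alone justify the exchange of sum
  and integral. As the phase depends on the fluxes only, it leaves the sum over \<open>l\<close>,
  which is then the real quantity of \<open>boltzmann_link_sum\<close>.\<close>

lemma partition_function_eq:
  assumes N: "N \<ge> 1" and \<beta>: "\<beta> > 0"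
  shows "partition_function N \<beta> \<theta> =
    of_real (enn2real (gaussian_volume N 1)) * of_real ((1 / sqrt \<beta>) ^ (3 * N ^ 4 - 3)) * theta_pair \<beta> \<theta> ^ 3"
proof -
  define h where "h A n = exp (- of_real (\<beta> / 2 * action N A n) - \<i> * of_real \<theta> * of_real (top_charge N (field_strength N A n)))" for A n
  define w where "w p A = exp (- (\<beta> / 2) * action N A (closed_form N p))" for p A
  define \<omega> where "\<omega> q = cis (- \<theta> * of_int (flux_charge q))" for q
  \<comment> \<open>On \<open>forms\<close> the product of Kronecker deltas is the indicator of
    \<open>closed_forms\<close>.\<close>
  have constraint: "(\<Prod>x\<in>lattice N. \<Prod>\<mu>\<nu>\<rho>\<in>increasing_indices 3. if ext_deriv N n (x, \<mu>\<nu>\<rho>) = 0 then 1 else (0::complex)) =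
     (if n \<in> closed_forms N then 1 else 0)" if nf: "n \<in> forms N 2" for n
  proof -
    have fin: "finite (increasing_indices 3)" by (rule finite_subset[OF increasing_indices_subset finite_indices])
    show ?thesis
    proof (cases "n \<in> closed_forms N")
      case True
      then show ?thesis by (auto simp: closed_forms_def intro!: prod.neutral)
    next
      case False
      then obtain x "is" where "x \<in> lattice N" "is \<in> increasing_indices 3" "ext_deriv N n (x, is) \<noteq> 0"
        using nf unfolding closed_forms_def by blast
      then show ?thesis using False
        by (auto intro!: prod_zero[OF finite_lattice] bexI[of _ x] prod_zero[OF fin] bexI[of _ "is"])
    qed
  qed
  have h: "h A (closed_form N (q, l)) = of_real (w (q, l) A) * \<omega> q" for A q l
  proof -
    have "- of_real (\<beta> / 2 * S) - \<i> * of_real \<theta> * of_real c = of_real (- (\<beta> / 2) * S) + \<i> * of_real (- \<theta> * c)" for S c :: real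
      by simp
    then show ?thesis
      unfolding h_def w_def \<omega>_def top_charge_closed_form[OF N] cis_conv_exp
      by (simp only: exp_add exp_of_real)
  qed
  have inner: "(\<Sum>\<^sub>\<infinity>n\<in>forms N 2. h A n * (\<Prod>x\<in>lattice N. \<Prod>\<mu>\<nu>\<rho>\<in>increasing_indices 3. if ext_deriv N n (x, \<mu>\<nu>\<rho>) = 0 then 1 else 0)) =
     (\<Sum>\<^sub>\<infinity>p\<in>flux_links N. of_real (w p A) * \<omega> (fst p))" for A
  proof -
    have "(\<Sum>\<^sub>\<infinity>n\<in>forms N 2. h A n * (\<Prod>x\<in>lattice N. \<Prod>\<mu>\<nu>\<rho>\<in>increasing_indices 3. if ext_deriv N n (x, \<mu>\<nu>\<rho>) = 0 then 1 else 0)) =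
      (\<Sum>\<^sub>\<infinity>n\<in>closed_forms N. h A n)"
      by (rule infsum_cong_neutral) (auto simp: constraint closed_forms_def)
    also have "\<dots> = (\<Sum>\<^sub>\<infinity>p\<in>flux_links N. h A (closed_form N p))"
      unfolding flux_links_def by (rule infsum_reindex_bij_betw[OF bij_betw_closed_form[OF N], symmetric])
    also have "\<dots> = (\<Sum>\<^sub>\<infinity>p\<in>flux_links N. of_real (w p A) * \<omega> (fst p))"
      by (rule infsum_cong) (auto simp: h)
    finally show ?thesis .
  qed
  have nw: "norm (of_real (w p A) * \<omega> (fst p)) = w p A" for p A
    by (simp add: norm_mult \<omega>_def w_def)
  have cnt: "countable (flux_links N)"
    unfolding flux_links_def by (intro countable_SIGMA countable_int_PiE finite_free_links) auto
  have int: "integrable (gauge_measure N) (w p)" for p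
    unfolding w_def by (rule boltzmann_integrable[OF \<beta>])
  have "partition_function N \<beta> \<theta> = (\<integral>A. (\<Sum>\<^sub>\<infinity>p\<in>flux_links N. of_real (w p A) * \<omega> (fst p)) \<partial>gauge_measure N)"
    unfolding partition_function_def inner[symmetric] h_def action_def ..
  also have "\<dots> = (\<Sum>\<^sub>\<infinity>p\<in>flux_links N. \<integral>A. of_real (w p A) * \<omega> (fst p) \<partial>gauge_measure N)"
  proof (rule integral_infsum_swap)
    show "sigma_finite_measure (gauge_measure N)"
      by (rule prob_space_imp_sigma_finite[OF prob_space_gauge_measure])
    show "integrable (gauge_measure N) (\<lambda>A. of_real (w p A) * \<omega> (fst p))" for p
      using int[of p] by (intro integrable_mult_left integrable_of_real)
    show "(\<lambda>p. norm (of_real (w p A) * \<omega> (fst p))) summable_on flux_links N" for A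
      unfolding nw unfolding w_def by (rule boltzmann_summable[OF N \<beta>])
    show "(\<lambda>p. \<integral>A. norm (of_real (w p A) * \<omega> (fst p)) \<partial>gauge_measure N) summable_on flux_links N"
      unfolding nw unfolding w_def by (rule boltzmann_integral_summable[OF N \<beta>])
  qed (rule cnt)
  also have "\<dots> = (\<Sum>\<^sub>\<infinity>p\<in>flux_links N. of_real (\<integral>A. w p A \<partial>gauge_measure N) * \<omega> (fst p))"
    by simp
  \<comment> \<open>The sum over links is taken first, at fixed flux, where the phase is
    constant.\<close>
  also have "\<dots> = (\<Sum>\<^sub>\<infinity>q. \<Sum>\<^sub>\<infinity>l\<in>free_links N \<rightarrow>\<^sub>E UNIV. of_real (\<integral>A. w (q, l) A \<partial>gauge_measure N) * \<omega> q)"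
  proof -
    have "(\<lambda>p. norm (of_real (\<integral>A. w p A \<partial>gauge_measure N) * \<omega> (fst p))) summable_on flux_links N"
    proof -
      have "norm (of_real (\<integral>A. w p A \<partial>gauge_measure N) * \<omega> (fst p)) = (\<integral>A. w p A \<partial>gauge_measure N)" for p
        by (simp add: norm_mult \<omega>_def w_def)
      then show ?thesis using boltzmann_integral_summable[OF N \<beta>] by (simp add: w_def)
    qed
    then have "(\<lambda>p. of_real (\<integral>A. w p A \<partial>gauge_measure N) * \<omega> (fst p)) summable_on flux_links N"
      by (rule abs_summable_summable)
    then have "(\<lambda>(q, l). of_real (\<integral>A. w (q, l) A \<partial>gauge_measure N) * \<omega> q) summable_on UNIV \<times> (free_links N \<rightarrow>\<^sub>E UNIV)"
      unfolding flux_links_def by (simp add: case_prod_unfold)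
    from infsum_Sigma'_banach[OF this] show ?thesis
      unfolding flux_links_def by (simp add: case_prod_unfold)
  qed
  also have "\<dots> = (\<Sum>\<^sub>\<infinity>q. of_real (\<Sum>\<^sub>\<infinity>l\<in>free_links N \<rightarrow>\<^sub>E UNIV. \<integral>A. w (q, l) A \<partial>gauge_measure N) * \<omega> q)"
    by (simp only: infsum_cmult_left' infsum_of_real)
  also have "\<dots> = (\<Sum>\<^sub>\<infinity>q. of_real ((1 / sqrt \<beta>) ^ (3 * N ^ 4 - 3) * enn2real (gaussian_volume N 1)) *
      (of_real (exp (- 2 * pi\<^sup>2 * \<beta> * of_int (flux_norm q))) * \<omega> q))"
    unfolding w_def boltzmann_link_sum[OF N \<beta>] by (simp only: of_real_mult mult_ac)
  also have "\<dots> = of_real ((1 / sqrt \<beta>) ^ (3 * N ^ 4 - 3) * enn2real (gaussian_volume N 1)) * theta_pair \<beta> \<theta> ^ 3"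
    unfolding \<omega>_def infsum_cmult_right' flux_sum_eq_theta_pair[OF \<beta>] ..
  finally show ?thesis by (simp only: of_real_mult mult_ac)
qed

theorem mainTheorem1:
  fixes N :: nat
  assumes "N \<ge> 1"
  shows "(\<forall>\<beta> \<theta> :: real. \<beta> > 0 \<longrightarrow>
            - 1 / tau \<beta> \<theta> = tau (dual_beta \<beta> \<theta>) (dual_theta \<beta> \<theta>) \<and>
            partition_function N \<beta> (\<theta> + 2 * pi) = partition_function N \<beta> \<theta> \<and>
            partition_function N \<beta> \<theta> =
              of_real (sqrt (dual_beta \<beta> \<theta> / \<beta>) ^ (3 * N ^ 4)) *
              partition_function N (dual_beta \<beta> \<theta>) (dual_theta \<beta> \<theta>)) \<and>
         (\<forall>a b c d :: int. a * d - b * c = 1 \<longrightarrow>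
            (\<forall>\<tau> :: complex. Im \<tau> > 0 \<longrightarrow>
               rescaled_partition_function N
                 ((of_int a * \<tau> + of_int b) / (of_int c * \<tau> + of_int d)) =
               rescaled_partition_function N \<tau>))"
proof -
  define C where "C = complex_of_real (enn2real (gaussian_volume N 1))"
  have Z: "partition_function N \<beta> \<theta> = C * of_real ((1 / sqrt \<beta>) ^ (3 * N ^ 4 - 3)) * theta_pair \<beta> \<theta> ^ 3" if "\<beta> > 0" for \<beta> \<theta>
    unfolding C_def by (rule partition_function_eq[OF assms that])
  define K where "K = C * of_real ((1 / sqrt (2 * pi)) ^ 3)"
  \<comment> \<open>The power \<open>sqrt \<beta> ^ (3 * N ^ 4)\<close> is used up exactly: all but
    three factors by the Gaussian integral, the last three by the Poisson factors of the theta
    series.\<close>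
  have resc': "of_real (sqrt \<beta> ^ (3 * N ^ 4)) * partition_function N \<beta> \<theta> = K * of_real (lattice_theta (tau \<beta> \<theta>)) ^ 3"
    if \<beta>: "\<beta> > 0" for \<beta> \<theta>
  proof -
    have "3 * N ^ 4 = (3 * N ^ 4 - 3) + 3" using assms by simp
    then have "sqrt \<beta> ^ (3 * N ^ 4) = sqrt \<beta> ^ (3 * N ^ 4 - 3) * sqrt \<beta> ^ 3"
      by (metis power_add)
    then have "sqrt \<beta> ^ (3 * N ^ 4) * (1 / sqrt \<beta>) ^ (3 * N ^ 4 - 3) * (1 / sqrt (2 * pi * \<beta>)) ^ 3 =
       (sqrt \<beta> * (1 / sqrt \<beta>)) ^ (3 * N ^ 4 - 3) * (sqrt \<beta> * (1 / sqrt (2 * pi * \<beta>))) ^ 3"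
      by (simp only: power_mult_distrib mult_ac)
    also have "\<dots> = (1 / sqrt (2 * pi)) ^ 3"
      using \<beta> by (simp add: real_sqrt_mult)
    finally have "complex_of_real (sqrt \<beta> ^ (3 * N ^ 4)) * of_real ((1 / sqrt \<beta>) ^ (3 * N ^ 4 - 3)) * of_real ((1 / sqrt (2 * pi * \<beta>)) ^ 3) =
       of_real ((1 / sqrt (2 * pi)) ^ 3)" by (metis of_real_mult)
    note this[symmetric]
    then show ?thesis
      unfolding K_def Z[OF \<beta>] theta_pair_eq_lattice_theta[OF \<beta>]
      by (simp only: of_real_mult power_mult_distrib of_real_power mult_ac)
  qed
  have resc: "rescaled_partition_function N \<tau> = K * of_real (lattice_theta \<tau>) ^ 3" if "Im \<tau> > 0" for \<tau>
  proof -
    have t: "tau (Im \<tau> / (2 * pi)) (2 * pi * Re \<tau>) = \<tau>" by (simp add: tau_def complex_eq_iff)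
    show ?thesis
      using resc'[of "Im \<tau> / (2 * pi)" "2 * pi * Re \<tau>"] that
      unfolding rescaled_partition_function_def Let_def t by simp
  qed
  \<comment> \<open>Invariance under the whole group comes directly from
    \<open>lattice_theta\<close>; the two functional equations below are read off from it.\<close>
  have modular: "rescaled_partition_function N ((of_int a * \<tau> + of_int b) / (of_int c * \<tau> + of_int d)) =
     rescaled_partition_function N \<tau>"
    if det: "a * d - b * c = 1" and y: "Im \<tau> > 0" for a b c d :: int and \<tau>
  proof -
    have "Im ((of_int a * \<tau> + of_int b) / (of_int c * \<tau> + of_int d)) > 0"
      using Im_moebius[OF det y] y by simp
    then show ?thesis using resc y lattice_theta_modular[OF det y] by simp
  qed
  have Im_tau: "Im (tau \<beta> \<theta>) > 0" if "\<beta> > 0" for \<beta> \<theta> using that by (simp add: tau_def)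
  have T: "partition_function N \<beta> (\<theta> + 2 * pi) = partition_function N \<beta> \<theta>" if \<beta>: "\<beta> > 0" for \<beta> \<theta>
  proof -
    \<comment> \<open>The translation matrix with rows (1, 1) and (0, 1). It fixes \<beta>, so the
      rescaling factors agree and cancel.\<close>
    have "tau \<beta> (\<theta> + 2 * pi) = (of_int 1 * tau \<beta> \<theta> + of_int 1) / (of_int 0 * tau \<beta> \<theta> + of_int 1)"
      by (simp add: tau_def add_divide_distrib)
    then have "rescaled_partition_function N (tau \<beta> (\<theta> + 2 * pi)) = rescaled_partition_function N (tau \<beta> \<theta>)"
      using modular[OF _ Im_tau[OF \<beta>], of 1 1 1 0 \<theta>] by simp
    then show ?thesis using \<beta> by (simp add: rescaled_partition_function_tau)
  qed
  have dual: "- 1 / tau \<beta> \<theta> = tau (dual_beta \<beta> \<theta>) (dual_theta \<beta> \<theta>)" if \<beta>: "\<beta> > 0" for \<beta> \<theta>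
  proof -
    define x y where "x = \<theta> / (2 * pi)" and "y = 2 * pi * \<beta>"
    define D where "D = y\<^sup>2 + x\<^sup>2"
    have "D > 0" unfolding D_def y_def using \<beta> by (intro add_pos_nonneg) auto
    have 1: "tau \<beta> \<theta> = Complex x y" by (simp add: tau_def complex_eq_iff x_def y_def)
    have 2: "tau (dual_beta \<beta> \<theta>) (dual_theta \<beta> \<theta>) = Complex (- x / D) (y / D)"
      unfolding dual_beta_def dual_theta_def tau_def D_def x_def y_def by (simp add: complex_eq_iff)
    show ?thesis
      unfolding 1 2 using \<open>D > 0\<close> by (simp add: complex_eq_iff Re_divide Im_divide D_def add.commute)
  qed
  have S: "partition_function N \<beta> \<theta> = of_real (sqrt (dual_beta \<beta> \<theta> / \<beta>) ^ (3 * N ^ 4)) *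
              partition_function N (dual_beta \<beta> \<theta>) (dual_theta \<beta> \<theta>)" if \<beta>: "\<beta> > 0" for \<beta> \<theta>
  proof -
    \<comment> \<open>The inversion matrix with rows (0, -1) and (1, 0). Here the two rescaling
      factors differ, and their quotient is the prefactor in the duality.\<close>
    have "(of_int 0 * tau \<beta> \<theta> + of_int (- 1)) / (of_int 1 * tau \<beta> \<theta> + of_int 0) = tau (dual_beta \<beta> \<theta>) (dual_theta \<beta> \<theta>)"
      using dual[OF \<beta>] by simp
    then have "rescaled_partition_function N (tau (dual_beta \<beta> \<theta>) (dual_theta \<beta> \<theta>)) = rescaled_partition_function N (tau \<beta> \<theta>)"
      using modular[OF _ Im_tau[OF \<beta>], of 0 0 "- 1" 1 \<theta>] by simp
    then show ?thesis using \<beta>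
      by (simp add: rescaled_partition_function_tau real_sqrt_divide power_divide field_simps)
  qed
  show ?thesis using modular T S dual by blast
qed

end
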